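(* Let $X\geq 3$, $C_1,C_2>0$, and fix $\mathbf{q}\in((\mathbb{Z}/8\mathbb{Z})^{*})^4$ and $\tilde{\mathbf{q}}=(\tilde q_0,\tilde q_1)\in((\mathbb{Z}/8\mathbb{Z})^{*})^2$. Fix odd integers $1\leq r_0,r_1,r_2,r_3,\tilde r_0,\tilde r_1\leq(\log X)^{C_1}$ and fix integers $1\leq c_{01},c_{23},\tilde c_0,\tilde c_1\leq(\log X)^{C_2}$. For any $\mathbf{m}=(m_0,m_1)\in\mathbb{N}^2$ define $$T(X,\mathbf{m})=\mathop{\sum\sum\sum\sum}_{\substack{\|n_0n_1c_{01},n_2n_3c_{23}\|\cdot\|m_0\tilde c_0,m_1\tilde c_1\|\leq X\\ \gcd(n_i,2r_i)=1\ \forall\,0\leq i\leq 3\\ n_i\equiv q_i\bmod 8\ \forall\,0\leq i\leq 3}}\frac{\psi_{m_0m_1}(n_0n_2)}{\tau(n_0)\tau(n_1)\tau(n_2)\tau(n_3)},$$ the sum being over $(n_0,n_1,n_2,n_3)\in\mathbb{N}^4$. Then for any $C_3>0$, $$\mathop{\sum\sum}_{\substack{\|m_0,m_1\|\leq(\log X)^{C_3}\\ m_i\equiv\tilde q_i\bmod 8\ \forall\,0\leq i\leq 1\\ \gcd(m_i,\tilde r_i)=1\ \forall\,0\leq i\leq 1\\ m_0m_1\neq 1}}\frac{\mu^2(m_0m_1)}{\tau(m_0)\tau(m_1)}|T(X,\mathbf{m})|\ll_{C_1,C_2,C_3}\frac{\tau(r_0)\tau(r_2)X^2(\log\log X)^{1/2}}{c_{01}c_{23}\tilde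 c_0\tilde c_1(\log X)},$$ where the implied constant depends at most on $C_1,C_2,C_3$.
   Context: $\mathbb{N}$ is the set of positive integers, $\|a,b\|=\max\{|a|,|b|\}$, $\tau$ is the divisor-counting function, $\mu$ the Möbius function, $(\mathbb{Z}/8\mathbb{Z})^*$ the group of units modulo $8$. For an odd positive integer $m$, $\psi_m(\cdot)$ denotes generically either the Jacobi symbol $\left(\frac{\cdot}{m}\right)$ or the Jacobi symbol $\left(\frac{m}{\cdot}\right)$ (evaluated at odd positive integers); the statement holds for either choice. $A\ll B$ means $|A|\leq CB$ for a constant $C>0$ with the stated dependence. *)

theory Defs
  imports Complex_Main "HOL-Number_Theory.Number_Theory" "HOL-Computational_Algebra.Squarefree"
begin

definition divisor_tau :: "nat \<Rightarrow> nat" where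
  "divisor_tau n = card {d. d dvd n}"

definition moebius :: "nat \<Rightarrow> int" where
  "moebius n = (if squarefree n then (-1) ^ card (prime_factors n) else 0)"

text \<open>The Jacobi symbol $(a / m)$, meaningful for odd positive \<open>m\<close>; prime factors of \<open>m\<close>
  are taken with multiplicity.\<close>

definition jacobi :: "int \<Rightarrow> nat \<Rightarrow> int" where
  "jacobi a m = (\<Prod>p\<in>#prime_factorization m. Legendre a (int p))"

text \<open>The two possible meanings of the symbol $\psi_m(n)$: as a function of \<open>n\<close> it is
  $(n / m)$ or $(m / n)$. The first argument is the index \<open>m\<close>.\<close>

definition jacobi_symbols :: "(nat \<Rightarrow> nat \<Rightarrow> int) set" where
  "jacobi_symbols = {\<lambda>m n. jacobi (int n) m, \<lambda>m n. jacobi (int m) n}"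

text \<open>The range of summation of \<open>T_sum\<close>. Residue classes modulo 8 are given by
  representatives \<open>q i\<close>; only the values of \<open>q\<close> and \<open>r\<close> at 0, 1, 2, 3 matter. The set is finite
  whenever \<open>c01\<close>, \<open>c23\<close> and \<open>max (m0 * d0) (m1 * d1)\<close> are positive, since the \<open>n\<close>'s are.\<close>

definition T_range ::
  "(nat \<Rightarrow> nat) \<Rightarrow> (nat \<Rightarrow> nat) \<Rightarrow> nat \<Rightarrow> nat \<Rightarrow> nat \<Rightarrow> nat \<Rightarrow> real \<Rightarrow> nat \<Rightarrow> nat
    \<Rightarrow> (nat \<times> nat \<times> nat \<times> nat) set" where
  "T_range q r c01 c23 d0 d1 X m0 m1 =
     {(n0, n1, n2, n3).
        n0 > 0 \<and> n1 > 0 \<and> n2 > 0 \<and> n3 > 0 \<and>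
        real (max (n0 * n1 * c01) (n2 * n3 * c23) * max (m0 * d0) (m1 * d1)) \<le> X \<and>
        coprime n0 (2 * r 0) \<and> coprime n1 (2 * r 1) \<and>
        coprime n2 (2 * r 2) \<and> coprime n3 (2 * r 3) \<and>
        [n0 = q 0] (mod 8) \<and> [n1 = q 1] (mod 8) \<and>
        [n2 = q 2] (mod 8) \<and> [n3 = q 3] (mod 8)}"

definition T_sum ::
  "(nat \<Rightarrow> nat \<Rightarrow> int) \<Rightarrow> (nat \<Rightarrow> nat) \<Rightarrow> (nat \<Rightarrow> nat) \<Rightarrow> nat \<Rightarrow> nat \<Rightarrow> nat \<Rightarrow> nat
    \<Rightarrow> real \<Rightarrow> nat \<Rightarrow> nat \<Rightarrow> real" where
  "T_sum \<psi> q r c01 c23 d0 d1 X m0 m1 =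
     (\<Sum>(n0, n1, n2, n3) \<in> T_range q r c01 c23 d0 d1 X m0 m1.
        real_of_int (\<psi> (m0 * m1) (n0 * n2)) /
        (real (divisor_tau n0) * real (divisor_tau n1) *
         real (divisor_tau n2) * real (divisor_tau n3)))"

definition m_range ::
  "(nat \<Rightarrow> nat) \<Rightarrow> (nat \<Rightarrow> nat) \<Rightarrow> real \<Rightarrow> real \<Rightarrow> (nat \<times> nat) set" where
  "m_range qt rt C3 X =
     {(m0, m1).
        m0 > 0 \<and> m1 > 0 \<and>
        real (max m0 m1) \<le> ln X powr C3 \<and>
        [m0 = qt 0] (mod 8) \<and> [m1 = qt 1] (mod 8) \<and>
        coprime m0 (rt 0) \<and> coprime m1 (rt 1) \<and>
        m0 * m1 \<noteq> 1}"

end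

theory Submission
  imports Defs "HOL-Real_Asymp.Real_Asymp" "HOL-Analysis.Convex"
begin

text \<open>
  The inner sum factors. With \<open>M = max (m0 * ct0) (m1 * ct1)\<close> the size condition says
  \<open>n0 * n1 \<le> X / (M * c01)\<close> and \<open>n2 * n3 \<le> X / (M * c23)\<close>, and the symbol is completely
  multiplicative, so \<open>T\<close> is a product of two sums over regions \<open>n0 * n1 \<le> N\<close>
  (\<open>T_sum_factor\<close>). By reciprocity the two readings of \<open>\<psi>\<close> differ by a sign that is constant on
  the residue classes involved (\<open>T_sum_other_symbol\<close>). Detecting the classes modulo 8 by the four
  real characters \<open>\<chi>\<close> modulo 8 turns each factor into a combination of sums over \<open>n \<le> N\<close> of
  multiplicative functions \<open>g\<close>, each the convolution of two twists of \<open>1 / \<tau>\<close>.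

  Only an upper bound is wanted, so neither zeros of \<open>L\<close>-functions nor an asymptotic formula enter.
  At a prime not dividing the \<open>r\<close>'s one has \<open>\<bar>g p\<bar> \<le> (1 + f p) / 2\<close>, where
  \<open>f\<close> is the real character given by \<open>\<psi>\<close> times two characters modulo 8. A
  non-negative multiplicative function of moderate size at prime powers has mean value at most a constant times \<open>1 / ln N\<close> times its
  logarithmic sum (\<open>multf_mean_le_log_mean\<close>, after Hall and Tenenbaum). The square of the
  logarithmic sum of \<open>\<bar>g\<bar>\<close> is bounded by that of \<open>h = 1 * f\<close>, up to the cost of the coprimality
  conditions (\<open>twist_conv_mean_square\<close>), and the logarithmic sum of \<open>h\<close> is at most about \<open>ln N\<close>
  times a partial sum of \<open>L(1, f)\<close> (\<open>divisor_log_sum_le_char\<close>). That partial sum is in turn,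
  apart from small errors, at most the mean value of \<open>h\<close> up to \<open>Q ^ 3\<close>, where \<open>Q\<close> bounds the period of
  \<open>f\<close>, and the mean value theorem bounds it by a short Euler product
  \<open>E = exp (\<Sum>p \<le> z. f p / p)\<close>, at a cost of \<open>ln Q / ln z\<close> (\<open>char_mean_le_short_product\<close>). Altogether
  \<open>T\<close> is bounded by \<open>X\<^sup>2 / (M\<^sup>2 * c01 * c23 * ln X)\<close> times a sum of
  terms \<open>(ln Q / ln z) * E + 1\<close> over pairs of characters and the coprimality cost (\<open>T_sum_pointwise\<close>).

  For a single modulus \<open>E\<close> could be as large as \<open>ln z\<close>, but over \<open>m0 \<le> U0\<close>, \<open>m1 \<le> U1\<close> its mean square
  is bounded (\<open>short_product_mean_square\<close>). Indeed \<open>E\<^sup>2\<close> is essentially a sum over the squarefree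
  products \<open>n\<close> of primes up to \<open>z\<close>; such an \<open>n > 1\<close> is never a square, so the symbols \<open>(n / m)\<close> cancel
  when \<open>m\<close> runs over an interval, which settles small \<open>n\<close>, while Rankin's trick discards large
  \<open>n\<close>. The choice \<open>ln z = (ln Q) powr (7 / 8)\<close> leaves the loss \<open>ln Q / ln z\<close> of order \<open>(ln Q) powr (1 / 8)\<close>.
  Combined by Cauchy and Schwarz with the saving in the mean of \<open>1 / \<tau>\<^sup>2\<close>, the box contributes at most a
  constant times \<open>U0 * U1 * (1 + ln (min U0 U1)) powr (-5 / 8)\<close> (\<open>box_average\<close>). Splitting \<open>M\<close> into
  dyadic ranges, of which there are \<open>O(ln (ln X))\<close>, gives \<open>(ln (ln X)) powr (3 / 8)\<close>
  (\<open>dyadic_sum_le\<close>). The primes dividing \<open>r 1\<close> and \<open>r 3\<close> cost at most another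
  \<open>(ln (ln X)) powr (1 / 8)\<close>, those dividing \<open>r 0\<close> and \<open>r 2\<close> at most \<open>\<tau> (r 0) * \<tau> (r 2)\<close>; the
  exponents add up to \<open>1 / 2\<close>. For bounded \<open>X\<close> the estimate is a matter of the constant.
\<close>

section \<open>Notation\<close>

abbreviation tau :: "nat \<Rightarrow> real" where
  "tau n \<equiv> real (divisor_tau n)"

abbreviation jac :: "nat \<Rightarrow> nat \<Rightarrow> real" where
  "jac n m \<equiv> real_of_int (jacobi (int n) m)"

section \<open>Chebyshev and Mertens estimates\<close>

definition primes_le :: "nat \<Rightarrow> nat set" where
  "primes_le n = {p. prime p \<and> p \<le> n}"

lemma finite_primes_le [simp, intro]: "finite (primes_le n)"
  by (rule finite_subset[of _ "{..n}"]) (auto simp: primes_le_def)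

lemma primes_le_Suc: "primes_le (Suc n) = (if prime (Suc n) then insert (Suc n) (primes_le n) else primes_le n)"
  by (auto simp: primes_le_def le_Suc_eq)

lemma primes_le_mono: "m \<le> n \<Longrightarrow> primes_le m \<subseteq> primes_le n"
  by (auto simp: primes_le_def)

lemma prod_coprime_dvd:
  fixes f :: "nat \<Rightarrow> nat"
  assumes "finite A" "\<And>x y. x \<in> A \<Longrightarrow> y \<in> A \<Longrightarrow> x \<noteq> y \<Longrightarrow> coprime (f x) (f y)"
    "\<And>x. x \<in> A \<Longrightarrow> f x dvd n"
  shows "prod f A dvd n"
  using assms
proof (induction A rule: finite_induct)
  case (insert x F)
  have "coprime (f x) (prod f F)"
    using insert by (intro prod_coprime_right) auto
  then show ?case
    using insert by (auto intro!: divides_mult)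
qed auto

lemma central_binomial_le: "(2 * k + 1) choose k \<le> 4 ^ k"
proof -
  have "(2 * k + 1 choose k) + (2 * k + 1 choose (k + 1)) = (\<Sum>i\<in>{k, k + 1}. 2 * k + 1 choose i)"
    by simp
  also have "\<dots> \<le> (\<Sum>i\<le>2 * k + 1. 2 * k + 1 choose i)"
    by (rule sum_mono2) auto
  also have "\<dots> = 2 ^ (2 * k + 1)"
    by (rule choose_row_sum)
  finally have "(2 * k + 1 choose k) + (2 * k + 1 choose (k + 1)) \<le> 2 * 4 ^ k"
    by (simp add: power_mult)
  moreover have "(2 * k + 1 choose (k + 1)) = (2 * k + 1 choose k)"
    by (subst binomial_symmetric) auto
  ultimately show ?thesis by simp
qed

text \<open>The primes in \<open>{k + 2..2 * k + 1}\<close> divide a binomial coefficient that is at most \<open>4 ^ k\<close>; the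
  smaller primes are covered by induction. Even numbers above 2 add no new prime.\<close>

lemma prod_primes_le: "\<Prod>(primes_le n) \<le> 4 ^ n"
proof (induction n rule: less_induct)
  case (less n)
  consider "n \<le> 2" | k where "n = 2 * k" "k \<ge> 2" | k where "n = 2 * k + 1" "k \<ge> 1"
    by (cases "even n") (auto elim!: evenE oddE, linarith, force)
  then show ?case
  proof cases
    case 1
    then have "n = 0 \<or> n = 1 \<or> n = 2" by auto
    moreover have "primes_le 0 = {}" "primes_le (Suc 0) = {}" "primes_le 2 = {2}"
      by (auto simp: primes_le_def dest: prime_ge_2_nat)
    ultimately show ?thesis by auto
  next
    case 2
    then have np: "\<not> prime n" using prime_odd_nat[of n] by auto
    have n: "n = Suc (n - 1)" using 2 by simp
    have "primes_le n = primes_le (n - 1)"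
      using np by (subst n, subst primes_le_Suc) (use n in simp)
    moreover have "\<Prod>(primes_le (n - 1)) \<le> 4 ^ (n - 1)" using less[of "n - 1"] n by simp
    moreover have "(4::nat) ^ (n - 1) \<le> 4 ^ n" by (rule power_increasing) auto
    ultimately show ?thesis by (metis le_trans)
  next
    case (3 k)
    define B where "B = {p. prime p \<and> k + 1 < p \<and> p \<le> 2 * k + 1}"
    have fB: "finite B" by (rule finite_subset[of _ "{..n}"]) (auto simp: B_def 3)
    have eq: "primes_le n = primes_le (k + 1) \<union> B" "primes_le (k + 1) \<inter> B = {}"
      using 3 by (auto simp: primes_le_def B_def)
    have "\<Prod>B dvd (2 * k + 1 choose k)"
    proof (rule prod_coprime_dvd[OF fB])
      fix p assume p: "p \<in> B"
      then have pr: "prime p" by (auto simp: B_def)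
      have "p dvd fact (2 * k + 1)" using p pr by (simp add: prime_dvd_fact_iff B_def del: fact_Suc)
      also have "(fact (2 * k + 1) :: nat) = fact k * fact (k + 1) * (2 * k + 1 choose k)"
        using binomial_fact_lemma[of k "2 * k + 1"] by (simp add: Suc_diff_le algebra_simps del: fact_Suc)
      finally have "p dvd fact k \<or> p dvd fact (k + 1) \<or> p dvd (2 * k + 1 choose k)"
        using pr by (simp add: prime_dvd_mult_iff del: fact_Suc)
      moreover have "\<not> p dvd fact k" "\<not> p dvd fact (k + 1)"
        using p pr by (auto simp: prime_dvd_fact_iff B_def simp del: fact_Suc)
      ultimately show "p dvd (2 * k + 1 choose k)" by auto
    qed (auto simp: B_def primes_coprime)
    then have "\<Prod>B \<le> (2 * k + 1 choose k)"
      by (intro dvd_imp_le) auto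
    then have b: "\<Prod>B \<le> 4 ^ k" using central_binomial_le[of k] by simp
    have "\<Prod>(primes_le n) = \<Prod>(primes_le (k + 1)) * \<Prod>B"
      unfolding eq(1) by (rule prod.union_disjoint) (use eq fB in auto)
    also have "\<dots> \<le> 4 ^ (k + 1) * 4 ^ k"
      using less[of "k + 1"] b 3 by (intro mult_mono) auto
    also have "\<dots> = 4 ^ n" using 3 by (simp add: power_add mult_2)
    finally show ?thesis .
  qed
qed

lemma chebyshev_theta: "(\<Sum>p\<in>primes_le n. ln (real p)) \<le> real n * ln 4"
proof -
  have pos: "\<And>p. p \<in> primes_le n \<Longrightarrow> real p > 0" by (auto simp: primes_le_def prime_gt_0_nat)
  have "(\<Sum>p\<in>primes_le n. ln (real p)) = ln (\<Prod>p\<in>primes_le n. real p)"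
    using pos by (intro ln_prod[symmetric]) auto
  also have "(\<Prod>p\<in>primes_le n. real p) = real (\<Prod>(primes_le n))"
    by simp
  also have "ln (real (\<Prod>(primes_le n))) \<le> ln (real (4 ^ n))"
  proof (rule ln_mono)
    show "0 < real (\<Prod>(primes_le n))" using pos by (simp add: prod_pos)
    show "real (\<Prod>(primes_le n)) \<le> real (4 ^ n)" using prod_primes_le[of n] of_nat_mono by blast
  qed
  also have "\<dots> = real n * ln 4" by (simp add: ln_realpow)
  finally show ?thesis .
qed

lemma power_dvd_fact_mult:
  assumes "p > 0"
  shows "p ^ k dvd (fact (p * k) :: nat)"
proof (induction k)
  case (Suc k)
  have False: "p \<noteq> 0" using assms by simp
    have "p * p ^ k dvd (p * k + p) * (fact (p * k + p - 1) :: nat)"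
    proof (rule mult_dvd_mono)
      show "p ^ k dvd fact (p * k + p - 1)"
        using Suc False by (rule_tac dvd_trans[OF Suc]) (auto intro!: fact_dvd)
    qed (simp add: dvd_add)
    also have "(p * k + p) * (fact (p * k + p - 1) :: nat) = fact (p * Suc k)"
      using False fact_reduce[of "p * k + p", where ?'a = nat] by (simp add: algebra_simps)
    finally show ?case by simp
qed auto

lemma real_div_ge: "real n / real d - 1 \<le> real (n div d)"
proof -
  have "real n / real d - 1 \<le> of_int \<lfloor>real n / real d\<rfloor>" by linarith
  also have "\<lfloor>real n / real d\<rfloor> = int (n div d)" by (simp add: floor_divide_of_nat_eq)
  finally show ?thesis by simp
qed

text \<open>The product of the \<open>p ^ (n div p)\<close> divides \<open>n!\<close>, which is at most \<open>n ^ n\<close>; replacing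
  \<open>n div p\<close> by \<open>n / p\<close> costs a Chebyshev sum.\<close>

lemma mertens_log:
  assumes "n \<ge> 1"
  shows "(\<Sum>p\<in>primes_le n. ln (real p) / real p) \<le> ln (real n) + ln 4"
proof -
  have pos: "\<And>p. p \<in> primes_le n \<Longrightarrow> real p > 0" by (auto simp: primes_le_def prime_gt_0_nat)
  have "(\<Prod>p\<in>primes_le n. p ^ (n div p)) dvd (fact n :: nat)"
  proof (rule prod_coprime_dvd)
    fix p assume "p \<in> primes_le n"
    have "p ^ (n div p) dvd (fact (p * (n div p)) :: nat)" 
      using pos[of p] \<open>p \<in> primes_le n\<close> by (intro power_dvd_fact_mult) auto
    also have "\<dots> dvd fact n" by (rule fact_dvd) simp
    finally show "p ^ (n div p) dvd (fact n :: nat)" .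
  qed (auto simp: primes_le_def primes_coprime)
  then have "(\<Prod>p\<in>primes_le n. p ^ (n div p)) \<le> (fact n :: nat)"
    by (rule dvd_imp_le) simp
  also have "(fact n :: nat) \<le> n ^ n" using fact_le_power[of n, where ?'a = nat] by simp
  finally have le: "real (\<Prod>p\<in>primes_le n. p ^ (n div p)) \<le> real (n ^ n)" by (rule of_nat_mono)
  have "(\<Sum>p\<in>primes_le n. real (n div p) * ln (real p)) = ln (\<Prod>p\<in>primes_le n. real p ^ (n div p))"
    using pos by (subst ln_prod) (auto simp: ln_realpow)
  also have "\<dots> \<le> ln (real (n ^ n))"
    using le pos assms by (intro ln_mono) (auto intro!: prod_pos)
  also have "\<dots> = real n * ln (real n)" using assms by (simp add: ln_realpow)
  finally have 1: "(\<Sum>p\<in>primes_le n. real (n div p) * ln (real p)) \<le> real n * ln (real n)" .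
  have "(\<Sum>p\<in>primes_le n. (real n / real p - 1) * ln (real p)) \<le>
      (\<Sum>p\<in>primes_le n. real (n div p) * ln (real p))"
  proof (intro sum_mono mult_right_mono)
    fix p assume p: "p \<in> primes_le n"
    show "real n / real p - 1 \<le> real (n div p)" 
      by (rule real_div_ge)
    show "0 \<le> ln (real p)" using p prime_ge_1_nat[of p] by (auto simp: primes_le_def)
  qed
  also note 1
  finally have "real n * (\<Sum>p\<in>primes_le n. ln (real p) / real p) - (\<Sum>p\<in>primes_le n. ln (real p))
      \<le> real n * ln (real n)"
    by (simp add: algebra_simps sum_subtractf sum_distrib_left)
  then have "real n * (\<Sum>p\<in>primes_le n. ln (real p) / real p) \<le> real n * (ln (real n) + ln 4)"
    using chebyshev_theta[of n] by (simp add: algebra_simps)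
  then show ?thesis using assms by (simp add: mult_le_cancel_left)
qed

lemma ln2_ge_half: "ln 2 \<ge> (1 / 2 :: real)"
  using ln_le_minus_one[of "1 / 2 :: real"] by (simp add: ln_div)

text \<open>One step of the partial summation in the next lemma, with \<open>a = ln n\<close>, \<open>b = ln (n + 1)\<close>: the main
  term \<open>1 - a / b\<close> is at most \<open>ln b - ln a\<close> and telescopes.\<close>

lemma partial_summation_step:
  fixes a b c A :: real
  assumes "a > 0" "a \<le> b" "A \<le> a + c"
  shows "A / a - A / b \<le> ln b - ln a + c / a - c / b"
proof -
  have "1 / a - 1 / b \<ge> 0" using assms by (simp add: frac_le)
  then have "A * (1 / a - 1 / b) \<le> (a + c) * (1 / a - 1 / b)"
    using assms(3) by (intro mult_right_mono)
  also have "\<dots> = (1 - a / b) + c / a - c / b"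
    using assms by (simp add: add_divide_distrib right_diff_distrib)
  also have "1 - a / b \<le> ln b - ln a"
  proof -
    have "ln (a / b) \<le> a / b - 1" using assms by (intro ln_le_minus_one) auto
    then show ?thesis using assms by (simp add: ln_div)
  qed
  finally show ?thesis by (simp add: algebra_simps)
qed

text \<open>Partial summation from the sum of \<open>ln p / p\<close>. The leading coefficient of \<open>ln (ln n)\<close> has to be exactly 1,
  since the exponential of this sum is compared with a power of \<open>ln n\<close> later on.\<close>

lemma mertens_recip_upper:
  assumes "n \<ge> 2"
  shows "(\<Sum>p\<in>primes_le n. 1 / real p) \<le> ln (ln (real n)) + 5"
proof -
  define S where "S n = (\<Sum>p\<in>primes_le n. 1 / real p)" for n
  define A where "A n = (\<Sum>p\<in>primes_le n. ln (real p) / real p)" for n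
  have ln2: "ln 2 > (1/4 :: real)" "ln 2 \<ge> (1/2 :: real)" using ln_le_minus_one[of "1/2 :: real"] by (auto simp: ln_div)
  \<comment> \<open>After subtracting \<open>A n / ln n\<close> the increment is the same whether or not \<open>n + 1\<close> is prime.\<close>
  have "S n - A n / ln (real n) \<le> ln (ln (real n)) - ln (ln 2) + ln 4 / ln 2 - ln 4 / ln (real n)"
    using assms
  proof (induction n rule: dec_induct)
    case base
    have "primes_le 2 = {2}" by (auto simp: primes_le_def dest: prime_ge_2_nat)
    then show ?case by (simp add: S_def A_def)
  next
    case (step n)
    have n: "real n \<ge> 2" using step by simp
    have pos: "ln (real n) > 0" "ln (real (Suc n)) > 0" "ln (real n) \<le> ln (real (Suc n))" using n by (auto simp: ln_mono)
    have d: "S (Suc n) - A (Suc n) / ln (real (Suc n)) = S n - A n / ln (real (Suc n))"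
    proof (cases "prime (Suc n)")
      case True
      have "Suc n \<notin> primes_le n" by (auto simp: primes_le_def)
      then have "S (Suc n) = S n + 1 / real (Suc n)" "A (Suc n) = A n + ln (real (Suc n)) / real (Suc n)"
        using True by (auto simp: S_def A_def primes_le_Suc)
      then show ?thesis using pos by (simp add: add_divide_distrib del: of_nat_Suc)
    qed (auto simp: S_def A_def primes_le_Suc)
    let ?a = "ln (real n)" and ?b = "ln (real (Suc n))"
    have "A n \<le> ?a + ln 4" unfolding A_def using mertens_log[of n] step by simp
    from partial_summation_step[OF pos(1,3) this] show ?case
      using step.IH d by linarith
  qed
  moreover have "A n \<le> ln (real n) + ln 4" using mertens_log[of n] assms by (simp add: A_def)
  then have "A n / ln (real n) \<le> 1 + ln 4 / ln (real n)" using assms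
      divide_right_mono[of "A n" "ln (real n) + ln 4" "ln (real n)"] by (simp add: add_divide_distrib)
  moreover have "ln 4 = 2 * ln (2::real)" using ln_realpow[of 2 2] by simp
  moreover have "- ln (ln 2) \<le> (1::real)"
  proof -
    have "ln (1 / 2) \<le> ln (ln (2::real))" using ln2 by (intro ln_mono) auto
    then have "- ln (ln 2) \<le> ln (2::real)" by (simp add: ln_div)
    then show ?thesis using ln_le_minus_one[of "2 :: real"] by simp
  qed
  moreover have "ln 4 / ln 2 = (2::real)" using ln_realpow[of 2 2] by simp
  ultimately show ?thesis unfolding S_def by linarith
qed

section \<open>Multiplicative functions and Dirichlet convolution\<close>

definition multf :: "(nat \<Rightarrow> real) \<Rightarrow> bool" where
  "multf f \<longleftrightarrow> f 1 = 1 \<and> (\<forall>a b. coprime a b \<longrightarrow> f (a * b) = f a * f b)"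

text \<open>Dirichlet convolution. At \<open>n = 0\<close> the sum ranges over an infinite set, so the value is 0.\<close>

definition dconv :: "(nat \<Rightarrow> real) \<Rightarrow> (nat \<Rightarrow> real) \<Rightarrow> nat \<Rightarrow> real" where
  "dconv f g n = (\<Sum>d | d dvd n. f d * g (n div d))"

lemma multfI: "f 1 = 1 \<Longrightarrow> (\<And>a b. a > 0 \<Longrightarrow> b > 0 \<Longrightarrow> coprime a b \<Longrightarrow> f (a * b) = f a * f b) \<Longrightarrow> multf f"
  unfolding multf_def
proof safe
  fix a b :: nat assume a: "f 1 = 1" "\<And>a b. a > 0 \<Longrightarrow> b > 0 \<Longrightarrow> coprime a b \<Longrightarrow> f (a * b) = f a * f b" "coprime a b"
  show "f (a * b) = f a * f b"
  proof (cases "a = 0 \<or> b = 0")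
    case True
    then show ?thesis using a by auto
  next
    case False
    then show ?thesis using a by auto
  qed
qed

lemma multf_1: "multf f \<Longrightarrow> f (Suc 0) = 1"
  by (auto simp: multf_def)

lemma multf_mult: "multf f \<Longrightarrow> coprime a b \<Longrightarrow> f (a * b) = f a * f b"
  by (auto simp: multf_def)

lemma multf_times: "multf f \<Longrightarrow> multf g \<Longrightarrow> multf (\<lambda>n. f n * g n)"
  by (auto simp: multf_def)

lemma multf_abs: "multf f \<Longrightarrow> multf (\<lambda>n. \<bar>f n\<bar>)"
  by (auto simp: multf_def abs_mult)

lemma multf_inverse: "multf f \<Longrightarrow> multf (\<lambda>n. 1 / f n)"
  by (auto simp: multf_def)

lemma bij_betw_divisors_mult:
  fixes a b :: nat
  assumes "coprime a b" "a > 0" "b > 0"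
  shows "bij_betw (\<lambda>(d, e). d * e) ({d. d dvd a} \<times> {e. e dvd b}) {n. n dvd a * b}"
proof (rule bij_betwI')
  fix x y assume x: "x \<in> {d. d dvd a} \<times> {e. e dvd b}" and y: "y \<in> {d. d dvd a} \<times> {e. e dvd b}"
  obtain d e d' e' where xy: "x = (d, e)" "y = (d', e')" by (metis surj_pair)
  have "d = d' \<and> e = e'" if "d * e = d' * e'"
  proof -
    have "coprime d e'" "coprime d' e"
      using x y xy assms(1) by (auto intro: coprime_divisors)
    then have "d dvd d'" "d' dvd d"
      using that by (metis coprime_dvd_mult_left_iff dvd_triv_left)+
    then have "d = d'" by (rule dvd_antisym)
    moreover have "d > 0" using x xy assms by (auto intro: Nat.gr0I)
    ultimately show ?thesis using that by auto
  qed
  then show "((case x of (d, e) \<Rightarrow> d * e) = (case y of (d, e) \<Rightarrow> d * e)) = (x = y)"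
    using xy by auto
next
  fix x assume "x \<in> {d. d dvd a} \<times> {e. e dvd b}"
  then show "(case x of (d, e) \<Rightarrow> d * e) \<in> {n. n dvd a * b}" by (auto intro: mult_dvd_mono)
next
  fix n assume "n \<in> {n. n dvd a * b}"
  then obtain d e where "n = d * e" "d dvd a" "e dvd b" by (auto elim: dvd_productE)
  then show "\<exists>x\<in>{d. d dvd a} \<times> {e. e dvd b}. n = (case x of (d, e) \<Rightarrow> d * e)" by auto
qed

lemma sum_divisors_mult:
  fixes a b :: nat
  assumes "coprime a b" "a > 0" "b > 0"
  shows "(\<Sum>d | d dvd a * b. F d) = (\<Sum>d | d dvd a. \<Sum>e | e dvd b. F (d * e))"
  using sum.reindex_bij_betw[OF bij_betw_divisors_mult[OF assms], of F]
  by (simp add: sum.cartesian_product case_prod_unfold)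

lemma multf_dconv:
  assumes "multf f" "multf g"
  shows "multf (dconv f g)"
proof (rule multfI)
  show "dconv f g 1 = 1" using assms by (simp add: dconv_def multf_1)
next
  fix a b :: nat assume ab: "a > 0" "b > 0" "coprime a b"
  have "dconv f g (a * b) = (\<Sum>d | d dvd a. \<Sum>e | e dvd b. f (d * e) * g (a * b div (d * e)))"
    unfolding dconv_def by (rule sum_divisors_mult) (use ab in auto)
  also have "\<dots> = (\<Sum>d | d dvd a. \<Sum>e | e dvd b. (f d * g (a div d)) * (f e * g (b div e)))"
  proof (intro sum.cong refl)
    fix d e assume de: "d \<in> {d. d dvd a}" "e \<in> {e. e dvd b}"
    have "coprime d e" using de ab by (auto intro: coprime_divisors)
    moreover have "coprime (a div d) (b div e)"
      using de ab by (auto intro!: coprime_divisors[of "a div d" a "b div e" b])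
    moreover have "a * b div (d * e) = (a div d) * (b div e)"
      using de by (simp add: div_mult_div_if_dvd)
    ultimately show "f (d * e) * g (a * b div (d * e)) = (f d * g (a div d)) * (f e * g (b div e))"
      using assms by (simp add: multf_mult)
  qed
  also have "\<dots> = dconv f g a * dconv f g b"
    by (simp add: dconv_def sum_product)
  finally show "dconv f g (a * b) = dconv f g a * dconv f g b" .
qed

lemma sum_divisors_prime_power:
  fixes p :: nat
  assumes "prime p"
  shows "(\<Sum>d | d dvd p ^ k. F d) = (\<Sum>i\<le>k. F (p ^ i))"
proof -
  have "{d. d dvd p ^ k} = (\<lambda>i. p ^ i) ` {..k}"
    using assms by (auto simp: divides_primepow_nat)
  moreover have "inj_on (\<lambda>i. p ^ i) {..k}"
    using assms prime_gt_1_nat[of p] by (auto simp: inj_on_def)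
  ultimately show ?thesis by (simp add: sum.reindex)
qed

lemma dconv_prime_power:
  assumes "prime p"
  shows "dconv f g (p ^ k) = (\<Sum>i\<le>k. f (p ^ i) * g (p ^ (k - i)))"
proof -
  have "dconv f g (p ^ k) = (\<Sum>i\<le>k. f (p ^ i) * g (p ^ k div p ^ i))"
    unfolding dconv_def by (rule sum_divisors_prime_power[OF assms])
  also have "\<dots> = (\<Sum>i\<le>k. f (p ^ i) * g (p ^ (k - i)))"
    using assms by (intro sum.cong refl) (auto simp: power_diff prime_gt_0_nat)
  finally show ?thesis .
qed

lemma dconv_nonneg: "(\<And>n. f n \<ge> 0) \<Longrightarrow> (\<And>n. g n \<ge> 0) \<Longrightarrow> dconv f g n \<ge> 0"
  by (auto simp: dconv_def intro!: sum_nonneg)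

lemma factor_le_bound: "0 < k \<Longrightarrow> b * k \<le> N \<Longrightarrow> b \<le> (N :: nat)"
  by (rule order_trans[of b "b * k"]) auto

text \<open>Opening the divisor sum under a summation over \<open>n\<close>: the pairs with product at most \<open>N\<close>.\<close>

lemma sum_divisor_pairs:
  fixes F :: "nat \<Rightarrow> nat \<Rightarrow> real"
  shows "(\<Sum>n = 1..N. \<Sum>d | d dvd n. F d (n div d)) = (\<Sum>a = 1..N. \<Sum>b = 1..N div a. F a b)"
proof -
  have fin: "finite {d. d dvd n}" if "n \<in> {1..N}" for n :: nat using that by auto
  have "(\<Sum>n = 1..N. \<Sum>d | d dvd n. F d (n div d)) = 
      (\<Sum>(n, d)\<in>Sigma {1..N} (\<lambda>n. {d. d dvd n}). F d (n div d))"
    using fin by (subst sum.Sigma) auto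
  also have "\<dots> = (\<Sum>(a, b)\<in>Sigma {1..N} (\<lambda>a. {1..N div a}). F a b)"
    by (rule sum.reindex_bij_witness[of _ "\<lambda>(a, b). (a * b, a)" "\<lambda>(n, d). (d, n div d)"])
       (auto simp: div_le_mono dvd_imp_le less_eq_div_iff_mult_less_eq mult.commute Suc_le_eq
          intro: factor_le_bound elim!: dvdE)
  also have "\<dots> = (\<Sum>a = 1..N. \<Sum>b = 1..N div a. F a b)"
    by (subst sum.Sigma) auto
  finally show ?thesis .
qed

section \<open>Euler product bounds for logarithmic means\<close>

lemma sum_recip_squares: "(\<Sum>n = 2..N. 1 / real n ^ 2) \<le> 1"
proof (cases "N \<ge> 1")
  case True
  then have "(\<Sum>n = 2..N. 1 / real n ^ 2) \<le> 1 - 1 / real N"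
  proof (induction N rule: dec_induct)
    case (step n)
    have "1 / real (Suc n) ^ 2 \<le> 1 / real n - 1 / real (Suc n)"
    proof -
      have "1 / real (Suc n) ^ 2 \<le> 1 / (real n * real (Suc n))"
        using step by (intro divide_left_mono) (auto simp: power2_eq_square)
      also have "\<dots> = 1 / real n - 1 / real (Suc n)" using step by (simp add: field_simps)
      finally show ?thesis .
    qed
    then show ?case using step by simp
  qed auto
  also have "\<dots> \<le> 1" by simp
  finally show ?thesis .
qed auto

lemma sum_ln_over_squares: "(\<Sum>n = 2..N. ln (real n) / real n ^ 2) \<le> 4"
proof (cases "N \<ge> 1")
  case True
  then have "(\<Sum>n = 2..N. ln (real n) / real n ^ 2) \<le> 4 - 4 / sqrt (real N)"
  proof (induction N rule: dec_induct)
    case (step n)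
    let ?a = "sqrt (real n)" and ?b = "sqrt (real (Suc n))"
    have pos: "?a > 0" "?b > 0" "?a \<le> ?b" using step by auto
    have sq: "?b ^ 2 = ?a ^ 2 + 1" "?b ^ 2 = real (Suc n)" by auto
    have "ln (real (Suc n)) = 2 * ln ?b" by (simp add: ln_sqrt)
    also have "\<dots> \<le> 2 * ?b" using pos ln_le_minus_one[of ?b] by simp
    finally have "ln (real (Suc n)) / real (Suc n) ^ 2 \<le> 2 * ?b / (?b ^ 2) ^ 2"
      unfolding sq(2) by (rule divide_right_mono) auto
    also have "\<dots> = 2 / ?b ^ 3"
    proof -
      have "2 * b / (b ^ 2) ^ 2 = 2 / b ^ 3" if "b > 0" for b :: real
        using that by (simp add: power2_eq_square power3_eq_cube)
      from this[OF pos(2)] show ?thesis .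
    qed
    also have "\<dots> \<le> 4 / ?a - 4 / ?b"
    proof -
      have "(?b - ?a) * (?b + ?a) = 1" using sq(1) by (simp add: algebra_simps power2_eq_square)
      then have d: "?b - ?a = 1 / (?b + ?a)"
        by (subst nonzero_eq_divide_eq) (use pos in linarith)+
      have "4 / ?a - 4 / ?b = 4 * (?b - ?a) / (?a * ?b)" using pos by (simp add: field_simps)
      also have "\<dots> = 4 / ((?b + ?a) * (?a * ?b))" unfolding d by simp
      also have "\<dots> \<ge> 4 / ((2 * ?b) * (?b * ?b))"
      proof -
        have "4 / ((b + a) * (a * b)) \<ge> 4 / ((2 * b) * (b * b))" if "0 < a" "0 < b" "a \<le> b" for a b :: real
          using that by (intro divide_left_mono mult_mono) auto
        from this[OF pos] show ?thesis .
      qed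
      also have "4 / ((2 * ?b) * (?b * ?b)) = 2 / ?b ^ 3" by (simp add: power3_eq_cube)
      finally show ?thesis .
    qed
    finally show ?case using step by simp
  qed auto
  also have "\<dots> \<le> 4" by simp
  finally show ?thesis .
qed auto

lemma sum_primes_le_mono:
  assumes "\<And>n. n \<ge> 2 \<Longrightarrow> F n \<ge> (0 :: real)"
  shows "(\<Sum>p\<in>primes_le N. F p) \<le> (\<Sum>n = 2..N. F n)"
  by (rule sum_mono2) (auto simp: primes_le_def prime_ge_2_nat assms)

lemma sum_primes_recip_squares: "(\<Sum>p\<in>primes_le N. 1 / real p ^ 2) \<le> 1"
  using sum_primes_le_mono[of "\<lambda>n. 1 / real n ^ 2" N] sum_recip_squares[of N] by simp

text \<open>Induction on \<open>Q\<close>, splitting off from \<open>n\<close> the exact power of one prime; the exponent is at most \<open>N\<close>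
  because \<open>k < 2 ^ k\<close>.\<close>

lemma smooth_sum_le_prod:
  fixes f :: "nat \<Rightarrow> real"
  assumes "multf f" and nn: "\<And>n. f n \<ge> 0" and "finite Q" "\<And>p. p \<in> Q \<Longrightarrow> prime p"
  shows "(\<Sum>n\<in>{n \<in> {1..N}. prime_factors n \<subseteq> Q}. f n) \<le> (\<Prod>p\<in>Q. \<Sum>k\<le>N. f (p ^ k))"
  using assms(3,4)
proof (induction Q rule: finite_induct)
  case empty
  have "{n \<in> {1..N}. prime_factors n \<subseteq> {}} \<subseteq> {1}"
    using prime_factorization_empty_iff[where ?'a = nat] by auto
  then have "(\<Sum>n\<in>{n \<in> {1..N}. prime_factors n \<subseteq> {}}. f n) \<le> (\<Sum>n\<in>{1}. f n)"
    by (intro sum_mono2) (auto simp: nn)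
  then show ?case using assms(1) by (simp add: multf_1)
next
  case (insert p Q)
  have p: "prime p" using insert by auto
  let ?A = "{n \<in> {1..N}. prime_factors n \<subseteq> insert p Q}" and ?B = "{n \<in> {1..N}. prime_factors n \<subseteq> Q}"
  have "(\<Sum>n\<in>?A. f n) \<le> (\<Sum>(k, m)\<in>{..N} \<times> ?B. f (p ^ k) * f m)"
  proof (rule sum_le_included[where i = "\<lambda>(k, m). p ^ k * m"])
    show "\<forall>n\<in>?A. \<exists>y\<in>{..N} \<times> ?B. (case y of (k, m) \<Rightarrow> p ^ k * m) = n \<and> f n \<le> (case y of (k, m) \<Rightarrow> f (p ^ k) * f m)"
    proof
      fix n assume n: "n \<in> ?A"
      define k where "k = multiplicity p n"
      have "n \<noteq> 0" "\<not> is_unit p" using n p by auto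
      then obtain m where m: "n = p ^ k * m" "\<not> p dvd m"
        using multiplicity_decompose'[of n p] unfolding k_def by blast
      have m0: "m > 0" using m n by (auto intro: Nat.gr0I)
      have "k < 2 ^ k" by simp
      also have "(2::nat) ^ k \<le> p ^ k" using p prime_ge_2_nat by (intro power_mono) auto
      also have "p ^ k \<le> n" using m m0 by simp
      finally have k: "k \<le> N" using n by simp
      have "m \<le> n" using m n by simp
      moreover have "prime_factors m \<subseteq> prime_factors n - {p}"
        using m m0 p by (auto simp: prime_factors_dvd)
      ultimately have mB: "m \<in> ?B" using n m0 by auto
      have "coprime (p ^ k) m" using m p by (auto simp: prime_imp_coprime intro: coprime_power_left_iff[THEN iffD2])
      then have "f n = f (p ^ k) * f m" using m assms(1) by (simp add: multf_mult)
      then show "\<exists>y\<in>{..N} \<times> ?B. (case y of (k, m) \<Rightarrow> p ^ k * m) = n \<and> f n \<le> (case y of (k, m) \<Rightarrow> f (p ^ k) * f m)"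
        using k mB m by (intro bexI[of _ "(k, m)"]) auto
    qed
  qed (auto simp: nn)
  also have "\<dots> = (\<Sum>k\<le>N. f (p ^ k)) * (\<Sum>n\<in>?B. f n)"
    by (simp add: sum_product sum.cartesian_product)
  also have "\<dots> \<le> (\<Sum>k\<le>N. f (p ^ k)) * (\<Prod>p\<in>Q. \<Sum>k\<le>N. f (p ^ k))"
    using insert by (intro mult_left_mono) (auto intro!: sum_nonneg nn)
  also have "\<dots> = (\<Prod>p\<in>insert p Q. \<Sum>k\<le>N. f (p ^ k))"
    using insert by simp
  finally show ?case .
qed

text \<open>Comparison with the prime 2: since the sum starts at exponent 2, the quotient of the terms is at
  most \<open>4 / p\<^sup>2\<close>, so these tails are summable over the primes.\<close>

lemma weighted_geometric_tail:
  fixes w :: "nat \<Rightarrow> real"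
  assumes p: "p \<ge> 2" and w: "\<And>k. w k \<ge> 0" and c: "(\<Sum>k = 2..N. w k / 2 ^ k) \<le> c"
  shows "(\<Sum>k = 2..N. w k / real p ^ k) \<le> 4 * c / real p ^ 2"
proof -
  have "(\<Sum>k = 2..N. w k / real p ^ k) \<le> (\<Sum>k = 2..N. 4 / real p ^ 2 * (w k / 2 ^ k))"
  proof (rule sum_mono)
    fix k assume "k \<in> {2..N}"
    then obtain j where j: "k = j + 2" by (metis atLeastAtMost_iff le_add_diff_inverse2)
    have pk: "real p ^ k = real p ^ 2 * real p ^ j" unfolding j by (simp only: power_add mult.commute)
    have "(2::real) ^ j \<le> real p ^ j" using p by (intro power_mono) auto
    then have "w k / (real p ^ 2 * real p ^ j) \<le> w k / (real p ^ 2 * 2 ^ j)"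
      using p w by (intro divide_left_mono mult_left_mono) auto
    also have "\<dots> = 4 / real p ^ 2 * (w k / 2 ^ k)"
    proof -
      have "x / (P * 2 ^ j) = 4 / P * (x / 2 ^ (j + 2))" for x P :: real by (simp add: power_add)
      then show ?thesis by (simp only: j)
    qed
    finally show "w k / real p ^ k \<le> 4 / real p ^ 2 * (w k / 2 ^ k)" unfolding pk .
  qed
  also have "\<dots> = 4 / real p ^ 2 * (\<Sum>k = 2..N. w k / 2 ^ k)" by (rule sum_distrib_left[symmetric])
  also have "\<dots> \<le> 4 / real p ^ 2 * c" by (intro mult_left_mono c) auto
  finally show ?thesis by simp
qed

lemma sum_linear_over_power:
  assumes "p \<ge> 2"
  shows "(\<Sum>k = 2..N. (real k + 1) / real p ^ k) \<le> 8 / real p ^ 2"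
proof -
  have "(\<Sum>k = 2..N. (real k + 1) / 2 ^ k) \<le> (2 :: real)"
  proof (cases "N \<ge> 1")
    case True
    then have "(\<Sum>k = 2..N. (real k + 1) / 2 ^ k) \<le> 2 - (real N + 3) / 2 ^ N"
    proof (induction N rule: dec_induct)
      case (step n)
      have "(real (Suc n) + 1) / 2 ^ Suc n = (real n + 3) / 2 ^ n - (real (Suc n) + 3) / 2 ^ Suc n"
        by (simp add: field_simps)
      then show ?case using step by simp
    qed auto
    also have "\<dots> \<le> 2" by simp
    finally show ?thesis .
  qed auto
  from weighted_geometric_tail[OF assms _ this] show ?thesis by simp
qed

text \<open>The bound by \<open>k + 1\<close> makes the prime powers with \<open>k \<ge> 2\<close> contribute \<open>O(1 / p\<^sup>2)\<close> to the local factor at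
  \<open>p\<close>, hence a constant to the product; what remains is the first-order term.\<close>

lemma sum_le_euler_product:
  fixes g :: "nat \<Rightarrow> real"
  assumes "multf g" and nn: "\<And>n. g n \<ge> 0" and pp: "\<And>p k. prime p \<Longrightarrow> g (p ^ k) \<le> real k + 1"
  shows "(\<Sum>n = 1..N. g n / real n) \<le> exp 8 * exp (\<Sum>p\<in>primes_le N. g p / real p)"
proof -
  define f where "f n = g n / real n" for n
  have mf: "multf f" using assms(1) by (auto simp: multf_def f_def)
  have nf: "f n \<ge> 0" for n using nn by (simp add: f_def)
  have pr: "prime p" "p \<ge> 2" if "p \<in> primes_le N" for p
    using that by (auto simp: primes_le_def prime_ge_2_nat)
  have "(\<Sum>n = 1..N. f n) = (\<Sum>n\<in>{n \<in> {1..N}. prime_factors n \<subseteq> primes_le N}. f n)"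
    by (rule sum.cong) (auto simp: primes_le_def prime_factors_dvd intro: order_trans[OF dvd_imp_le])
  also have "\<dots> \<le> (\<Prod>p\<in>primes_le N. \<Sum>k\<le>N. f (p ^ k))"
    by (rule smooth_sum_le_prod[OF mf nf]) (auto simp: primes_le_def)
  also have "\<dots> \<le> (\<Prod>p\<in>primes_le N. exp (g p / real p + 8 / real p ^ 2))"
  proof (rule prod_mono, safe)
    fix p assume p: "p \<in> primes_le N"
    then have N: "N \<ge> 2" using pr(2)[OF p] by (auto simp: primes_le_def)
    have "{..N} = {0, 1} \<union> {2..N}" using N by auto
    then have "(\<Sum>k\<le>N. f (p ^ k)) = f (p ^ 0) + f (p ^ 1) + (\<Sum>k = 2..N. f (p ^ k))"
      by (simp add: sum.union_disjoint)
    also have "\<dots> \<le> 1 + g p / real p + (\<Sum>k = 2..N. (real k + 1) / real p ^ k)"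
      using pp[OF pr(1)[OF p]] multf_1[OF mf]
      by (intro add_mono sum_mono) (auto simp: f_def intro!: divide_right_mono)
    also have "\<dots> \<le> 1 + (g p / real p + 8 / real p ^ 2)"
      using sum_linear_over_power[OF pr(2)[OF p], of N] by simp
    also have "\<dots> \<le> exp (g p / real p + 8 / real p ^ 2)" by (rule exp_ge_add_one_self)
    finally show "(\<Sum>k\<le>N. f (p ^ k)) \<le> exp (g p / real p + 8 / real p ^ 2)" .
  qed (auto intro!: sum_nonneg nf)
  also have "\<dots> = exp (8 * (\<Sum>p\<in>primes_le N. 1 / real p ^ 2)) * exp (\<Sum>p\<in>primes_le N. g p / real p)"
    by (simp add: exp_sum [symmetric] exp_add [symmetric] sum.distrib sum_distrib_left mult.commute)
  also have "\<dots> \<le> exp 8 * exp (\<Sum>p\<in>primes_le N. g p / real p)"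
    using sum_primes_recip_squares[of N] by (intro mult_right_mono) auto
  finally show ?thesis by (simp add: f_def)
qed

text \<open>The Euler product bound for the constant function 1, whose logarithmic sum is at least \<open>ln n\<close>.\<close>

lemma mertens_recip_lower:
  assumes "n \<ge> 2"
  shows "ln (ln (real n)) - 8 \<le> (\<Sum>p\<in>primes_le n. 1 / real p)"
proof -
  have "ln (real (Suc N)) \<le> (\<Sum>k = 1..N. 1 / real k)" for N
  proof (induction N)
    case (Suc N)
    have "ln (real (Suc (Suc N)) / real (Suc N)) \<le> real (Suc (Suc N)) / real (Suc N) - 1"
      by (rule ln_le_minus_one) simp
    also have "\<dots> = 1 / real (Suc N)" by (simp add: field_simps)
    finally have "ln (real (Suc (Suc N))) - ln (real (Suc N)) \<le> 1 / real (Suc N)"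
      by (subst (asm) ln_div) auto
    then show ?case using Suc by simp
  qed auto
  then have "ln (real n) \<le> (\<Sum>k = 1..n. 1 / real k)"
    using assms by (intro order_trans[OF ln_mono[of "real n" "real (Suc n)"]]) auto
  also have "\<dots> \<le> exp 8 * exp (\<Sum>p\<in>primes_le n. 1 / real p)"
    by (rule sum_le_euler_product[of "\<lambda>_. 1"]) (auto simp: multf_def)
  also have "\<dots> = exp (8 + (\<Sum>p\<in>primes_le n. 1 / real p))" by (simp add: exp_add)
  finally have "ln (ln (real n)) \<le> ln (exp (8 + (\<Sum>p\<in>primes_le n. 1 / real p)))"
    using assms by (intro ln_mono) auto
  then show ?thesis by simp
qed

section \<open>Mean values of non-negative multiplicative functions\<close>

definition prime_powers_le :: "nat \<Rightarrow> (nat \<times> nat) set" where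
  "prime_powers_le y = {(p, k). prime p \<and> k \<ge> 1 \<and> p ^ k \<le> y}"

lemma prime_powers_le_subset: "prime_powers_le y \<subseteq> primes_le y \<times> {1..y}"
proof
  fix x assume "x \<in> prime_powers_le y"
  then obtain p k where x: "x = (p, k)" "prime p" "k \<ge> 1" "p ^ k \<le> y"
    by (auto simp: prime_powers_le_def)
  have "k < 2 ^ k" by simp
  also have "(2::nat) ^ k \<le> p ^ k" using x prime_ge_2_nat by (intro power_mono) auto
  finally have "k \<le> y" using x by simp
  moreover have "p ^ 1 \<le> p ^ k" using x prime_ge_1_nat by (intro power_increasing) auto
  ultimately show "x \<in> primes_le y \<times> {1..y}" using x by (auto simp: primes_le_def)
qed

lemma finite_prime_powers_le [simp, intro]: "finite (prime_powers_le y)"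
  by (rule finite_subset[OF prime_powers_le_subset]) auto

lemma sum_quadratic_over_power:
  assumes "p \<ge> 2"
  shows "(\<Sum>k = 2..N. (real k + 1) * real k / real p ^ k) \<le> 28 / real p ^ 2"
proof -
  have "(\<Sum>k = 2..N. (real k + 1) * real k / 2 ^ k) \<le> (7 :: real)"
  proof (cases "N \<ge> 1")
    case True
    then have "(\<Sum>k = 2..N. (real k + 1) * real k / 2 ^ k) \<le> 7 - (real N ^ 2 + 5 * real N + 8) / 2 ^ N"
    proof (induction N rule: dec_induct)
      case (step n)
      have "(real (Suc n) + 1) * real (Suc n) / 2 ^ Suc n =
          (real n ^ 2 + 5 * real n + 8) / 2 ^ n - (real (Suc n) ^ 2 + 5 * real (Suc n) + 8) / 2 ^ Suc n"
        by (simp add: field_simps power2_eq_square)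
      then show ?case using step by simp
    qed auto
    also have "\<dots> \<le> 7" by simp
    finally show ?thesis .
  qed auto
  from weighted_geometric_tail[OF assms _ this] show ?thesis by simp
qed

text \<open>A Chebyshev bound with the weights that arise when \<open>ln n\<close> is split over the prime powers exactly
  dividing \<open>n\<close> and the value at \<open>p ^ k\<close> is bounded by \<open>k + 1\<close>. First powers are Chebyshev's
  estimate; for \<open>k \<ge> 2\<close> a term is inflated by \<open>y / p ^ k \<ge> 1\<close>, after which the series converges.\<close>

lemma prime_power_weight_le:
  "(\<Sum>(p, k)\<in>prime_powers_le y. (real k + 1) * real k * ln (real p)) \<le> 116 * real y"
proof -
  define w where "w = (\<lambda>(p :: nat) (k :: nat). (real k + 1) * real k * ln (real p))"
  have w0: "w p k \<ge> 0" if "p \<in> primes_le y" for p k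
    using that prime_ge_1_nat[of p] by (auto simp: w_def primes_le_def)
  have "(\<Sum>(p, k)\<in>prime_powers_le y. w p k) \<le>
      (\<Sum>(p, k)\<in>primes_le y \<times> {1..y}. if k = 1 then w p k else real y * (w p k / real p ^ k))"
  proof -
    have "(\<Sum>(p, k)\<in>prime_powers_le y. w p k) \<le>
        (\<Sum>(p, k)\<in>prime_powers_le y. if k = 1 then w p k else real y * (w p k / real p ^ k))"
    proof (rule sum_mono, safe)
      fix p k assume pk: "(p, k) \<in> prime_powers_le y"
      have pl: "p \<in> primes_le y" "p > 0"
        using pk prime_powers_le_subset[of y] by (auto simp: primes_le_def prime_gt_0_nat)
      have "real (p ^ k) \<le> real y" using pk by (simp add: prime_powers_le_def del: of_nat_power)
      then have "real p ^ k \<le> real y" by simp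
      then have "w p k * real p ^ k \<le> w p k * real y" using w0[OF pl(1)] by (intro mult_left_mono)
      then have "w p k \<le> real y * (w p k / real p ^ k)"
        using pl(2) by (simp add: pos_le_divide_eq mult.commute)
      then show "w p k \<le> (if k = 1 then w p k else real y * (w p k / real p ^ k))" by simp
    qed
    also have "\<dots> \<le> (\<Sum>(p, k)\<in>primes_le y \<times> {1..y}. if k = 1 then w p k else real y * (w p k / real p ^ k))"
      by (rule sum_mono2[OF _ prime_powers_le_subset]) (auto simp: w0)
    finally show ?thesis .
  qed
  also have "\<dots> = (\<Sum>p\<in>primes_le y. \<Sum>k = 1..y. if k = 1 then w p k else real y * (w p k / real p ^ k))"
    by (simp add: sum.cartesian_product)
  also have "\<dots> \<le> (\<Sum>p\<in>primes_le y. 2 * ln (real p) + real y * (28 * (ln (real p) / real p ^ 2)))"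
  proof (rule sum_mono)
    fix p assume p: "p \<in> primes_le y"
    then have p2: "p \<ge> 2" "y \<ge> 1" by (auto simp: primes_le_def dest: prime_ge_2_nat)
    have "{1..y} = insert 1 {2..y}" using p2 by auto
    then have "(\<Sum>k = 1..y. if k = 1 then w p k else real y * (w p k / real p ^ k)) =
        w p 1 + (\<Sum>k = 2..y. if k = 1 then w p k else real y * (w p k / real p ^ k))"
      by simp
    also have "(\<Sum>k = 2..y. if k = 1 then w p k else real y * (w p k / real p ^ k)) =
        real y * ln (real p) * (\<Sum>k = 2..y. (real k + 1) * real k / real p ^ k)"
      unfolding sum_distrib_left by (rule sum.cong) (auto simp: w_def)
    also have "\<dots> \<le> real y * ln (real p) * (28 / real p ^ 2)"
      using p2 by (intro mult_left_mono sum_quadratic_over_power) auto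
    finally show "(\<Sum>k = 1..y. if k = 1 then w p k else real y * (w p k / real p ^ k)) \<le>
        2 * ln (real p) + real y * (28 * (ln (real p) / real p ^ 2))"
      by (simp add: w_def mult_ac)
  qed
  also have "\<dots> = 2 * (\<Sum>p\<in>primes_le y. ln (real p)) + 28 * real y * (\<Sum>p\<in>primes_le y. ln (real p) / real p ^ 2)"
    by (simp add: sum.distrib sum_distrib_left mult_ac)
  also have "\<dots> \<le> 2 * (real y * ln 4) + 28 * real y * 4"
  proof (intro add_mono mult_left_mono chebyshev_theta)
    have "(\<Sum>p\<in>primes_le y. ln (real p) / real p ^ 2) \<le> (\<Sum>n = 2..y. ln (real n) / real n ^ 2)"
      by (rule sum_primes_le_mono) auto
    also have "\<dots> \<le> 4" by (rule sum_ln_over_squares)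
    finally show "(\<Sum>p\<in>primes_le y. ln (real p) / real p ^ 2) \<le> 4" .
  qed auto
  also have "\<dots> \<le> 116 * real y"
  proof -
    have "ln 4 = 2 * ln (2::real)" using ln_realpow[of 2 2] by simp
    then have "ln 4 \<le> (2::real)" using ln_le_minus_one[of "2::real"] by simp
    then have "real y * ln 4 \<le> real y * 2" by (intro mult_left_mono) auto
    then show ?thesis by simp
  qed
  finally show ?thesis by (simp add: w_def)
qed

lemma ln_eq_sum_prime_factors:
  assumes "n > 0"
  shows "ln (real n) = (\<Sum>p\<in>prime_factors n. real (multiplicity p n) * ln (real p))"
proof -
  have pos: "real p > 0" if "p \<in> prime_factors n" for p
    using that by (auto intro: prime_gt_0_nat)
  have "real n = real (\<Prod>p\<in>prime_factors n. p ^ multiplicity p n)"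
    using prime_factorization_nat[OF assms] by simp
  also have "\<dots> = (\<Prod>p\<in>prime_factors n. real p ^ multiplicity p n)" by simp
  finally have "ln (real n) = ln (\<Prod>p\<in>prime_factors n. real p ^ multiplicity p n)" by (rule arg_cong)
  also have "\<dots> = (\<Sum>p\<in>prime_factors n. ln (real p ^ multiplicity p n))"
  proof (rule ln_prod)
    fix p assume "p \<in> prime_factors n"
    from pos[OF this] show "real p ^ multiplicity p n \<noteq> 0" by simp
  qed simp
  also have "\<dots> = (\<Sum>p\<in>prime_factors n. real (multiplicity p n) * ln (real p))"
    using pos by (intro sum.cong refl) (simp add: ln_realpow)
  finally show ?thesis .
qed

text \<open>The inequality of Hall and Tenenbaum. Write \<open>ln N = ln (N / n) + ln n\<close>. The first part is at most
  \<open>N / n\<close>. In the second, \<open>ln n\<close> is a sum over the prime powers exactly dividing \<open>n = m * p ^ k\<close>;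
  multiplicativity separates \<open>m\<close> from \<open>p ^ k\<close>, and for fixed \<open>m\<close> the prime powers up to
  \<open>N / m\<close> contribute \<open>O(N / m)\<close>.\<close>

lemma multf_mean_le_log_mean:
  fixes g :: "nat \<Rightarrow> real"
  assumes "multf g" and nn: "\<And>n. g n \<ge> 0" and pp: "\<And>p k. prime p \<Longrightarrow> g (p ^ k) \<le> real k + 1"
  shows "ln (real N) * (\<Sum>n = 1..N. g n) \<le> 117 * real N * (\<Sum>n = 1..N. g n / real n)"
proof -
  define w where "w = (\<lambda>(p :: nat) (k :: nat). (real k + 1) * real k * ln (real p))"
  have w0: "w p k \<ge> 0" if "prime p" for p k
    using that prime_ge_1_nat[of p] by (auto simp: w_def)
  let ?S = "Sigma {1..N} (\<lambda>n. prime_factors n)" and ?T = "Sigma {1..N} (\<lambda>m. prime_powers_le (N div m))"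
  have "(\<Sum>n = 1..N. g n * ln (real n)) =
      (\<Sum>n = 1..N. \<Sum>p\<in>prime_factors n. g n * (real (multiplicity p n) * ln (real p)))"
    by (intro sum.cong refl) (simp add: ln_eq_sum_prime_factors sum_distrib_left)
  also have "\<dots> = (\<Sum>(n, p)\<in>?S. g n * (real (multiplicity p n) * ln (real p)))"
    by (subst sum.Sigma) auto
  also have "\<dots> \<le> (\<Sum>(m, p, k)\<in>?T. g m * w p k)"
  proof (rule sum_le_included[where i = "\<lambda>(m, p, k). (m * p ^ k, p)"])
    show "\<forall>x\<in>?S. \<exists>y\<in>?T. (case y of (m, p, k) \<Rightarrow> (m * p ^ k, p)) = x \<and>
        (case x of (n, p) \<Rightarrow> g n * (real (multiplicity p n) * ln (real p))) \<le> (case y of (m, p, k) \<Rightarrow> g m * w p k)"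
    proof safe
      fix n p assume n: "n \<in> {1..N}" and pn: "p \<in> prime_factors n"
      define k where "k = multiplicity p n"
      have p: "prime p" "p dvd n" using pn by auto
      have "n \<noteq> 0" "\<not> is_unit p" using n p by auto
      then obtain m where m: "n = p ^ k * m" "\<not> p dvd m"
        using multiplicity_decompose'[of n p] unfolding k_def by blast
      have m0: "m > 0" using m n by (auto intro: Nat.gr0I)
      have k1: "k \<ge> 1" using pn unfolding k_def by (metis One_nat_def Suc_leI count_prime_factorization_prime
         p(1) count_greater_zero_iff)
      have "p ^ k \<le> N div m"
        using n m m0 by (simp add: less_eq_div_iff_mult_less_eq)
      moreover have "m \<le> N"
        using n m p factor_le_bound[of "p ^ k" m N] by (simp add: prime_gt_0_nat mult.commute)
      ultimately have T: "(m, p, k) \<in> ?T" using m0 k1 p by (auto simp: prime_powers_le_def)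
      have "coprime (p ^ k) m" using m p by (auto simp: prime_imp_coprime intro: coprime_power_left_iff[THEN iffD2])
      then have "g n = g m * g (p ^ k)" using m assms(1) by (simp add: multf_mult)
      then have "g n * (real k * ln (real p)) = g m * (g (p ^ k) * (real k * ln (real p)))" by simp
      also have "\<dots> \<le> g m * ((real k + 1) * (real k * ln (real p)))"
        using pp[OF p(1)] p(1) prime_ge_1_nat[of p] by (intro mult_left_mono mult_right_mono nn) auto
      also have "\<dots> = g m * w p k" by (simp add: w_def)
      finally have "g n * (real k * ln (real p)) \<le> g m * w p k" .
      moreover have "m * p ^ k = n" using m(1) by (simp only: mult.commute)
      ultimately show "\<exists>y\<in>?T. (case y of (m, p, k) \<Rightarrow> (m * p ^ k, p)) = (n, p) \<and>
          g n * (real (multiplicity p n) * ln (real p)) \<le> (case y of (m, p, k) \<Rightarrow> g m * w p k)"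
        unfolding k_def[symmetric] by (intro bexI[OF _ T]) simp
    qed
  next
    show "finite ?S" "finite ?T" by auto
    show "\<forall>y\<in>?T. 0 \<le> (case y of (m, p, k) \<Rightarrow> g m * w p k)"
      by (auto simp: nn w0 prime_powers_le_def)
  qed
  also have "\<dots> = (\<Sum>m = 1..N. \<Sum>(p, k)\<in>prime_powers_le (N div m). g m * w p k)"
    by (subst sum.Sigma) (auto intro: finite_prime_powers_le simp: case_prod_unfold)
  also have "\<dots> = (\<Sum>m = 1..N. g m * (\<Sum>(p, k)\<in>prime_powers_le (N div m). w p k))"
    by (simp add: sum_distrib_left case_prod_unfold)
  also have "\<dots> \<le> (\<Sum>m = 1..N. g m * (116 * (real N / real m)))"
  proof (intro sum_mono mult_left_mono nn)
    fix m
    have "(\<Sum>(p, k)\<in>prime_powers_le (N div m). w p k) \<le> 116 * real (N div m)"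
      using prime_power_weight_le[of "N div m"] by (simp add: w_def)
    also have "\<dots> \<le> 116 * (real N / real m)" using of_nat_div_le_of_nat[of N m, where ?'a = real] by simp
    finally show "(\<Sum>(p, k)\<in>prime_powers_le (N div m). w p k) \<le> 116 * (real N / real m)" .
  qed
  finally have 1: "(\<Sum>n = 1..N. g n * ln (real n)) \<le> (\<Sum>n = 1..N. g n * (116 * (real N / real n)))" .
  have "ln (real N) * (\<Sum>n = 1..N. g n) = (\<Sum>n = 1..N. g n * ln (real N / real n)) + (\<Sum>n = 1..N. g n * ln (real n))"
    unfolding sum_distrib_left sum.distrib[symmetric]
    by (intro sum.cong refl) (auto simp: ln_div algebra_simps)
  also have "(\<Sum>n = 1..N. g n * ln (real N / real n)) \<le> (\<Sum>n = 1..N. g n * (real N / real n))"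
  proof (intro sum_mono mult_left_mono nn)
    fix n assume "n \<in> {1..N}"
    then have "ln (real N / real n) \<le> real N / real n - 1" by (intro ln_le_minus_one) auto
    then show "ln (real N / real n) \<le> real N / real n" by simp
  qed
  also note 1
  also have "(\<Sum>n = 1..N. g n * (real N / real n)) + (\<Sum>n = 1..N. g n * (116 * (real N / real n))) =
      117 * real N * (\<Sum>n = 1..N. g n / real n)"
    unfolding sum_distrib_left sum.distrib[symmetric]
    by (intro sum.cong refl) (simp add: field_simps)
  finally show ?thesis by simp
qed

section \<open>Divisor sums of a real character\<close>

text \<open>A real character is used only through complete multiplicativity, its values and a bound \<open>q\<close> for its
  partial sums, the form in which partial summation consumes periodicity. The bound excludes
  principal characters.\<close>

definition real_char :: "(nat \<Rightarrow> real) \<Rightarrow> nat \<Rightarrow> bool" where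
  "real_char f q \<longleftrightarrow> f 1 = 1 \<and> (\<forall>a b. f (a * b) = f a * f b) \<and> (\<forall>n. f n \<in> {-1, 0, 1}) \<and>
     (\<forall>n. \<bar>\<Sum>k = 1..n. f k\<bar> \<le> real q)"

lemma real_charD:
  assumes "real_char f q"
  shows "f (Suc 0) = 1" "f (a * b) = f a * f b" "f n \<in> {-1, 0, 1}" "\<bar>f n\<bar> \<le> 1" "multf f"
    "\<bar>\<Sum>k = 1..n. f k\<bar> \<le> real q" "f (p ^ j) = f p ^ j"
proof -
  have 1: "f 1 = 1" "\<And>a b. f (a * b) = f a * f b" "\<And>n. f n \<in> {-1, 0, 1}" "\<And>n. \<bar>\<Sum>k = 1..n. f k\<bar> \<le> real q"
    using assms by (auto simp: real_char_def)
  show "f (Suc 0) = 1" "f (a * b) = f a * f b" "f n \<in> {-1, 0, 1}" "multf f" "\<bar>\<Sum>k = 1..n. f k\<bar> \<le> real q"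
    using 1(1,2) 1(3,4)[of n] by (auto simp: multf_def)
  show "\<bar>f n\<bar> \<le> 1" using 1(3)[of n] by auto
  show "f (p ^ j) = f p ^ j" using 1(1) by (induction j) (auto simp: 1(2))
qed

lemma dconv_commute: "dconv f g n = dconv g f n"
proof (cases "n = 0")
  case False
  then show ?thesis unfolding dconv_def
    by (intro sum.reindex_bij_witness[of _ "\<lambda>d. n div d" "\<lambda>d. n div d"]) (auto elim!: dvdE)
qed (simp add: dconv_def)

lemma multf_prime_power_decomp:
  fixes n :: nat
  assumes "n > 1"
  obtains p k m where "prime p" "n = p ^ k * m" "coprime (p ^ k) m" "m < n" "m > 0"
proof -
  obtain p where p: "prime p" "p dvd n" using prime_factor_nat[of n] assms by auto
  define k where "k = multiplicity p n"
  have "n \<noteq> 0" "\<not> is_unit p" using assms p by auto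
  then obtain m where m: "n = p ^ k * m" "\<not> p dvd m"
    using multiplicity_decompose'[of n p] unfolding k_def by blast
  have m0: "m > 0" using m assms by (auto intro: Nat.gr0I)
  have "k \<noteq> 0" using m p by (intro notI) auto
  then have "p ^ k > 1" using p prime_gt_1_nat[of p] by (intro one_less_power) auto
  then have "m < n" using m m0 by simp
  moreover have "coprime (p ^ k) m"
    using m p by (auto simp: prime_imp_coprime intro: coprime_power_left_iff[THEN iffD2])
  ultimately show ?thesis using that p m m0 by blast
qed

text \<open>Comparison of multiplicative functions reduces to prime powers, one of the two being
  non-negative there.\<close>

lemma multf_mono:
  assumes "multf g" "multf g'" "\<And>p k. prime p \<Longrightarrow> 0 \<le> g (p ^ k)" "\<And>p k. prime p \<Longrightarrow> g (p ^ k) \<le> g' (p ^ k)" "n > 0"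
  shows "0 \<le> g n \<and> g n \<le> g' n"
  using assms(5)
proof (induction n rule: less_induct)
  case (less n)
  show ?case
  proof (cases "n > 1")
    case True
    then obtain p k m where *: "prime p" "n = p ^ k * m" "coprime (p ^ k) m" "m < n" "m > 0"
      by (rule multf_prime_power_decomp)
    have "0 \<le> g (p ^ k)" "g (p ^ k) \<le> g' (p ^ k)" using * assms(3,4) by auto
    moreover have "0 \<le> g m \<and> g m \<le> g' m" using * less by auto
    ultimately show ?thesis
      using * assms(1,2) by (auto simp: multf_mult intro!: mult_mono)
  next
    case False
    then have "n = 1" using less by simp
    then show ?thesis using assms(1,2) by (simp add: multf_1)
  qed
qed

lemma multf_one: "multf (\<lambda>_. 1)"
  by (simp add: multf_def)

lemma multf_nonneg:
  assumes "multf g" "\<And>p k. prime p \<Longrightarrow> 0 \<le> g (p ^ k)" "g 0 \<ge> 0"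
  shows "0 \<le> g n"
  using multf_mono[OF assms(1,1,2), of n] assms(3) by (cases "n = 0") auto

text \<open>At a prime power the convolution \<open>1 * f\<close> is the geometric sum \<open>\<Sum>i \<le> k. f p ^ i\<close> with
  \<open>f p \<in> {-1, 0, 1}\<close>, so it lies between 0 and \<open>k + 1\<close>. Non-negativity is what makes \<open>1 * f\<close> accessible to
  the mean value theorem.\<close>

lemma char_divisor_sum:
  assumes "real_char f q"
  shows "multf (dconv f (\<lambda>_. 1))" "prime p \<Longrightarrow> dconv f (\<lambda>_. 1) (p ^ k) \<in> {0..real k + 1}"
    "prime p \<Longrightarrow> dconv f (\<lambda>_. 1) p = 1 + f p" "dconv f (\<lambda>_. 1) n \<ge> 0"
proof -
  let ?h = "dconv f (\<lambda>_. 1)"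
  show m: "multf ?h" by (intro multf_dconv real_charD(5)[OF assms] multf_one)
  have h: "?h (p ^ k) = (\<Sum>i\<le>k. f p ^ i)" if "prime p" for p k
    using that by (simp add: dconv_prime_power real_charD(7)[OF assms])
  show pp: "?h (p ^ k) \<in> {0..real k + 1}" if "prime p" for p k
  proof -
    have "f p = -1 \<or> f p = 0 \<or> f p = 1" using real_charD(3)[OF assms, of p] by auto
    moreover have "(\<Sum>i\<le>k. (-1 :: real) ^ i) = (if even k then 1 else 0)" by (induction k) auto
    moreover have "(\<Sum>i\<le>k. (0 :: real) ^ i) = 1" by (induction k) auto
    ultimately show ?thesis using h[OF that] by auto
  qed
  show "?h p = 1 + f p" if "prime p" using h[OF that, of 1] by simp
  show "?h n \<ge> 0" by (rule multf_nonneg[OF m]) (use pp in \<open>auto simp: dconv_def\<close>)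
qed

text \<open>Summation by parts against a decreasing sequence; sums of \<open>f\<close> over intervals are at most \<open>2 * B\<close>,
  as differences of two initial sums.\<close>

lemma abel_bound:
  fixes f c :: "nat \<Rightarrow> real"
  assumes "\<And>n. \<bar>\<Sum>k = 1..n. f k\<bar> \<le> B" and anti: "\<And>k. a < k \<Longrightarrow> c (Suc k) \<le> c k" and nn: "\<And>k. c k \<ge> 0"
  shows "\<bar>\<Sum>k = Suc a..b. f k * c k\<bar> \<le> 2 * B * c (Suc a)"
proof (cases "b \<ge> Suc a")
  case True
  define S where "S b = (\<Sum>k = Suc a..b. f k)" for b
  have S: "\<bar>S b\<bar> \<le> 2 * B" if "b \<ge> a" for b
  proof -
    have "{1..b} = {1..a} \<union> {Suc a..b}" using that by auto
    then have "(\<Sum>k = 1..b. f k) = (\<Sum>k = 1..a. f k) + S b"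
      unfolding S_def by (subst sum.union_disjoint[symmetric]) auto
    then show ?thesis using assms(1)[of a] assms(1)[of b] by linarith
  qed
  have "\<bar>(\<Sum>k = Suc a..b. f k * c k) - S b * c b\<bar> \<le> 2 * B * (c (Suc a) - c b)"
    using True
  proof (induction b rule: dec_induct)
    case (step b)
    have "(\<Sum>k = Suc a..Suc b. f k * c k) - S (Suc b) * c (Suc b) =
        ((\<Sum>k = Suc a..b. f k * c k) - S b * c b) + S b * (c b - c (Suc b))"
      using step by (simp add: S_def algebra_simps)
    moreover have "\<bar>S b * (c b - c (Suc b))\<bar> \<le> 2 * B * (c b - c (Suc b))"
      unfolding abs_mult using step anti[of b] S[of b]
      by (intro mult_mono) auto
    ultimately show ?case using step.IH by (simp add: algebra_simps)
  qed (simp add: S_def)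
  moreover have "\<bar>S b * c b\<bar> \<le> 2 * B * c b"
    unfolding abs_mult using True S[of b] nn[of b] by (intro mult_mono) auto
  ultimately show ?thesis by (simp add: algebra_simps)
next
  case False
  have "B \<ge> 0" using assms(1)[of 0] by simp
  then show ?thesis using False nn[of "Suc a"] by simp
qed

lemma harmonic_interval:
  assumes "1 \<le> a" "a \<le> W"
  shows "(\<Sum>b = Suc a..W. 1 / real b) \<le> ln (real W) - ln (real a)"
  using assms(2)
proof (induction W rule: dec_induct)
  case (step n)
  have n: "real n > 0" using step assms by simp
  have "ln (real n / real (Suc n)) \<le> real n / real (Suc n) - 1"
    using n by (intro ln_le_minus_one) auto
  also have "\<dots> = - 1 / real (Suc n)" by (simp add: field_simps)
  finally have "1 / real (Suc n) \<le> ln (real (Suc n)) - ln (real n)"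
    using n by (subst (asm) ln_div) auto
  then show ?case using step by simp
qed auto

lemma harmonic_le:
  assumes "W \<ge> 1"
  shows "(\<Sum>b = 1..W. 1 / real b) \<le> 1 + ln (real W)"
proof -
  have "{1..W} = insert 1 {Suc 1..W}" using assms by auto
  then have "(\<Sum>b = 1..W. 1 / real b) = 1 + (\<Sum>b = Suc 1..W. 1 / real b)" by simp
  then show ?thesis using harmonic_interval[of 1 W] assms by simp
qed

text \<open>The partial sums of the series for \<open>L(1, f)\<close>.\<close>

definition char_log_sum :: "(nat \<Rightarrow> real) \<Rightarrow> nat \<Rightarrow> real" where
  "char_log_sum f t = (\<Sum>a = 1..t. f a / real a)"

text \<open>The sum of \<open>1 * f\<close> up to \<open>Q ^ 3\<close> is the sum of \<open>f a * (Q ^ 3 div a)\<close>. Up to \<open>a = Q\<^sup>2\<close> dropping the integer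
  parts costs \<open>Q\<^sup>2\<close>; beyond, the coefficients decrease from at most \<open>Q\<close>, so partial summation bounds the rest by
  \<open>2 * Q\<^sup>2\<close>. Both are negligible against \<open>Q ^ 3\<close>.\<close>

lemma char_log_sum_le_mean:
  assumes f: "real_char f q" and q: "q \<le> Q" "Q \<ge> 1"
  shows "char_log_sum f (Q ^ 2) \<le> (\<Sum>n = 1..Q ^ 3. dconv f (\<lambda>_. 1) n) / real Q ^ 3 + 3 / real Q"
proof -
  let ?H = "\<Sum>n = 1..Q ^ 3. dconv f (\<lambda>_. 1) n"
  have Q0: "real Q > 0" using q by simp
  have "?H = (\<Sum>a = 1..Q ^ 3. \<Sum>b = 1..Q ^ 3 div a. f a)"
    unfolding dconv_def using sum_divisor_pairs[of "\<lambda>a b. f a" "Q ^ 3"] by simp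
  also have "\<dots> = (\<Sum>a = 1..Q ^ 3. f a * real (Q ^ 3 div a))" by (simp add: mult.commute)
  also have "\<dots> =
      (\<Sum>a = 1..Q ^ 2. f a * real (Q ^ 3 div a)) + (\<Sum>a = Suc (Q ^ 2)..Q ^ 3. f a * real (Q ^ 3 div a))"
  proof -
    have "{1..Q ^ 3} = {1..Q ^ 2} \<union> {Suc (Q ^ 2)..Q ^ 3}"
      using q power_increasing[of 2 3 Q] by auto
    then show ?thesis by (simp only:) (rule sum.union_disjoint, auto)
  qed
  also have "\<dots> \<ge> (real Q ^ 3 * char_log_sum f (Q ^ 2) - real Q ^ 2) - 2 * real Q ^ 2"
  proof -
    have "\<bar>\<Sum>a = Suc (Q ^ 2)..Q ^ 3. f a * real (Q ^ 3 div a)\<bar> \<le> 2 * real q * real (Q ^ 3 div Suc (Q ^ 2))"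
      by (rule abel_bound[OF real_charD(6)[OF f]]) (auto intro!: div_le_mono2)
    also have "\<dots> \<le> 2 * real Q * real Q"
    proof -
      have "Q ^ 3 div Suc (Q ^ 2) \<le> Q ^ 3 div Q ^ 2" using q by (intro div_le_mono2) auto
      also have "\<dots> = Q" using q by (simp add: power3_eq_cube power2_eq_square)
      finally have "real (Q ^ 3 div Suc (Q ^ 2)) \<le> real Q" by simp
      then show ?thesis using q by (intro mult_mono) auto
    qed
    finally have 2: "\<bar>\<Sum>a = Suc (Q ^ 2)..Q ^ 3. f a * real (Q ^ 3 div a)\<bar> \<le> 2 * real Q ^ 2"
      by (simp add: power2_eq_square)
    have "(\<Sum>a = 1..Q ^ 2. f a * (real Q ^ 3 / real a)) - (\<Sum>a = 1..Q ^ 2. f a * real (Q ^ 3 div a)) =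
        (\<Sum>a = 1..Q ^ 2. f a * (real Q ^ 3 / real a - real (Q ^ 3 div a)))"
      by (simp add: sum_subtractf[symmetric] right_diff_distrib)
    also have "\<dots> \<le> (\<Sum>a = 1..Q ^ 2. 1)"
    proof (rule sum_mono)
      fix a
      have "real Q ^ 3 / real a - real (Q ^ 3 div a) \<in> {0..1}"
        using real_div_ge[of "Q ^ 3" a] of_nat_div_le_of_nat[of "Q ^ 3" a, where ?'a = real] by simp
      moreover have "f a \<in> {-1, 0, 1}" by (rule real_charD(3)[OF f])
      ultimately show "f a * (real Q ^ 3 / real a - real (Q ^ 3 div a)) \<le> 1" by auto
    qed
    also have "\<dots> = real Q ^ 2" by simp
    finally have "real Q ^ 3 * char_log_sum f (Q ^ 2) - (\<Sum>a = 1..Q ^ 2. f a * real (Q ^ 3 div a)) \<le> real Q ^ 2"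
      by (simp add: char_log_sum_def sum_distrib_left mult.commute)
    then show ?thesis using 2 by linarith
  qed
  finally have "char_log_sum f (Q ^ 2) * real Q ^ 3 \<le> ?H + 3 * real Q ^ 2" by (simp add: mult.commute)
  then have "char_log_sum f (Q ^ 2) \<le> (?H + 3 * real Q ^ 2) / real Q ^ 3"
    using Q0 by (simp add: pos_le_divide_eq)
  also have "\<dots> = ?H / real Q ^ 3 + 3 / real Q"
    using Q0 by (simp add: add_divide_distrib power3_eq_cube power2_eq_square)
  finally show ?thesis .
qed

lemma char_log_sum_le_trivial:
  assumes f: "real_char f q" and "t \<ge> 1"
  shows "char_log_sum f t \<le> 1 + ln (real t)"
proof -
  have "char_log_sum f t \<le> (\<Sum>a = 1..t. 1 / real a)"
    unfolding char_log_sum_def using real_charD(4)[OF f]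
    by (intro sum_mono divide_right_mono) (auto simp: abs_le_iff)
  also have "\<dots> \<le> 1 + ln (real t)" by (rule harmonic_le[OF assms(2)])
  finally show ?thesis .
qed

text \<open>The logarithmic sum of \<open>1 * f\<close> is the sum over \<open>b \<le> W\<close> of \<open>1 / b\<close> times the partial sum of \<open>L(1, f)\<close> up to
  \<open>W / b\<close>. Partial sums of length at least \<open>Q\<^sup>2\<close> differ from the one of length \<open>Q\<^sup>2\<close> by at most \<open>2 / Q\<close>. For the remaining \<open>b\<close>, within
  a factor \<open>Q\<^sup>2\<close> of \<open>W\<close>, both \<open>\<Sum> 1 / b\<close> and the partial sum are logarithmic in \<open>Q\<close>.\<close>

lemma divisor_log_sum_le_char:
  assumes f: "real_char f q" and q: "q \<le> Q" "Q \<ge> 1" and W: "Q ^ 2 \<le> W"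
  shows "(\<Sum>n = 1..W. dconv f (\<lambda>_. 1) n / real n) \<le>
    (1 + ln (real W)) * ((\<Sum>n = 1..Q ^ 3. dconv f (\<lambda>_. 1) n) / real Q ^ 3 + 5 / real Q) +
    (1 + 2 * ln (real Q)) ^ 2"
proof -
  define Dp where "Dp = (\<Sum>n = 1..Q ^ 3. dconv f (\<lambda>_. 1) n) / real Q ^ 3 + 5 / real Q"
  have Q0: "real Q > 0" using q by simp
  have Dp0: "Dp \<ge> 0" unfolding Dp_def using q
    by (intro add_nonneg_nonneg divide_nonneg_nonneg sum_nonneg char_divisor_sum(4)[OF f]) auto
  have W1: "W \<ge> 1" using W q by (metis le_trans one_le_power)
  define v where "v = Q ^ 2"
  have v1: "v \<ge> 1" using q by (simp add: v_def)
  have lnv: "ln (real v) = 2 * ln (real Q)" using Q0 by (simp add: v_def ln_realpow)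
  have lnQ: "ln (real Q) \<ge> 0" using q by simp
  have D_large: "char_log_sum f t \<le> Dp" if "t \<ge> v" for t
  proof -
    have "{1..t} = {1..v} \<union> {Suc v..t}" using that by auto
    then have "char_log_sum f t = char_log_sum f v + (\<Sum>a = Suc v..t. f a / real a)"
      unfolding char_log_sum_def by (subst sum.union_disjoint[symmetric]) auto
    also have "(\<Sum>a = Suc v..t. f a / real a) \<le> 2 / real Q"
    proof -
      have "\<bar>\<Sum>a = Suc v..t. f a * (1 / real a)\<bar> \<le> 2 * real q * (1 / real (Suc v))"
        by (rule abel_bound[OF real_charD(6)[OF f]]) (auto intro!: divide_left_mono)
      also have "\<dots> \<le> 2 * real Q * (1 / real v)"
        using q v1 by (intro mult_mono divide_left_mono) auto
      also have "\<dots> = 2 / real Q" using Q0 by (simp add: v_def power2_eq_square)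
      finally show ?thesis by simp
    qed
    also have "char_log_sum f v \<le> (\<Sum>n = 1..Q ^ 3. dconv f (\<lambda>_. 1) n) / real Q ^ 3 + 3 / real Q"
      unfolding v_def by (rule char_log_sum_le_mean[OF f q])
    finally show ?thesis by (simp add: Dp_def)
  qed
  have bound: "char_log_sum f (W div b) \<le> Dp + (if W div b < v then 1 + ln (real v) else 0)"
    if "b \<in> {1..W}" for b
  proof (cases "W div b < v")
    case True
    have t1: "W div b \<ge> 1" using that by (simp add: div_greater_zero_iff Suc_le_eq)
    then have "char_log_sum f (W div b) \<le> 1 + ln (real (W div b))"
      by (rule char_log_sum_le_trivial[OF f])
    also have "ln (real (W div b)) \<le> ln (real v)" using True t1 by (intro ln_mono) auto
    finally show ?thesis using True Dp0 by simp
  next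
    case False
    then show ?thesis using D_large[of "W div b"] by simp
  qed
  have "(\<Sum>n = 1..W. dconv f (\<lambda>_. 1) n / real n) = (\<Sum>n = 1..W. dconv (\<lambda>_. 1) f n / real n)"
    by (simp add: dconv_commute)
  also have "\<dots> = (\<Sum>n = 1..W. \<Sum>d | d dvd n. (1 / real d) * (f (n div d) / real (n div d)))"
    unfolding dconv_def sum_divide_distrib
    by (intro sum.cong refl) (auto simp: real_of_nat_div)
  also have "\<dots> = (\<Sum>b = 1..W. \<Sum>a = 1..W div b. (1 / real b) * (f a / real a))"
    by (rule sum_divisor_pairs)
  also have "\<dots> = (\<Sum>b = 1..W. (1 / real b) * char_log_sum f (W div b))"
    by (simp add: char_log_sum_def sum_distrib_left)
  also have "\<dots> \<le> (\<Sum>b = 1..W. (1 / real b) * (Dp + (if W div b < v then 1 + ln (real v) else 0)))"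
    using bound by (intro sum_mono mult_left_mono) auto
  also have "\<dots> = (\<Sum>b = 1..W. 1 / real b) * Dp +
      (1 + ln (real v)) * (\<Sum>b = 1..W. if W div b < v then 1 / real b else 0)"
    unfolding sum_distrib_right sum_distrib_left sum.distrib[symmetric]
    by (intro sum.cong refl) (auto simp: algebra_simps add_divide_distrib)
  also have "\<dots> \<le> (1 + ln (real W)) * Dp + (1 + ln (real v)) * (1 + ln (real v))"
  proof (intro add_mono mult_right_mono mult_left_mono harmonic_le W1 Dp0)
    show "0 \<le> 1 + ln (real v)" using v1 by simp
    define a where "a = W div v"
    have a1: "a \<ge> 1" "a \<le> W" using W v1 unfolding a_def v_def by (auto simp: div_greater_zero_iff Suc_le_eq)
    have "(\<Sum>b = 1..W. if W div b < v then 1 / real b else 0) \<le> (\<Sum>b = Suc a..W. 1 / real b)"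
    proof -
      have "(\<Sum>b = 1..W. if W div b < v then 1 / real b else 0) = (\<Sum>b\<in>{b \<in> {1..W}. W div b < v}. 1 / real b)"
        by (rule sum.inter_filter[symmetric]) auto
      also have "\<dots> \<le> (\<Sum>b = Suc a..W. 1 / real b)"
      proof (rule sum_mono2)
        show "{b \<in> {1..W}. W div b < v} \<subseteq> {Suc a..W}"
        proof safe
          fix b assume b: "b \<in> {1..W}" "W div b < v"
          then have "W < b * v" by (simp add: div_less_iff_less_mult mult.commute)
          then have "W div v < b" using v1 by (simp add: div_less_iff_less_mult)
          then show "b \<in> {Suc a..W}" using b by (simp add: a_def)
        qed
      qed auto
      finally show ?thesis .
    qed
    also have "\<dots> \<le> ln (real W) - ln (real a)" by (rule harmonic_interval[OF a1])
    also have "\<dots> \<le> 1 + ln (real v)"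
    proof -
      have "W < v * (a + 1)" unfolding a_def using v1 by (metis Suc_eq_plus1 div_less_iff_less_mult lessI less_le_trans mult.commute zero_less_one)
      also have "\<dots> \<le> v * (2 * a)" using a1 by (intro mult_left_mono) auto
      finally have "real W \<le> real (2 * v * a)" unfolding of_nat_le_iff by (simp add: mult_ac)
      then have "ln (real W) \<le> ln (2 * real v * real a)" using W1 by (intro ln_mono) auto
      also have "\<dots> = ln 2 + ln (real v) + ln (real a)" using a1 v1 by (simp add: ln_mult)
      finally show ?thesis using ln_le_minus_one[of "2::real"] by simp
    qed
    finally show "(\<Sum>b = 1..W. if W div b < v then 1 / real b else 0) \<le> 1 + ln (real v)" .
  qed
  finally show ?thesis by (simp add: Dp_def lnv power2_eq_square)
qed

text \<open>The mean value theorem bounds the left side by an Euler product over all \<open>p \<le> Q ^ 3\<close>, divided by the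
  logarithm. For the primes above \<open>z\<close> only \<open>1 + f p \<le> 2\<close> is used, and by the two Mertens estimates
  this costs the factor \<open>ln Q / ln z\<close>.\<close>

lemma char_mean_le_short_product:
  assumes f: "real_char f q" and Q: "Q \<ge> 2" and z: "2 \<le> z" "z \<le> Q ^ 3"
  shows "(\<Sum>n = 1..Q ^ 3. dconv f (\<lambda>_. 1) n) / real Q ^ 3 \<le>
    351 * exp 26 * (ln (real Q) / ln (real z)) * exp (\<Sum>p\<in>primes_le z. f p / real p)"
proof -
  let ?h = "dconv f (\<lambda>_. 1)"
  define x where "x = Q ^ 3"
  define S where "S y = (\<Sum>p\<in>primes_le y. 1 / real p)" for y
  define E where "E = (\<Sum>p\<in>primes_le z. f p / real p)"
  have x2: "x \<ge> 2" using z by (simp add: x_def)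
  have lnx: "ln (real x) = 3 * ln (real Q)" using Q by (simp add: x_def ln_realpow)
  have pos: "ln (real Q) > 0" "ln (real z) > 0" "ln (real x) > 0" using Q z x2 by auto
  have "(\<Sum>p\<in>primes_le x. ?h p / real p) = (\<Sum>p\<in>primes_le x. (1 + f p) / real p)"
    by (intro sum.cong refl) (auto simp: primes_le_def char_divisor_sum(3)[OF f])
  also have "\<dots> = (\<Sum>p\<in>primes_le z. (1 + f p) / real p) +
      (\<Sum>p\<in>primes_le x - primes_le z. (1 + f p) / real p)"
  proof -
    have "primes_le z \<subseteq> primes_le x" using z by (intro primes_le_mono) (simp add: x_def)
    from sum.subset_diff[OF this, of "\<lambda>p. (1 + f p) / real p"] show ?thesis by simp
  qed
  also have "(\<Sum>p\<in>primes_le x - primes_le z. (1 + f p) / real p) \<le> (\<Sum>p\<in>primes_le x - primes_le z. 2 * (1 / real p))"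
  proof (rule sum_mono)
    fix p
    have "(1 + f p) / real p \<le> 2 / real p"
      using real_charD(4)[OF f, of p] by (intro divide_right_mono) auto
    then show "(1 + f p) / real p \<le> 2 * (1 / real p)" by simp
  qed
  also have "\<dots> = 2 * (S x - S z)"
    unfolding S_def sum_distrib_left[symmetric] using primes_le_mono[of z x] z
    by (subst sum_diff) (auto simp: x_def)
  also have "(\<Sum>p\<in>primes_le z. (1 + f p) / real p) = S z + E"
    by (simp add: S_def E_def add_divide_distrib sum.distrib)
  also have "S z + E + 2 * (S x - S z) \<le> 2 * (ln (ln (real x)) + 5) - (ln (ln (real z)) - 8) + E"
    using mertens_recip_upper[OF x2] mertens_recip_lower[OF z(1)] by (simp add: S_def)
  finally have *: "(\<Sum>p\<in>primes_le x. ?h p / real p) \<le> 18 + 2 * ln (ln (real x)) - ln (ln (real z)) + E" by simp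
  have "ln (real x) * (\<Sum>n = 1..x. ?h n) \<le> 117 * real x * (\<Sum>n = 1..x. ?h n / real n)"
    using char_divisor_sum[OF f] by (intro multf_mean_le_log_mean) auto
  also have "\<dots> \<le> 117 * real x * (exp 8 * exp (\<Sum>p\<in>primes_le x. ?h p / real p))"
    using char_divisor_sum[OF f] by (intro mult_left_mono sum_le_euler_product) auto
  also have "\<dots> \<le> 117 * real x * (exp 8 * exp (18 + 2 * ln (ln (real x)) - ln (ln (real z)) + E))"
    using * by (intro mult_left_mono) auto
  also have "\<dots> = 117 * real x * (exp 26 * (ln (real x) * ln (real x) / ln (real z)) * exp E)"
  proof -
    have "exp 8 * exp (18 + 2 * ln (ln (real x)) - ln (ln (real z)) + E) =
      exp (26 + (ln (ln (real x)) + ln (ln (real x)) - ln (ln (real z))) + E)"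
      unfolding exp_add[symmetric] by (simp add: algebra_simps)
    also have "\<dots> = exp 26 * (ln (real x) * ln (real x) / ln (real z)) * exp E"
      by (simp only: exp_add exp_diff exp_ln[OF pos(3)] exp_ln[OF pos(2)])
    finally show ?thesis by simp
  qed
  also have "\<dots> = ln (real x) * (117 * real x * (exp 26 * (ln (real x) / ln (real z)) * exp E))" by simp
  finally have "(\<Sum>n = 1..x. ?h n) \<le> 117 * real x * (exp 26 * (ln (real x) / ln (real z)) * exp E)"
    using pos(3) by (simp only: mult_le_cancel_left_pos)
  then have "(\<Sum>n = 1..x. ?h n) / real x \<le> 117 * (exp 26 * (ln (real x) / ln (real z)) * exp E)"
    using x2 by (simp add: pos_divide_le_eq mult_ac)
  also have "\<dots> = 351 * exp 26 * (ln (real Q) / ln (real z)) * exp E" by (simp add: lnx)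
  finally show ?thesis by (simp add: x_def E_def)
qed

section \<open>Convolutions of twisted reciprocal divisor functions\<close>

lemma divisor_tau_eq_dconv: "tau n = dconv (\<lambda>_. 1) (\<lambda>_. 1) n"
  by (simp add: divisor_tau_def dconv_def)

lemma multf_divisor_tau: "multf (\<lambda>n. tau n)"
  unfolding divisor_tau_eq_dconv by (intro multf_dconv multf_one)

lemma divisor_tau_prime_power: "prime p \<Longrightarrow> tau (p ^ k) = real k + 1"
  by (simp add: divisor_tau_eq_dconv dconv_prime_power)

lemma divisor_tau_ge_1:
  assumes "n > 0"
  shows "divisor_tau n \<ge> 1"
proof -
  have "card {1 :: nat} \<le> card {d. d dvd n}"
    using assms by (intro card_mono) auto
  then show ?thesis by (simp add: divisor_tau_def)
qed

text \<open>Any prescription of values at prime powers extends to a multiplicative function.\<close>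

lemma multf_local_product:
  fixes \<kappa> :: "nat \<Rightarrow> nat \<Rightarrow> real"
  shows "multf (\<lambda>n. \<Prod>p\<in>prime_factors n. \<kappa> p (multiplicity p n))"
proof (rule multfI)
  fix a b :: nat assume ab: "a > 0" "b > 0" "coprime a b"
  have disj: "prime_factors a \<inter> prime_factors b = {}"
  proof (intro equals0I)
    fix p assume "p \<in> prime_factors a \<inter> prime_factors b"
    then have "prime p" "p dvd a" "p dvd b" by (auto simp: prime_factors_dvd)
    then show False using ab(3) coprime_common_divisor not_prime_unit by blast
  qed
  have mult: "multiplicity p (a * b) = multiplicity p a + multiplicity p b" if "prime p" for p
    using ab that by (simp add: prime_elem_multiplicity_mult_distrib)
  have 1: "multiplicity p (a * b) = multiplicity p a" if "p \<in> prime_factors a" for p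
  proof -
    have "\<not> p dvd b" using that disj ab by (auto simp: prime_factors_dvd dest: in_prime_factors_imp_prime)
    then show ?thesis using mult[of p] in_prime_factors_imp_prime[OF that] by (simp add: not_dvd_imp_multiplicity_0)
  qed
  have 2: "multiplicity p (a * b) = multiplicity p b" if "p \<in> prime_factors b" for p
  proof -
    have "\<not> p dvd a" using that disj ab by (auto simp: prime_factors_dvd)
    then show ?thesis using mult[of p] in_prime_factors_imp_prime[OF that] by (simp add: not_dvd_imp_multiplicity_0)
  qed
  have "prime_factors (a * b) = prime_factors a \<union> prime_factors b"
    using ab by (simp add: prime_factors_product)
  then show "(\<Prod>p\<in>prime_factors (a * b). \<kappa> p (multiplicity p (a * b))) =
      (\<Prod>p\<in>prime_factors a. \<kappa> p (multiplicity p a)) * (\<Prod>p\<in>prime_factors b. \<kappa> p (multiplicity p b))"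
    using disj 1 2 by (simp add: prod.union_disjoint)
qed simp

text \<open>The factor that one of the variables \<open>n0, ..., n3\<close> contributes to the summand of \<open>T\<close>, with the
  residue class condition replaced by a character.\<close>

definition twist :: "(nat \<Rightarrow> real) \<Rightarrow> nat \<Rightarrow> nat \<Rightarrow> real" where
  "twist a r n = (if coprime n r then a n else 0) / tau n"

text \<open>Up to a bounded factor this is the product of \<open>1 + 1 / p\<close> over the primes dividing \<open>r\<close>: the cost of the
  condition \<open>coprime n r\<close>.\<close>

definition recip_prime_weight :: "nat \<Rightarrow> real" where
  "recip_prime_weight r = exp (\<Sum>p\<in>prime_factors r. 1 / real p)"

lemma multf_twist:
  assumes "multf a"
  shows "multf (twist a r)"
proof -
  have "multf (\<lambda>n. (if coprime n r then 1 else 0) * (a n * (1 / tau n)))"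
    by (intro multf_times assms multf_inverse multf_divisor_tau) (auto simp: multf_def)
  moreover have "(\<lambda>n. (if coprime n r then 1 else 0) * (a n * (1 / tau n))) = twist a r"
    by (auto simp: twist_def fun_eq_iff)
  ultimately show ?thesis by simp
qed

lemma twist_prime_power:
  assumes "prime p" "a (p ^ k) \<in> {-1, 0, 1 :: real}"
  shows "\<bar>twist a r (p ^ k)\<bar> \<le> 1 / (real k + 1)"
proof -
  have "\<bar>if coprime (p ^ k) r then a (p ^ k) else 0\<bar> \<le> 1" using assms(2) by auto
  from divide_right_mono[OF this, of "real k + 1"] show ?thesis
    unfolding twist_def divisor_tau_prime_power[OF assms(1)] abs_divide by simp
qed

text \<open>Each of the \<open>k + 1\<close> terms is at most \<open>1 / ((i + 1) * (k - i + 1)) \<le> 1 / (k + 1)\<close>.\<close>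

lemma twist_conv_prime_power:
  assumes p: "prime p" and a: "\<And>n. a n \<in> {-1, 0, 1 :: real}" and b: "\<And>n. b n \<in> {-1, 0, 1 :: real}"
  shows "\<bar>dconv (twist a r) (twist b s) (p ^ k)\<bar> \<le> 1"
proof -
  have "\<bar>dconv (twist a r) (twist b s) (p ^ k)\<bar> \<le> (\<Sum>i\<le>k. \<bar>twist a r (p ^ i) * twist b s (p ^ (k - i))\<bar>)"
    unfolding dconv_prime_power[OF p] by (rule sum_abs)
  also have "\<dots> \<le> (\<Sum>i\<le>k. 1 / (real k + 1))"
  proof (rule sum_mono)
    fix i assume i: "i \<in> {..k}"
    have "\<bar>twist a r (p ^ i) * twist b s (p ^ (k - i))\<bar> \<le> (1 / (real i + 1)) * (1 / (real (k - i) + 1))"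
      unfolding abs_mult by (intro mult_mono twist_prime_power p a b) auto
    also have "\<dots> = 1 / ((real i + 1) * (real (k - i) + 1))" by simp
    also have "\<dots> \<le> 1 / (real k + 1)"
    proof (rule divide_left_mono)
      have "(real i + 1) * (real (k - i) + 1) = real i * real (k - i) + real k + 1"
        using i by (simp add: of_nat_diff algebra_simps)
      then show "real k + 1 \<le> (real i + 1) * (real (k - i) + 1)" by simp
    qed (auto intro!: mult_pos_pos)
    finally show "\<bar>twist a r (p ^ i) * twist b s (p ^ (k - i))\<bar> \<le> 1 / (real k + 1)" .
  qed
  also have "\<dots> = 1" by (simp add: field_simps)
  finally show ?thesis .
qed

text \<open>At a prime dividing neither \<open>r\<close> nor \<open>s\<close> the left side is \<open>\<bar>a p + b p\<bar>\<close>, and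
  \<open>\<bar>x + y\<bar> \<le> 1 + x * y\<close> for \<open>x, y \<in> {-1, 0, 1}\<close>. So the product character \<open>a * b\<close> controls the absolute value.\<close>

lemma twist_conv_prime:
  assumes p: "prime p" and a: "\<And>n. a n \<in> {-1, 0, 1 :: real}" and b: "\<And>n. b n \<in> {-1, 0, 1 :: real}"
    and ab: "multf a" "multf b"
  shows "2 * \<bar>dconv (twist a r) (twist b s) p\<bar> \<le>
    1 + a p * b p + ((if p dvd r then 1 else 0) + (if p dvd s then 1 else 0))"
proof -
  have tau: "tau p = 2"
    using divisor_tau_prime_power[OF p, of 1] by (simp only: power_one_right of_nat_1 one_add_one)
  have t: "twist a r p = (if p dvd r then 0 else a p / 2)" "twist b s p = (if p dvd s then 0 else b p / 2)"
  proof -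
    have "coprime p r \<longleftrightarrow> \<not> p dvd r" for r
    proof (cases "p dvd r")
      case True
      then show ?thesis using prime_gt_1_nat[OF p] coprime_absorb_left[OF True] by simp
    next
      case False
      then show ?thesis using prime_imp_coprime[OF p False] by simp
    qed
    then show "twist a r p = (if p dvd r then 0 else a p / 2)" "twist b s p = (if p dvd s then 0 else b p / 2)"
      unfolding twist_def tau by simp_all
  qed
  have 1: "twist a r (Suc 0) = 1" "twist b s (Suc 0) = 1"
    by (rule multf_1[OF multf_twist[OF ab(1)]], rule multf_1[OF multf_twist[OF ab(2)]])
  have "dconv (twist a r) (twist b s) p = twist a r p + twist b s p"
    using dconv_prime_power[OF p, of "twist a r" "twist b s" 1] 1 by simp
  moreover have "2 * \<bar>x / 2\<bar> = \<bar>x\<bar>" "2 * \<bar>x / 2 + y / 2\<bar> = \<bar>x + y\<bar>" for x y :: real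
    by (simp_all add: add_divide_distrib[symmetric])
  moreover have "a p = -1 \<or> a p = 0 \<or> a p = 1" "b p = -1 \<or> b p = 0 \<or> b p = 1"
    using a[of p] b[of p] by auto
  ultimately show ?thesis by (cases "p dvd r"; cases "p dvd s") (auto simp: t)
qed

lemma log_sum_conv_le:
  fixes F G :: "nat \<Rightarrow> real"
  assumes "\<And>n. F n \<ge> 0" "\<And>n. G n \<ge> 0"
  shows "(\<Sum>n = 1..W. dconv F G n / real n) \<le> (\<Sum>n = 1..W. F n / real n) * (\<Sum>n = 1..W. G n / real n)"
    and "(\<Sum>n = 1..N. F n / real n) * (\<Sum>n = 1..N. G n / real n) \<le> (\<Sum>n = 1..N ^ 2. dconv F G n / real n)"
proof -
  have eq: "(\<Sum>n = 1..W. dconv F G n / real n) = (\<Sum>a = 1..W. \<Sum>b = 1..W div a. (F a / real a) * (G b / real b))" for W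
  proof -
    have "(\<Sum>n = 1..W. dconv F G n / real n) = (\<Sum>n = 1..W. \<Sum>d | d dvd n. (F d / real d) * (G (n div d) / real (n div d)))"
      unfolding dconv_def sum_divide_distrib
      by (intro sum.cong refl) (auto simp: real_of_nat_div)
    also have "\<dots> = (\<Sum>a = 1..W. \<Sum>b = 1..W div a. (F a / real a) * (G b / real b))"
      by (rule sum_divisor_pairs)
    finally show ?thesis .
  qed
  have nn: "F a / real a * (G b / real b) \<ge> 0" for a b using assms by simp
  show "(\<Sum>n = 1..W. dconv F G n / real n) \<le> (\<Sum>n = 1..W. F n / real n) * (\<Sum>n = 1..W. G n / real n)"
    unfolding eq sum_product
    by (intro sum_mono sum_mono2 nn) (auto intro: order_trans[OF _ div_le_dividend])
  have "(\<Sum>a = 1..N. \<Sum>b = 1..N. (F a / real a) * (G b / real b)) \<le>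
      (\<Sum>a = 1..N. \<Sum>b = 1..N ^ 2 div a. (F a / real a) * (G b / real b))"
  proof (intro sum_mono sum_mono2 nn)
    fix a assume a: "a \<in> {1..N}"
    have "N \<le> N ^ 2 div a"
      using a by (simp add: less_eq_div_iff_mult_less_eq power2_eq_square)
    then show "{1..N} \<subseteq> {1..N ^ 2 div a}" by auto
  qed auto
  also have "\<dots> \<le> (\<Sum>a = 1..N ^ 2. \<Sum>b = 1..N ^ 2 div a. (F a / real a) * (G b / real b))"
    by (intro sum_mono2 sum_nonneg nn) (auto simp: power2_eq_square intro: order_trans[of _ N])
  finally show "(\<Sum>n = 1..N. F n / real n) * (\<Sum>n = 1..N. G n / real n) \<le> (\<Sum>n = 1..N ^ 2. dconv F G n / real n)"
    unfolding eq sum_product .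
qed

text \<open>Write \<open>g\<close> for the absolute value of the convolution, so that \<open>g * g\<close> takes the value \<open>2 * g p\<close> at a prime,
  close to \<open>1 + a p * b p\<close>, the value of the divisor sum \<open>h\<close> of the product character. Hence the convolution
  \<open>g * g\<close> is dominated by that of \<open>h\<close> with a correction supported on few integers, and the square of the
  logarithmic sum of \<open>g\<close> inherits the bound. Working with \<open>g * g\<close> instead of Euler products keeps a sum
  over \<open>n \<le> N\<^sup>2\<close>, which for \<open>h\<close> is accessible by partial summation.\<close>

lemma twist_conv_mean_square:
  assumes a: "\<And>n. a n \<in> {-1, 0, 1 :: real}" "multf a" and b: "\<And>n. b n \<in> {-1, 0, 1 :: real}" "multf b"
    and f: "real_char (\<lambda>n. a n * b n) q" and rs: "r > 0" "s > 0" and N: "N \<ge> 2"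
  shows "(ln (real N) * (\<Sum>n = 1..N. dconv (twist a r) (twist b s) n)) ^ 2 \<le>
    (117 * real N) ^ 2 * (exp 8 * recip_prime_weight r * recip_prime_weight s *
      (\<Sum>n = 1..N ^ 2. dconv (\<lambda>n. a n * b n) (\<lambda>_. 1) n / real n))"
proof -
  define g where "g n = \<bar>dconv (twist a r) (twist b s) n\<bar>" for n
  define h where "h = dconv (\<lambda>n. a n * b n) (\<lambda>_. 1)"
  define e where "e p = ((if p dvd r then 1 else 0) + (if p dvd s then 1 else 0) :: real)" for p
  \<comment> \<open>The correction: \<open>e p\<close> pays for primes dividing \<open>r\<close> or \<open>s\<close>, and at higher prime powers \<open>k + 1\<close> alone
    dominates \<open>g * g\<close>.\<close>
  define \<kappa> where "\<kappa> n = (\<Prod>p\<in>prime_factors n. if multiplicity p n = 1 then e p else real (multiplicity p n) + 1)" for n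
  have mg: "multf g" unfolding g_def[abs_def] by (intro multf_abs multf_dconv multf_twist a b)
  have g0: "g n \<ge> 0" for n by (simp add: g_def)
  have gpp: "g (p ^ k) \<le> 1" if "prime p" for p k
    unfolding g_def by (intro twist_conv_prime_power that a b)
  have gp: "2 * g p \<le> 1 + a p * b p + e p" if "prime p" for p
    unfolding g_def e_def by (intro twist_conv_prime that a b)
  note h = char_divisor_sum[OF f, folded h_def]
  have m\<kappa>: "multf \<kappa>"
    unfolding \<kappa>_def[abs_def] by (rule multf_local_product[of "\<lambda>p k. if k = 1 then e p else real k + 1"])
  have e02: "0 \<le> e p" "e p \<le> 2" for p by (auto simp: e_def)
  have \<kappa>0: "\<kappa> n \<ge> 0" for n by (auto simp: \<kappa>_def e02 intro!: prod_nonneg)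
  have \<kappa>pp: "\<kappa> (p ^ k) = (if k = 1 then e p else real k + 1)" if "prime p" for p k
  proof (cases "k = 0")
    case False
    have pf: "prime_factors (p ^ k) = {p}" "multiplicity p (p ^ k) = k"
      using that False by (auto simp: prime_factors_power prime_prime_factors)
    have "\<kappa> (p ^ k) = (if multiplicity p (p ^ k) = 1 then e p else real (multiplicity p (p ^ k)) + 1)"
      unfolding \<kappa>_def pf(1) by simp
    then show ?thesis unfolding pf(2) .
  qed (simp add: \<kappa>_def)
  have dom: "0 \<le> dconv g g n \<and> dconv g g n \<le> dconv h \<kappa> n" if "n > 0" for n
  proof (rule multf_mono[OF _ _ _ _ that])
    show "multf (dconv g g)" "multf (dconv h \<kappa>)" by (intro multf_dconv mg m\<kappa> h(1))+
    fix p k :: nat assume p: "prime p"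
    show "0 \<le> dconv g g (p ^ k)" by (intro dconv_nonneg g0)
    have one: "g (Suc 0) = 1" "h (Suc 0) = 1" "\<kappa> (Suc 0) = 1"
      by (rule multf_1[OF mg], rule multf_1[OF h(1)], rule multf_1[OF m\<kappa>])
    consider "k = 0" | "k = 1" | "k \<ge> 2" by linarith
    then show "dconv g g (p ^ k) \<le> dconv h \<kappa> (p ^ k)"
    proof cases
      case 1
      then show ?thesis using one by (simp add: dconv_def)
    next
      case 2
      have "dconv g g p = 2 * g p" using dconv_prime_power[OF p, of g g 1] one by simp
      also have "\<dots> \<le> h p + \<kappa> p" using gp[OF p] h(3)[OF p] \<kappa>pp[OF p, of 1] by simp
      also have "\<dots> = dconv h \<kappa> p" using dconv_prime_power[OF p, of h \<kappa> 1] one by simp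
      finally show ?thesis using 2 by simp
    next
      case 3
      have "dconv g g (p ^ k) \<le> (\<Sum>i\<le>k. 1 * 1)"
        unfolding dconv_prime_power[OF p] by (intro sum_mono mult_mono gpp p g0) auto
      also have "\<dots> = h (p ^ 0) * \<kappa> (p ^ (k - 0))" using 3 one \<kappa>pp[OF p, of k] by simp
      also have "\<dots> \<le> (\<Sum>i\<le>k. h (p ^ i) * \<kappa> (p ^ (k - i)))"
        using h(4) \<kappa>0 by (intro member_le_sum) auto
      also have "\<dots> = dconv h \<kappa> (p ^ k)" by (rule dconv_prime_power[OF p, symmetric])
      finally show ?thesis .
    qed
  qed
  have "(\<Sum>n = 1..N. g n / real n) ^ 2 \<le> (\<Sum>n = 1..N ^ 2. dconv g g n / real n)"
    unfolding power2_eq_square[of "sum _ _"] by (rule log_sum_conv_le(2)) (auto simp: g0)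
  also have "\<dots> \<le> (\<Sum>n = 1..N ^ 2. dconv h \<kappa> n / real n)"
    using dom by (intro sum_mono divide_right_mono) auto
  also have "\<dots> \<le> (\<Sum>n = 1..N ^ 2. h n / real n) * (\<Sum>n = 1..N ^ 2. \<kappa> n / real n)"
    by (rule log_sum_conv_le(1)[OF h(4) \<kappa>0])
  also have "\<dots> \<le> (\<Sum>n = 1..N ^ 2. h n / real n) * (exp 8 * (recip_prime_weight r * recip_prime_weight s))"
  proof (rule mult_left_mono)
    have "(\<Sum>n = 1..N ^ 2. \<kappa> n / real n) \<le> exp 8 * exp (\<Sum>p\<in>primes_le (N ^ 2). \<kappa> p / real p)"
    proof (rule sum_le_euler_product[OF m\<kappa> \<kappa>0])
      fix p k :: nat assume p: "prime p"
      show "\<kappa> (p ^ k) \<le> real k + 1" using \<kappa>pp[OF p, of k] e02[of p] by auto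
    qed
    also have "(\<Sum>p\<in>primes_le (N ^ 2). \<kappa> p / real p) =
        (\<Sum>p\<in>primes_le (N ^ 2). if p dvd r then 1 / real p else 0) + (\<Sum>p\<in>primes_le (N ^ 2). if p dvd s then 1 / real p else 0)"
      unfolding sum.distrib[symmetric]
    proof (rule sum.cong)
      fix p assume "p \<in> primes_le (N ^ 2)"
      then show "\<kappa> p / real p = (if p dvd r then 1 / real p else 0) + (if p dvd s then 1 / real p else 0)"
        using \<kappa>pp[of p 1] by (auto simp: primes_le_def e_def)
    qed simp
    also have "\<dots> \<le> (\<Sum>p\<in>prime_factors r. 1 / real p) + (\<Sum>p\<in>prime_factors s. 1 / real p)"
    proof (rule add_mono)
      have *: "(\<Sum>p\<in>primes_le (N ^ 2). if p dvd r then 1 / real p else 0) \<le> (\<Sum>p\<in>prime_factors r. 1 / real p)" if "r > 0" for r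
      proof -
        have "(\<Sum>p\<in>primes_le (N ^ 2). if p dvd r then 1 / real p else 0) = (\<Sum>p\<in>{p \<in> primes_le (N ^ 2). p dvd r}. 1 / real p)"
          by (rule sum.inter_filter[symmetric]) auto
        also have "\<dots> \<le> (\<Sum>p\<in>prime_factors r. 1 / real p)"
          using that by (intro sum_mono2) (auto simp: primes_le_def prime_factors_dvd)
        finally show ?thesis .
      qed
      show "(\<Sum>p\<in>primes_le (N ^ 2). if p dvd r then 1 / real p else 0) \<le> (\<Sum>p\<in>prime_factors r. 1 / real p)"
        "(\<Sum>p\<in>primes_le (N ^ 2). if p dvd s then 1 / real p else 0) \<le> (\<Sum>p\<in>prime_factors s. 1 / real p)"
        using * rs by auto
    qed
    finally show "(\<Sum>n = 1..N ^ 2. \<kappa> n / real n) \<le> exp 8 * (recip_prime_weight r * recip_prime_weight s)"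
      by (simp add: recip_prime_weight_def exp_add)
    show "0 \<le> (\<Sum>n = 1..N ^ 2. h n / real n)" using h(4) by (intro sum_nonneg) auto
  qed
  finally have sq: "(\<Sum>n = 1..N. g n / real n) ^ 2 \<le>
      exp 8 * recip_prime_weight r * recip_prime_weight s * (\<Sum>n = 1..N ^ 2. h n / real n)"
    by (simp add: mult_ac)
  have lnN: "ln (real N) > 0" using N by simp
  have "\<bar>ln (real N) * (\<Sum>n = 1..N. dconv (twist a r) (twist b s) n)\<bar> \<le> ln (real N) * (\<Sum>n = 1..N. g n)"
    using lnN by (simp add: abs_mult g_def sum_abs)
  also have "\<dots> \<le> 117 * real N * (\<Sum>n = 1..N. g n / real n)"
  proof (rule multf_mean_le_log_mean[OF mg g0])
    fix p k :: nat assume "prime p"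
    from gpp[OF this, of k] show "g (p ^ k) \<le> real k + 1" by simp
  qed
  finally have "(ln (real N) * (\<Sum>n = 1..N. dconv (twist a r) (twist b s) n)) ^ 2 \<le>
      (117 * real N * (\<Sum>n = 1..N. g n / real n)) ^ 2"
    by (rule abs_le_square_iff[THEN iffD1, OF order_trans]) simp
  also have "\<dots> = (117 * real N) ^ 2 * (\<Sum>n = 1..N. g n / real n) ^ 2" by (simp add: power_mult_distrib)
  also have "\<dots> \<le> (117 * real N) ^ 2 * (exp 8 * recip_prime_weight r * recip_prime_weight s * (\<Sum>n = 1..N ^ 2. h n / real n))"
    using sq by (intro mult_left_mono) auto
  finally show ?thesis by (simp add: h_def)
qed

text \<open>The preceding estimates combined: mean value theorem for \<open>g\<close>, domination by \<open>h\<close>, and the bound of \<open>h\<close> by a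
  short Euler product. The hypothesis with \<open>K\<close> absorbs the error term \<open>(1 + 2 * ln Q)\<^sup>2\<close>, which is not
  multiplied by \<open>ln N\<close>.\<close>

lemma twist_conv_bound:
  assumes a: "\<And>n. a n \<in> {-1, 0, 1 :: real}" "multf a" and b: "\<And>n. b n \<in> {-1, 0, 1 :: real}" "multf b"
    and f: "real_char (\<lambda>n. a n * b n) q" and rs: "r > 0" "s > 0" and N: "N \<ge> 2"
    and Q: "q \<le> Q" "2 \<le> Q" "Q \<le> N" and z: "2 \<le> z" "z \<le> Q ^ 3"
    and K: "(1 + 2 * ln (real Q)) ^ 2 \<le> K * ln (real N)"
  shows "ln (real N) * (\<Sum>n = 1..N. dconv (twist a r) (twist b s) n) ^ 2 \<le>
    117 ^ 2 * exp 8 * real N ^ 2 * (recip_prime_weight r * recip_prime_weight s) *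
    (1404 * exp 26 * (ln (real Q) / ln (real z)) * exp (\<Sum>p\<in>primes_le z. a p * b p / real p) + 20 + K)"
proof -
  let ?h = "dconv (\<lambda>n. a n * b n) (\<lambda>_. 1)" and ?S = "\<Sum>n = 1..N. dconv (twist a r) (twist b s) n"
  define H where "H = (\<Sum>n = 1..Q ^ 3. ?h n) / real Q ^ 3"
  define E where "E = 351 * exp 26 * (ln (real Q) / ln (real z)) * exp (\<Sum>p\<in>primes_le z. a p * b p / real p)"
  have "ln 2 \<le> ln (real N)" using N by (intro ln_mono) auto
  then have lnN: "ln (real N) \<ge> 1 / 2" using ln2_ge_half by linarith
  have H0: "H \<ge> 0" unfolding H_def by (intro divide_nonneg_nonneg sum_nonneg char_divisor_sum(4)[OF f]) auto
  have HE: "H \<le> E" unfolding H_def E_def by (rule char_mean_le_short_product[OF f Q(2) z])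
  have N2: "ln (real (N ^ 2)) = 2 * ln (real N)" using N by (simp add: ln_realpow)
  have "(\<Sum>n = 1..N ^ 2. ?h n / real n) \<le> (1 + ln (real (N ^ 2))) * (H + 5 / real Q) + (1 + 2 * ln (real Q)) ^ 2"
    unfolding H_def using Q N by (intro divisor_log_sum_le_char[OF f]) (auto intro!: power_mono)
  also have "\<dots> \<le> (4 * ln (real N)) * (E + 5) + K * ln (real N)"
    using lnN HE H0 Q N2 K by (intro add_mono mult_mono) (auto simp: divide_le_eq)
  also have "\<dots> = ln (real N) * (4 * E + 20 + K)" by (simp add: algebra_simps)
  finally have h: "(\<Sum>n = 1..N ^ 2. ?h n / real n) \<le> ln (real N) * (4 * E + 20 + K)" .
  have "ln (real N) * (ln (real N) * ?S ^ 2) = (ln (real N) * ?S) ^ 2" by (simp add: power2_eq_square mult_ac)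
  also have "\<dots> \<le> (117 * real N) ^ 2 * (exp 8 * recip_prime_weight r * recip_prime_weight s * (\<Sum>n = 1..N ^ 2. ?h n / real n))"
    by (rule twist_conv_mean_square[OF a b f rs N])
  also have "\<dots> \<le> (117 * real N) ^ 2 * (exp 8 * recip_prime_weight r * recip_prime_weight s * (ln (real N) * (4 * E + 20 + K)))"
    using h by (intro mult_left_mono) (auto simp: recip_prime_weight_def)
  also have "\<dots> = ln (real N) * (117 ^ 2 * exp 8 * real N ^ 2 * (recip_prime_weight r * recip_prime_weight s) * (4 * E + 20 + K))"
    by (simp add: power_mult_distrib mult_ac)
  finally have "ln (real N) * ?S ^ 2 \<le> 117 ^ 2 * exp 8 * real N ^ 2 * (recip_prime_weight r * recip_prime_weight s) * (4 * E + 20 + K)"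
    using lnN by (subst (asm) mult_le_cancel_left_pos) auto
  then show ?thesis by (simp add: E_def mult_ac)
qed

section \<open>The Jacobi symbol and its reciprocity law\<close>

lemma cong_iff_mod: "[a = b] (mod c) \<longleftrightarrow> a mod c = b mod c"
  by (simp add: unique_euclidean_semiring_class.cong_def)

lemma cong_mod8_coarser:
  fixes m a :: nat
  assumes "[m = a] (mod 8)"
  shows "m mod 4 = a mod 4" "odd m \<longleftrightarrow> odd a"
proof -
  have "[m = a] (mod 4)" by (rule cong_dvd_modulus_nat[OF assms]) simp
  then show "m mod 4 = a mod 4" unfolding cong_iff_mod .
  have "[m = a] (mod 2)" by (rule cong_dvd_modulus_nat[OF assms]) simp
  then show "odd m \<longleftrightarrow> odd a" unfolding cong_iff_mod even_iff_mod_2_eq_zero by (rule arg_cong)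
qed

lemma prime_factor_odd_gt_2:
  fixes p m :: nat
  assumes "p \<in> prime_factors m" "odd m"
  shows "prime p" "2 < p" "p dvd m"
proof -
  show p: "prime p" "p dvd m" using assms by auto
  have "p \<noteq> 2" using p assms by auto
  then show "2 < p" using prime_ge_2_nat[OF p(1)] by simp
qed

lemma Legendre_values: "Legendre a p \<in> {-1, 0, 1}"
  by (auto simp: Legendre_def)

text \<open>By Euler's criterion both sides agree modulo \<open>p\<close>, and they differ by at most 2.\<close>

lemma Legendre_mult:
  assumes "prime p" "2 < p"
  shows "Legendre (a * b) (int p) = Legendre a (int p) * Legendre b (int p)"
proof -
  let ?e = "(p - 1) div 2"
  have "[Legendre a (int p) * Legendre b (int p) = a ^ ?e * b ^ ?e] (mod int p)"
    using assms by (intro cong_mult euler_criterion)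
  then have "[Legendre (a * b) (int p) = Legendre a (int p) * Legendre b (int p)] (mod int p)"
    using euler_criterion[OF assms, of "a * b"] by (metis cong_sym cong_trans power_mult_distrib)
  then have dvd: "int p dvd Legendre (a * b) (int p) - Legendre a (int p) * Legendre b (int p)"
    by (simp add: cong_iff_dvd_diff)
  have "\<bar>Legendre (a * b) (int p) - Legendre a (int p) * Legendre b (int p)\<bar> \<le> 2"
    using Legendre_values[of "a * b" "int p"] Legendre_values[of a "int p"] Legendre_values[of b "int p"] by auto
  then have "\<bar>Legendre (a * b) (int p) - Legendre a (int p) * Legendre b (int p)\<bar> < int p"
    using assms(2) by linarith
  then have "Legendre (a * b) (int p) - Legendre a (int p) * Legendre b (int p) = 0"
  proof (rule_tac ccontr)
    assume "Legendre (a * b) (int p) - Legendre a (int p) * Legendre b (int p) \<noteq> 0"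
    from dvd_imp_le_int[OF this dvd]
      \<open>\<bar>Legendre (a * b) (int p) - Legendre a (int p) * Legendre b (int p)\<bar> < int p\<close>
    show False by linarith
  qed
  then show ?thesis by simp
qed

lemma Legendre_cong: "[a = b] (mod p) \<Longrightarrow> Legendre a p = Legendre b p"
  unfolding Legendre_def QuadRes_def cong_iff_mod by simp

lemma Legendre_eq_0_iff: "Legendre a p = 0 \<longleftrightarrow> p dvd a"
  by (auto simp: Legendre_def cong_0_iff)

lemma Legendre_1: "prime p \<Longrightarrow> Legendre 1 (int p) = 1"
  unfolding Legendre_def QuadRes_def
  by (auto simp: cong_0_iff intro!: exI[of _ 1])

lemma jacobi_1_right [simp]: "jacobi a 1 = 1" "jacobi a (Suc 0) = 1"
  by (auto simp: jacobi_def)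

lemma jacobi_prime: "prime p \<Longrightarrow> jacobi a p = Legendre a (int p)"
  by (simp add: jacobi_def prime_factorization_prime)

lemma jacobi_mult_right: "m > 0 \<Longrightarrow> n > 0 \<Longrightarrow> jacobi a (m * n) = jacobi a m * jacobi a n"
  by (simp add: jacobi_def prime_factorization_mult)

lemma jacobi_mult_left:
  assumes "odd m"
  shows "jacobi (a * b) m = jacobi a m * jacobi b m"
proof -
  have "image_mset (\<lambda>p. Legendre (a * b) (int p)) (prime_factorization m) =
      image_mset (\<lambda>p. Legendre a (int p) * Legendre b (int p)) (prime_factorization m)"
    using prime_factor_odd_gt_2[OF _ assms] by (intro image_mset_cong Legendre_mult) auto
  then show ?thesis by (simp add: jacobi_def prod_mset.distrib)
qed

lemma jacobi_1_left: "jacobi 1 m = 1"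
proof -
  have "image_mset (\<lambda>p. Legendre 1 (int p)) (prime_factorization m) = image_mset (\<lambda>p. 1) (prime_factorization m)"
    by (intro image_mset_cong Legendre_1) auto
  then show ?thesis by (simp add: jacobi_def)
qed

lemma jacobi_cong:
  assumes "[a = b] (mod int m)"
  shows "jacobi a m = jacobi b m"
proof -
  have "image_mset (\<lambda>p. Legendre a (int p)) (prime_factorization m) =
      image_mset (\<lambda>p. Legendre b (int p)) (prime_factorization m)"
  proof (intro image_mset_cong Legendre_cong)
    fix p assume "p \<in># prime_factorization m"
    then have "int p dvd int m" by auto
    then show "[a = b] (mod int p)" using assms by (rule cong_dvd_modulus[rotated])
  qed
  then show ?thesis by (simp add: jacobi_def)
qed

lemma jacobi_values: "jacobi a m \<in> {-1, 0, 1}"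
proof -
  have "(\<Prod>p\<in>#M. Legendre a (int p)) \<in> {-1, 0, 1}" for M
  proof (induction M)
    case (add p M)
    have "x * y \<in> {-1, 0, 1}" if "x \<in> {-1, 0, 1}" "y \<in> {-1, 0, 1}" for x y :: int
      using that by auto
    from this[OF Legendre_values add] show ?case by simp
  qed simp
  then show ?thesis by (simp add: jacobi_def)
qed

lemma jacobi_not_coprime:
  assumes "m > 0" "\<not> coprime n m"
  shows "jacobi (int n) m = 0"
proof -
  obtain p where p: "prime p" "p dvd n" "p dvd m"
  proof -
    have "gcd n m \<noteq> 1" using assms(2) unfolding coprime_iff_gcd_eq_1 .
    from prime_factor_nat[OF this] obtain p where "prime p" "p dvd gcd n m" by auto
    then show ?thesis using that[of p] by simp
  qed
  then have "p \<in># prime_factorization m" using assms by (simp add: prime_factors_dvd)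
  then have "Legendre (int n) (int p) dvd jacobi (int n) m"
    unfolding jacobi_def by (intro dvd_prod_mset) auto
  moreover have "Legendre (int n) (int p) = 0" using p by (simp add: Legendre_eq_0_iff)
  ultimately show ?thesis by simp
qed

text \<open>The sign \<open>(-1) ^ ((m - 1) div 2 * ((n - 1) div 2))\<close> of the reciprocity law for odd \<open>m\<close> and \<open>n\<close>, in a form
  that shows that only the residues modulo 4 matter.\<close>

definition recip_sign :: "nat \<Rightarrow> nat \<Rightarrow> int" where
  "recip_sign m n = (if m mod 4 = 3 \<and> n mod 4 = 3 then -1 else 1)"

lemma recip_sign_mult:
  assumes "odd a" "odd b"
  shows "recip_sign (a * b) n = recip_sign a n * recip_sign b n"
    "recip_sign n (a * b) = recip_sign n a * recip_sign n b"
proof -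
  have *: "x mod 4 = 1 \<or> x mod 4 = 3" if "odd x" for x :: nat
  proof -
    have "x mod 4 < 4" by simp
    then have "x mod 4 \<in> {0, 1, 2, 3}" by auto
    moreover have "odd (x mod 4)" using that by (simp add: dvd_mod_iff)
    ultimately show ?thesis by auto
  qed
  have table: "(if x * y mod 4 = 3 \<and> w = 3 then -1 else 1) =
      (if x = 3 \<and> w = 3 then -1 else 1 :: int) * (if y = 3 \<and> w = 3 then -1 else 1)"
    if "x = 1 \<or> x = 3" "y = 1 \<or> y = 3" for x y w :: nat
    using that by (elim disjE) simp_all
  have key: "(if (a mod 4) * (b mod 4) mod 4 = 3 \<and> w = 3 then -1 else 1) =
      (if a mod 4 = 3 \<and> w = 3 then -1 else 1 :: int) * (if b mod 4 = 3 \<and> w = 3 then -1 else 1)" for w :: nat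
    by (rule table[OF *[OF assms(1)] *[OF assms(2)]])
  show "recip_sign (a * b) n = recip_sign a n * recip_sign b n"
    unfolding recip_sign_def mod_mult_eq[of a 4 b, symmetric] by (rule key)
  show "recip_sign n (a * b) = recip_sign n a * recip_sign n b"
    unfolding recip_sign_def mod_mult_eq[of a 4 b, symmetric] conj_commute[of "n mod 4 = 3"] by (rule key)
qed

lemma Legendre_reciprocity:
  assumes p: "prime p" "2 < p" and q: "prime q" "2 < q"
  shows "Legendre (int q) (int p) = recip_sign p q * Legendre (int p) (int q)"
proof (cases "p = q")
  case True
  then show ?thesis by (simp add: Legendre_eq_0_iff[THEN iffD2])
next
  case False
  have "odd p" "odd q" using p q prime_odd_nat by auto
  moreover have "even ((x - 1) div 2) \<longleftrightarrow> x mod 4 \<noteq> 3" if "odd x" for x :: nat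
    using that by presburger
  ultimately have "even ((p - 1) div 2) \<longleftrightarrow> p mod 4 \<noteq> 3" "even ((q - 1) div 2) \<longleftrightarrow> q mod 4 \<noteq> 3" by blast+
  then have "(-1::int) ^ ((p - 1) div 2 * ((q - 1) div 2)) = recip_sign p q"
    by (simp add: recip_sign_def uminus_power_if)
  then have "Legendre (int p) (int q) * Legendre (int q) (int p) = recip_sign p q"
    using Quadratic_Reciprocity[OF p q False] by simp
  moreover have "recip_sign p q \<in> {-1, 1}" by (auto simp: recip_sign_def)
  ultimately show ?thesis
    using Legendre_values[of "int p" "int q"] Legendre_values[of "int q" "int p"] by auto
qed

lemma jacobi_reciprocity_prime:
  assumes p: "prime p" "2 < p"
  shows "odd n \<Longrightarrow> jacobi (int n) p = recip_sign p n * jacobi (int p) n"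
proof (induction n rule: prime_divisors_induct)
  case (unit n)
  then show ?case by (simp add: jacobi_1_left recip_sign_def)
next
  case (factor q n)
  then have o: "odd q" "odd n" by auto
  then have q2: "2 < q" using factor(1) prime_ge_2_nat[of q] by (metis le_neq_implies_less dvd_refl)
  have op: "odd p" using p prime_odd_nat by auto
  have pos: "q > 0" "n > 0" using o by (auto intro: Nat.gr0I)
  have "jacobi (int (q * n)) p = jacobi (int q) p * jacobi (int n) p"
    using jacobi_mult_left[OF op, of "int q" "int n"] by simp
  also have "\<dots> = (recip_sign p q * jacobi (int p) q) * (recip_sign p n * jacobi (int p) n)"
    using Legendre_reciprocity[OF p factor(1) q2] factor(2)[OF o(2)] p factor(1) by (simp add: jacobi_prime)
  also have "\<dots> = recip_sign p (q * n) * jacobi (int p) (q * n)"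
    by (simp add: recip_sign_mult[OF o] jacobi_mult_right pos)
  finally show ?case .
qed auto

text \<open>Both sides are multiplicative in \<open>m\<close> and in \<open>n\<close>, so quadratic reciprocity for primes suffices. If \<open>m\<close> and
  \<open>n\<close> have a common factor, both symbols vanish.\<close>

lemma jacobi_reciprocity:
  shows "odd m \<Longrightarrow> odd n \<Longrightarrow> jacobi (int n) m = recip_sign m n * jacobi (int m) n"
proof (induction m rule: prime_divisors_induct)
  case (unit m)
  then show ?case by (simp add: jacobi_1_left recip_sign_def)
next
  case (factor p m)
  then have o: "odd p" "odd m" by auto
  then have p2: "2 < p" using factor(1) prime_ge_2_nat[of p] by (metis le_neq_implies_less dvd_refl)
  have pos: "p > 0" "m > 0" using o by (auto intro: Nat.gr0I)
  have "jacobi (int n) (p * m) = jacobi (int n) p * jacobi (int n) m"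
    by (simp add: jacobi_mult_right pos)
  also have "\<dots> = (recip_sign p n * jacobi (int p) n) * (recip_sign m n * jacobi (int m) n)"
    using jacobi_reciprocity_prime[OF factor(1) p2 factor(4)] factor(2)[OF o(2) factor(4)] by simp
  also have "\<dots> = recip_sign (p * m) n * jacobi (int (p * m)) n"
    using jacobi_mult_left[OF factor(4), of "int p" "int m"] by (simp add: recip_sign_mult[OF o])
  finally show ?case .
qed auto

section \<open>Cancellation in sums of Jacobi symbols\<close>

text \<open>Otherwise squaring would map \<open>{1..<p}\<close> onto itself modulo \<open>p\<close>, hence injectively; but 1 and \<open>p - 1\<close> have
  the same square.\<close>

lemma exists_nonresidue:
  assumes "prime p" "2 < p"
  shows "\<exists>a. Legendre (int a) (int p) = -1"
proof (rule ccontr)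
  assume no: "\<nexists>a. Legendre (int a) (int p) = -1"
  define f where "f y = y ^ 2 mod p" for y :: nat
  have "{1..<p} \<subseteq> f ` {1..<p}"
  proof
    fix a assume a: "a \<in> {1..<p}"
    have "\<not> int p dvd int a" using a nat_dvd_not_less[of a p] by simp
    then have "Legendre (int a) (int p) \<noteq> 0" by (simp add: Legendre_eq_0_iff)
    moreover have "Legendre (int a) (int p) \<noteq> -1" using no by blast
    ultimately have "QuadRes (int p) (int a)" by (simp add: Legendre_def split: if_splits)
    then obtain y where y: "[y ^ 2 = int a] (mod int p)" by (auto simp: QuadRes_def)
    define x where "x = nat (y mod int p)"
    have ix: "int x = y mod int p" using assms by (simp add: x_def)
    then have "[int x ^ 2 = int a] (mod int p)" using y by (simp add: cong_iff_mod power_mod)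
    then have "[x ^ 2 = a] (mod p)" using cong_int_iff[of "x ^ 2" a p] by simp
    then have fx: "f x = a" using a by (simp add: f_def cong_iff_mod)
    moreover have "x \<noteq> 0"
    proof
      assume "x = 0"
      then have "f x = 0" by (simp add: f_def)
      then show False using fx a by simp
    qed
    moreover have "x < p" using ix assms by (simp only: of_nat_less_iff[symmetric, where ?'a = int]) simp
    ultimately show "a \<in> f ` {1..<p}" by auto
  qed
  then have "inj_on f {1..<p}" by (intro finite_surj_inj) auto
  moreover have "f 1 = f (p - 1)"
  proof -
    have "[int (p - 1) ^ 2 = 1] (mod int p)"
      using assms by (simp add: of_nat_diff cong_iff_dvd_diff power2_eq_square algebra_simps)
    then have "[(p - 1) ^ 2 = 1] (mod p)" using cong_int_iff[of "(p - 1) ^ 2" 1 p] by simp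
    then show ?thesis by (simp add: f_def cong_iff_mod)
  qed
  ultimately have "1 = p - 1" using assms by (auto dest: inj_onD)
  then show False using assms by simp
qed

text \<open>Chinese remaindering: a non-residue modulo one prime factor of \<open>m\<close> that is 1 modulo 8 and modulo the
  cofactor. Squarefreeness makes that prime coprime to the cofactor.\<close>

lemma exists_jacobi_minus_one:
  assumes "odd m" "squarefree m" "m > 1"
  shows "\<exists>u. [u = 1] (mod 8) \<and> coprime u (8 * m) \<and> jacobi (int u) m = -1"
proof -
  obtain p where p: "prime p" "p dvd m" using prime_factor_nat[of m] assms by auto
  obtain m' where m': "m = p * m'" using p by auto
  have p2: "2 < p" using prime_factor_odd_gt_2[of p m] p assms by (simp add: prime_factors_dvd)
  have pos: "p > 0" "m' > 0" using assms m' by (auto intro: Nat.gr0I)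
  have "\<not> p dvd m'"
  proof
    assume "p dvd m'"
    then have "p ^ 2 dvd m" by (auto simp: m' power2_eq_square)
    then show False using assms(2) p by (auto simp: squarefree_def)
  qed
  moreover have "\<not> p dvd 8"
  proof
    assume "p dvd 8"
    then have "p dvd 2 ^ 3" by simp
    then have "p dvd 2" using p(1) prime_dvd_power by blast
    then show False using p2 by (auto dest: dvd_imp_le)
  qed
  ultimately have cop: "coprime p (8 * m')" using p(1) by (simp add: prime_imp_coprime prime_dvd_mult_iff)
  obtain a where a: "Legendre (int a) (int p) = -1" using exists_nonresidue[OF p(1) p2] by auto
  obtain u where u: "[u = a] (mod p)" "[u = 1] (mod (8 * m'))"
    using binary_chinese_remainder_nat[OF cop] by blast
  have u8: "[u = 1] (mod 8)" "[u = 1] (mod m')"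
    using u(2) by (auto intro: cong_dvd_modulus_nat)
  have "jacobi (int u) m = jacobi (int u) p * jacobi (int u) m'"
    by (simp add: m' jacobi_mult_right pos)
  also have "jacobi (int u) p = jacobi (int a) p"
    using u by (intro jacobi_cong) (simp add: cong_int_iff)
  also have "\<dots> = -1" using a p by (simp add: jacobi_prime)
  also have "jacobi (int u) m' = jacobi 1 m'"
    using u8(2) cong_int_iff[of u 1 m'] by (intro jacobi_cong) simp
  finally have j: "jacobi (int u) m = -1" by (simp add: jacobi_1_left)
  then have "coprime u m" using jacobi_not_coprime[of m u] assms by (cases "coprime u m") auto
  moreover have "coprime u 8" by (rule cong_imp_coprime[OF cong_sym[OF u8(1)]]) simp
  ultimately have "coprime u (8 * m)" by simp
  then show ?thesis using u8(1) j by blast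
qed

lemma periodic_mod:
  fixes f :: "nat \<Rightarrow> real"
  assumes "\<And>n. f (n + q) = f n"
  shows "f (n mod q) = f n"
proof -
  have "f (n + k * q) = f n" for n k
  proof (induction k)
    case (Suc k)
    then show ?case using assms[of "n + k * q"] by (simp add: algebra_simps)
  qed auto
  from this[of "n mod q" "n div q"] show ?thesis by simp
qed

text \<open>Multiplication by \<open>u\<close> permutes the residues modulo \<open>q\<close> and changes the sign of \<open>f\<close>, so the sum over a full
  period vanishes and at most one incomplete period remains.\<close>

lemma periodic_antisymmetric_partial_sum:
  fixes f :: "nat \<Rightarrow> real"
  assumes per: "\<And>n. f (n + q) = f n" and "q > 0" and bd: "\<And>n. \<bar>f n\<bar> \<le> 1"
    and u: "coprime u q" "\<And>n. f (u * n) = - f n"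
  shows "\<bar>\<Sum>k = 1..n. f k\<bar> \<le> real q"
proof -
  note md = periodic_mod[of f q, OF per]
  have inj: "inj_on (\<lambda>k. u * k mod q) {..<q}"
  proof (rule inj_onI)
    fix x y assume xy: "x \<in> {..<q}" "y \<in> {..<q}" "u * x mod q = u * y mod q"
    then have "[u * x = u * y] (mod q)" by (simp add: cong_iff_mod)
    then have "[x = y] (mod q)" using u(1) by (simp add: cong_mult_lcancel_nat coprime_commute)
    then show "x = y" using xy by (simp add: cong_iff_mod)
  qed
  have im: "(\<lambda>k. u * k mod q) ` {..<q} = {..<q}"
    using inj \<open>q > 0\<close> by (intro endo_inj_surj) auto
  have "(\<Sum>k<q. f k) = (\<Sum>k<q. f (u * k mod q))"
    using sum.reindex[OF inj, of f] im by simp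
  also have "\<dots> = - (\<Sum>k<q. f k)" by (simp add: md u sum_negf)
  finally have zero: "(\<Sum>k<q. f k) = 0" by simp
  have "(\<Sum>k<q * d + r. f k) = (\<Sum>k<r. f k)" for d r
  proof (induction d)
    case (Suc d)
    have "(\<Sum>k<q + N. f k) = (\<Sum>k<q. f k) + (\<Sum>k<N. f k)" for N
      by (induction N) (auto simp: per[of N for N, simplified add.commute])
    from this[of "q * d + r"] show ?case using Suc zero by (simp add: algebra_simps)
  qed auto
  from this[of "Suc n div q" "Suc n mod q"] have "(\<Sum>k<Suc n. f k) = (\<Sum>k<Suc n mod q. f k)" by simp
  moreover have "(\<Sum>k<Suc n. f k) = f 0 + (\<Sum>k = 1..n. f k)"
    by (simp add: lessThan_Suc_atMost sum.atMost_shift atLeast0AtMost[symmetric] sum.atLeast_Suc_atMost)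
  moreover have "f 0 = 0" using u(2)[of 0] by simp
  moreover have "\<bar>\<Sum>k<Suc n mod q. f k\<bar> \<le> real q"
  proof -
    have "\<bar>\<Sum>k<Suc n mod q. f k\<bar> \<le> (\<Sum>k<Suc n mod q. 1)"
      by (rule order_trans[OF sum_abs sum_mono]) (rule bd)
    also have "\<dots> \<le> real q" using \<open>q > 0\<close> by (simp add: less_imp_le)
    finally show ?thesis .
  qed
  ultimately show ?thesis by simp
qed

lemma jacobi_periodic: "jacobi (int (n + m * k)) m = jacobi (int n) m"
  by (rule jacobi_cong) (simp add: cong_iff_mod)

definition char_mod8 :: "(nat \<Rightarrow> real) \<Rightarrow> bool" where
  "char_mod8 \<chi> \<longleftrightarrow> \<chi> 1 = 1 \<and> (\<forall>a b. \<chi> (a * b) = \<chi> a * \<chi> b) \<and> (\<forall>n. \<chi> n \<in> {-1, 0, 1}) \<and>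
     (\<forall>n. \<chi> (n mod 8) = \<chi> n)"

lemma char_mod8_mult:
  assumes "char_mod8 \<chi>" "char_mod8 \<chi>'"
  shows "char_mod8 (\<lambda>n. \<chi> n * \<chi>' n)"
proof -
  have "\<chi> n * \<chi>' n \<in> {-1, 0, 1}" for n
  proof -
    have "\<chi> n \<in> {-1, 0, 1}" "\<chi>' n \<in> {-1, 0, 1}" using assms by (auto simp: char_mod8_def)
    then show ?thesis by auto
  qed
  then show ?thesis using assms by (auto simp: char_mod8_def)
qed

lemma char_mod8_cong:
  assumes "char_mod8 \<chi>" "[a = b] (mod 8)"
  shows "\<chi> a = \<chi> b"
  using assms by (metis char_mod8_def cong_iff_mod)

text \<open>The multiplier \<open>u\<close> is 1 modulo 8, so \<open>\<chi> u = 1\<close> and multiplication by \<open>u\<close> reverses the sign of the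
  product, whatever \<open>\<chi>\<close> is.\<close>

lemma real_char_jacobi:
  assumes \<chi>: "char_mod8 \<chi>" and m: "odd m" "squarefree m" "m > 1"
  shows "real_char (\<lambda>n. jac n m * \<chi> n) (8 * m)"
proof -
  let ?f = "\<lambda>n. jac n m * \<chi> n"
  have vals: "?f n \<in> {-1, 0, 1}" for n
  proof -
    have "\<chi> n \<in> {-1, 0, 1}" using \<chi> by (auto simp: char_mod8_def)
    then show ?thesis using jacobi_values[of "int n" m] by auto
  qed
  have mult: "?f (a * b) = ?f a * ?f b" for a b
    using \<chi> by (simp add: char_mod8_def jacobi_mult_left[OF m(1)])
  obtain u where u: "[u = 1] (mod 8)" "coprime u (8 * m)" "jacobi (int u) m = -1"
    using exists_jacobi_minus_one[OF m] by auto
  have "\<chi> u = 1" using char_mod8_cong[OF \<chi> u(1)] \<chi> by (simp add: char_mod8_def)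
  then have fu: "?f u = -1" using u(3) by simp
  have "\<bar>\<Sum>k = 1..n. ?f k\<bar> \<le> real (8 * m)" for n
  proof (rule periodic_antisymmetric_partial_sum[OF _ _ _ u(2)])
    fix n
    have "\<chi> (n + 8 * m) = \<chi> n" by (rule char_mod8_cong[OF \<chi>]) (simp add: cong_iff_mod)
    moreover have "jacobi (int (n + m * 8)) m = jacobi (int n) m" by (rule jacobi_periodic)
    ultimately show "?f (n + 8 * m) = ?f n" by (simp add: mult.commute)
    show "?f (u * n) = - ?f n" unfolding mult fu by simp
    show "\<bar>?f n\<bar> \<le> 1" using vals[of n] by auto
  qed (use m in auto)
  moreover have "?f 1 = 1" using \<chi> by (simp add: char_mod8_def jacobi_1_left)
  ultimately show ?thesis using vals mult unfolding real_char_def by blast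
qed

text \<open>Here the modulus varies and the numerator is fixed. Reciprocity exchanges them with a sign that is
  constant on the class of \<open>a\<close>, after which the summand has period \<open>8 * n\<close>.\<close>

lemma jacobi_class_sum:
  assumes n: "odd n" "squarefree n" "n > 1" and a: "odd a"
  shows "\<bar>\<Sum>m | 1 \<le> m \<and> m \<le> U \<and> [m = a] (mod 8). jac n m\<bar> \<le> 8 * real n"
proof -
  let ?F = "\<lambda>m. if [m = a] (mod 8) then jac m n else 0"
  obtain u where u: "[u = 1] (mod 8)" "coprime u (8 * n)" "jacobi (int u) n = -1"
    using exists_jacobi_minus_one[OF n] by auto
  have "\<bar>\<Sum>k = 1..U. ?F k\<bar> \<le> real (8 * n)"
  proof (rule periodic_antisymmetric_partial_sum[OF _ _ _ u(2)])
    fix m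
    have "[m + 8 * n = a] (mod 8) \<longleftrightarrow> [m = a] (mod 8)" by (simp add: cong_iff_mod)
    moreover have "jacobi (int (m + n * 8)) n = jacobi (int m) n" by (rule jacobi_periodic)
    ultimately show "?F (m + 8 * n) = ?F m" by (simp add: mult.commute)
    have "[u * m = m] (mod 8)" using cong_scalar_right[OF u(1), of m] by simp
    then have "[u * m = a] (mod 8) \<longleftrightarrow> [m = a] (mod 8)" by (meson cong_sym cong_trans)
    then show "?F (u * m) = - ?F m" using u(3) by (simp add: jacobi_mult_left[OF n(1)])
    show "\<bar>?F m\<bar> \<le> 1" using jacobi_values[of "int m" n] by auto
  qed (use n in auto)
  also have "(\<Sum>k = 1..U. ?F k) = (\<Sum>m | 1 \<le> m \<and> m \<le> U \<and> [m = a] (mod 8). jac m n)"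
  proof -
    have "{m. 1 \<le> m \<and> m \<le> U \<and> [m = a] (mod 8)} = {m \<in> {1..U}. [m = a] (mod 8)}" by auto
    then show ?thesis by (simp only:) (rule sum.inter_filter[symmetric], simp)
  qed
  finally have 1: "\<bar>\<Sum>m | 1 \<le> m \<and> m \<le> U \<and> [m = a] (mod 8). jac m n\<bar> \<le> 8 * real n" by simp
  have flip: "(\<Sum>m | 1 \<le> m \<and> m \<le> U \<and> [m = a] (mod 8). jac n m) =
      (\<Sum>m | 1 \<le> m \<and> m \<le> U \<and> [m = a] (mod 8). recip_sign a n * jac m n)"
  proof (rule sum.cong[OF refl])
    fix m assume "m \<in> {m. 1 \<le> m \<and> m \<le> U \<and> [m = a] (mod 8)}"
    then have m: "[m = a] (mod 8)" by blast
    have "m mod 4 = a mod 4" "odd m" using cong_mod8_coarser[OF m] a by blast+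
    then have "recip_sign m n = recip_sign a n" "odd m" unfolding recip_sign_def by simp_all
    then show "jac n m = recip_sign a n * jac m n"
      using jacobi_reciprocity[OF _ n(1), of m] by simp
  qed
  have abs1: "\<bar>real_of_int (recip_sign a n)\<bar> = 1" by (simp add: recip_sign_def)
  show ?thesis unfolding flip sum_distrib_left[symmetric] abs_mult abs1 mult_1_left by (rule 1)
qed

section \<open>The real characters modulo 8\<close>

text \<open>The indices 0, 1, 2, 3 stand for the principal character modulo 8, the character modulo 4, the symbol
  \<open>(2 / n)\<close>, and the product of the last two.\<close>

definition chi8 :: "nat \<Rightarrow> nat \<Rightarrow> real" where
  "chi8 i n = (if even n then 0 else
     (if i \<in> {1, 3} \<and> n mod 4 = 3 then -1 else 1) * (if i \<in> {2, 3} \<and> n mod 8 \<in> {3, 5} then -1 else 1))"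

lemma chi8_mod: "chi8 i (n mod 8) = chi8 i n"
proof -
  have 1: "even (n mod 8) \<longleftrightarrow> even n" by (simp add: dvd_mod_iff)
  have 2: "n mod 8 mod 4 = n mod 4" by (rule mod_mod_cancel) simp
  show ?thesis unfolding chi8_def 1 2 mod_mod_trivial ..
qed

lemma odd_residues_cases:
  fixes n :: nat
  assumes "odd n"
  shows "n mod 8 = 1 \<and> n mod 4 = 1 \<or> n mod 8 = 3 \<and> n mod 4 = 3 \<or>
    n mod 8 = 5 \<and> n mod 4 = 1 \<or> n mod 8 = 7 \<and> n mod 4 = 3"
proof -
  define r where "r = n mod 8"
  have "r < 8" by (simp add: r_def)
  then have "r \<in> {0, 1, 2, 3, 4, 5, 6, 7}" by auto
  moreover have "odd r" using assms by (simp add: r_def dvd_mod_iff)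
  moreover have "n mod 4 = r mod 4" unfolding r_def by (rule mod_mod_cancel[symmetric]) simp
  ultimately show ?thesis unfolding r_def[symmetric] by auto
qed

lemma chi8_mult: "chi8 i (a * b) = chi8 i a * chi8 i b"
proof (cases "odd a \<and> odd b")
  case True
  define G where "G r s = ((if i \<in> {1, 3} \<and> r = (3 :: nat) then -1 else 1) *
    (if i \<in> {2, 3} \<and> s \<in> {3, 5 :: nat} then -1 else 1) :: real)" for r s
  have chi: "chi8 i n = G (n mod 4) (n mod 8)" if "odd n" for n
    using that by (simp add: chi8_def G_def)
  have table: "G (ra * rb mod 4) (sa * sb mod 8) = G ra sa * G rb sb"
    if "sa = 1 \<and> ra = 1 \<or> sa = 3 \<and> ra = 3 \<or> sa = 5 \<and> ra = 1 \<or> sa = 7 \<and> ra = 3"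
      "sb = 1 \<and> rb = 1 \<or> sb = 3 \<and> rb = 3 \<or> sb = 5 \<and> rb = 1 \<or> sb = 7 \<and> rb = 3" for ra rb sa sb
    using that unfolding G_def by (elim disjE conjE; simp)
  from True have odd: "odd a" "odd b" "odd (a * b)" by simp_all
  from chi[OF odd(3)] have "chi8 i (a * b) = G ((a mod 4) * (b mod 4) mod 4) ((a mod 8) * (b mod 8) mod 8)"
    by (simp only: mod_mult_eq)
  also have "\<dots> = G (a mod 4) (a mod 8) * G (b mod 4) (b mod 8)"
    by (rule table[OF odd_residues_cases[OF odd(1)] odd_residues_cases[OF odd(2)]])
  finally show ?thesis unfolding chi[OF odd(1)] chi[OF odd(2)] .
qed (auto simp: chi8_def)

lemma char_mod8_chi8: "char_mod8 (chi8 i)"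
  unfolding char_mod8_def using chi8_mult chi8_mod by (auto simp: chi8_def)

lemma chi8_orthogonality:
  assumes "odd q"
  shows "(\<Sum>i<4. chi8 i n * chi8 i q) = (if [n = q] (mod 8) then 4 else 0)"
proof (cases "odd n")
  case True
  have 4: "(\<Sum>i<4. chi8 i n * chi8 i q) = chi8 0 n * chi8 0 q + chi8 1 n * chi8 1 q + chi8 2 n * chi8 2 q + chi8 3 n * chi8 3 q"
    by (simp add: eval_nat_numeral)
  define X where "X r s i = ((if i \<in> {1, 3} \<and> r = (3 :: nat) then -1 else 1) *
    (if i \<in> {2, 3 :: nat} \<and> s \<in> {3, 5 :: nat} then -1 else 1) :: real)" for r s i
  have chi: "chi8 i m = X (m mod 4) (m mod 8) i" if "odd m" for i m
    using that by (simp add: chi8_def X_def)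
  have "X ra sa 0 * X rb sb 0 + X ra sa 1 * X rb sb 1 + X ra sa 2 * X rb sb 2 + X ra sa 3 * X rb sb 3 =
      (if sa = sb then 4 else 0)"
    if "sa = 1 \<and> ra = 1 \<or> sa = 3 \<and> ra = 3 \<or> sa = 5 \<and> ra = 1 \<or> sa = 7 \<and> ra = 3"
      "sb = 1 \<and> rb = 1 \<or> sb = 3 \<and> rb = 3 \<or> sb = 5 \<and> rb = 1 \<or> sb = 7 \<and> rb = 3" for ra rb sa sb
    using that unfolding X_def by (elim disjE conjE; simp)
  from this[OF odd_residues_cases[OF True] odd_residues_cases[OF assms]]
  show ?thesis unfolding 4 unfolding cong_iff_mod chi[OF True] chi[OF assms] .
next
  case False
  then have "\<not> [n = q] (mod 8)" using assms cong_mod8_coarser(2) by blast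
  then show ?thesis using False by (simp add: chi8_def)
qed

section \<open>Separation of the variables\<close>

definition hyper_range :: "nat \<Rightarrow> nat \<Rightarrow> nat \<Rightarrow> nat \<Rightarrow> nat \<Rightarrow> (nat \<times> nat) set" where
  "hyper_range q0 q1 r0 r1 N = {(n0, n1). n0 > 0 \<and> n1 > 0 \<and> n0 * n1 \<le> N \<and>
     coprime n0 (2 * r0) \<and> coprime n1 (2 * r1) \<and> [n0 = q0] (mod 8) \<and> [n1 = q1] (mod 8)}"

text \<open>One of the two factors of \<open>T\<close>: the variables \<open>n0, n1\<close> under the hyperbola \<open>n0 * n1 = N\<close>.\<close>

definition hyper_sum :: "nat \<Rightarrow> nat \<Rightarrow> nat \<Rightarrow> nat \<Rightarrow> nat \<Rightarrow> nat \<Rightarrow> real" where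
  "hyper_sum m q0 q1 r0 r1 N = (\<Sum>(n0, n1)\<in>hyper_range q0 q1 r0 r1 N.
     jac n0 m / (tau n0 * tau n1))"

lemma le_nat_floor_div_iff:
  fixes a c M :: nat
  assumes "c > 0" "M > 0" "X \<ge> 0"
  shows "real (a * c * M) \<le> X \<longleftrightarrow> a \<le> nat \<lfloor>X / real (M * c)\<rfloor>"
proof -
  have "real (a * c * M) \<le> X \<longleftrightarrow> real a \<le> X / real (M * c)"
    using assms by (simp add: pos_le_divide_eq mult_ac)
  also have "\<dots> \<longleftrightarrow> int a \<le> \<lfloor>X / real (M * c)\<rfloor>" by (simp add: le_floor_iff)
  also have "\<dots> \<longleftrightarrow> a \<le> nat \<lfloor>X / real (M * c)\<rfloor>" using assms by (simp add: nat_le_eq_zle le_nat_iff)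
  finally show ?thesis .
qed

text \<open>A bound on a maximum bounds both entries separately, so the range of summation is a product set; the
  symbol of \<open>n0 * n2\<close> splits by complete multiplicativity.\<close>

lemma T_sum_factor:
  assumes "c01 > 0" "c23 > 0" "X \<ge> 0" and M: "M = max (m0 * d0) (m1 * d1)" "M > 0" and m: "odd (m0 * m1)"
  shows "T_sum (\<lambda>m n. jacobi (int n) m) q r c01 c23 d0 d1 X m0 m1 =
    hyper_sum (m0 * m1) (q 0) (q 1) (r 0) (r 1) (nat \<lfloor>X / real (M * c01)\<rfloor>) *
    hyper_sum (m0 * m1) (q 2) (q 3) (r 2) (r 3) (nat \<lfloor>X / real (M * c23)\<rfloor>)"
proof -
  let ?A = "hyper_range (q 0) (q 1) (r 0) (r 1) (nat \<lfloor>X / real (M * c01)\<rfloor>)"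
  let ?B = "hyper_range (q 2) (q 3) (r 2) (r 3) (nat \<lfloor>X / real (M * c23)\<rfloor>)"
  have size: "real (max (a * c01) (b * c23) * M) \<le> X \<longleftrightarrow>
      a \<le> nat \<lfloor>X / real (M * c01)\<rfloor> \<and> b \<le> nat \<lfloor>X / real (M * c23)\<rfloor>" for a b
  proof -
    have "max (a * c01) (b * c23) * M = max (a * c01 * M) (b * c23 * M)"
      by (simp add: nat_mult_max_left)
    then have "real (max (a * c01) (b * c23) * M) \<le> X \<longleftrightarrow> real (a * c01 * M) \<le> X \<and> real (b * c23 * M) \<le> X"
      by (simp only: of_nat_max max.bounded_iff)
    then show ?thesis using assms by (simp only: le_nat_floor_div_iff)
  qed
  have "T_sum (\<lambda>m n. jacobi (int n) m) q r c01 c23 d0 d1 X m0 m1 =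
      (\<Sum>((n0, n1), (n2, n3))\<in>?A \<times> ?B.
        (jac n0 (m0 * m1) / (tau n0 * tau n1)) *
        (jac n2 (m0 * m1) / (tau n2 * tau n3)))"
    unfolding T_sum_def
  proof (rule sum.reindex_bij_witness[of _ "\<lambda>((n0, n1), (n2, n3)). (n0, n1, n2, n3)" "\<lambda>(n0, n1, n2, n3). ((n0, n1), (n2, n3))"], goal_cases)
    case (2 x)
    then show ?case unfolding T_range_def M(1)[symmetric] size hyper_range_def by auto
  next
    case (4 x)
    then show ?case unfolding T_range_def M(1)[symmetric] size hyper_range_def by auto
  next
    case (5 x)
    obtain n0 n1 n2 n3 where x: "x = (n0, n1, n2, n3)" by (metis surj_pair)
    have "jacobi (int (n0 * n2)) (m0 * m1) = jacobi (int n0) (m0 * m1) * jacobi (int n2) (m0 * m1)"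
      using jacobi_mult_left[OF m, of "int n0" "int n2"] by simp
    then show ?case unfolding x by simp
  qed auto
  also have "\<dots> = (\<Sum>x\<in>?A. \<Sum>y\<in>?B.
        (case x of (n0, n1) \<Rightarrow> jac n0 (m0 * m1) / (tau n0 * tau n1)) *
        (case y of (n2, n3) \<Rightarrow> jac n2 (m0 * m1) / (tau n2 * tau n3)))"
    by (simp add: sum.cartesian_product case_prod_unfold)
  also have "\<dots> = hyper_sum (m0 * m1) (q 0) (q 1) (r 0) (r 1) (nat \<lfloor>X / real (M * c01)\<rfloor>) *
      hyper_sum (m0 * m1) (q 2) (q 3) (r 2) (r 3) (nat \<lfloor>X / real (M * c23)\<rfloor>)"
    unfolding hyper_sum_def by (rule sum_product[symmetric])
  finally show ?thesis .
qed

text \<open>The reciprocity sign depends on \<open>n0 * n2\<close> only modulo 4, hence only on \<open>q 0\<close> and \<open>q 2\<close>.\<close>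

lemma T_sum_other_symbol:
  assumes m: "odd (m0 * m1)" and q: "odd (q 0)" "odd (q 2)" and \<psi>: "\<psi> \<in> jacobi_symbols"
  shows "\<bar>T_sum \<psi> q r c01 c23 d0 d1 X m0 m1\<bar> =
    \<bar>T_sum (\<lambda>m n. jacobi (int n) m) q r c01 c23 d0 d1 X m0 m1\<bar>"
proof -
  define s where "s = recip_sign (q 0 * q 2) (m0 * m1)"
  have "T_sum (\<lambda>m n. jacobi (int m) n) q r c01 c23 d0 d1 X m0 m1 =
      real_of_int s * T_sum (\<lambda>m n. jacobi (int n) m) q r c01 c23 d0 d1 X m0 m1"
    unfolding T_sum_def sum_distrib_left
  proof (rule sum.cong[OF refl], safe)
    fix n0 n1 n2 n3 assume n: "(n0, n1, n2, n3) \<in> T_range q r c01 c23 d0 d1 X m0 m1"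
    then have c: "[n0 = q 0] (mod 8)" "[n2 = q 2] (mod 8)" by (auto simp: T_range_def)
    then have c8: "[n0 * n2 = q 0 * q 2] (mod 8)" by (rule cong_mult)
    have "(n0 * n2) mod 4 = (q 0 * q 2) mod 4" by (rule cong_mod8_coarser(1)[OF c8])
    then have s: "recip_sign (n0 * n2) (m0 * m1) = s" by (simp add: s_def recip_sign_def)
    have "odd (n0 * n2)"
      using cong_mod8_coarser(2)[OF c8] q by simp
    from jacobi_reciprocity[OF this m]
    have "jacobi (int (m0 * m1)) (n0 * n2) = s * jacobi (int (n0 * n2)) (m0 * m1)" unfolding s .
    then show "jac (m0 * m1) (n0 * n2) /
        (tau n0 * tau n1 * tau n2 * tau n3) =
       real_of_int s * (jac (n0 * n2) (m0 * m1) /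
        (tau n0 * tau n1 * tau n2 * tau n3))"
      by simp
  qed
  moreover have "\<bar>real_of_int s\<bar> = 1" by (simp add: s_def recip_sign_def)
  ultimately have "\<bar>T_sum (\<lambda>m n. jacobi (int m) n) q r c01 c23 d0 d1 X m0 m1\<bar> =
      \<bar>T_sum (\<lambda>m n. jacobi (int n) m) q r c01 c23 d0 d1 X m0 m1\<bar>" by (simp add: abs_mult)
  then show ?thesis using \<psi> unfolding jacobi_symbols_def by auto
qed

lemma class_twist:
  assumes "odd q"
  shows "(\<Sum>i<4. chi8 i q * twist (\<lambda>n. a n * chi8 i n) r n) =
    (if coprime n r \<and> [n = q] (mod 8) then 4 * a n / tau n else 0)"
proof (cases "coprime n r")
  case True
  have "(\<Sum>i<4. chi8 i q * twist (\<lambda>n. a n * chi8 i n) r n) = (\<Sum>i<4. a n / tau n * (chi8 i n * chi8 i q))"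
    using True by (intro sum.cong refl) (simp add: twist_def)
  also have "\<dots> = a n / tau n * (\<Sum>i<4. chi8 i n * chi8 i q)"
    by (rule sum_distrib_left[symmetric])
  finally show ?thesis using True by (simp add: chi8_orthogonality[OF assms])
qed (simp add: twist_def)

lemma hyper_sum_expand:
  assumes q: "odd q0" "odd q1"
  shows "16 * hyper_sum m q0 q1 r0 r1 N = (\<Sum>i<4. \<Sum>j<4. chi8 i q0 * chi8 j q1 *
    (\<Sum>n = 1..N. dconv (twist (\<lambda>n. jac n m * chi8 i n) r0) (twist (chi8 j) r1) n))"
proof -
  define F where "F i = twist (\<lambda>n. jac n m * chi8 i n) r0" for i
  define G where "G j = twist (chi8 j) r1" for j
  define u where "u a = (if coprime a r0 \<and> [a = q0] (mod 8) then 4 * jac a m / tau a else 0)" for a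
  define v where "v b = (if coprime b r1 \<and> [b = q1] (mod 8) then 4 * 1 / tau b else 0)" for b
  have F: "(\<Sum>i<4. chi8 i q0 * F i a) = u a" for a
    unfolding F_def u_def by (rule class_twist[OF q(1)])
  have G: "(\<Sum>j<4. chi8 j q1 * G j b) = v b" for b
    unfolding G_def v_def using class_twist[OF q(2), of "\<lambda>_. 1"] by simp
  let ?T = "Sigma {1..N} (\<lambda>a. {1..N div a})"
  define h where "h i j x = (chi8 i q0 * F i (fst x)) * (chi8 j q1 * G j (snd x))" for i j x
  have "(\<Sum>i<4. \<Sum>j<4. chi8 i q0 * chi8 j q1 * (\<Sum>n = 1..N. dconv (F i) (G j) n)) =
      (\<Sum>i<4. \<Sum>j<4. \<Sum>x\<in>?T. h i j x)"
  proof (intro sum.cong refl)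
    fix i j :: nat
    have "(\<Sum>n = 1..N. dconv (F i) (G j) n) = (\<Sum>a = 1..N. \<Sum>b = 1..N div a. F i a * G j b)"
      unfolding dconv_def by (rule sum_divisor_pairs)
    also have "\<dots> = (\<Sum>(a, b)\<in>?T. F i a * G j b)"
      by (rule sum.Sigma) auto
    finally show "chi8 i q0 * chi8 j q1 * (\<Sum>n = 1..N. dconv (F i) (G j) n) = (\<Sum>x\<in>?T. h i j x)"
      by (simp add: sum_distrib_left mult_ac case_prod_unfold h_def)
  qed
  also have "\<dots> = (\<Sum>i<4. \<Sum>x\<in>?T. \<Sum>j<4. h i j x)"
    by (intro sum.cong refl sum.swap)
  also have "\<dots> = (\<Sum>x\<in>?T. \<Sum>i<4. \<Sum>j<4. h i j x)"
    by (rule sum.swap)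
  also have "\<dots> = (\<Sum>(a, b)\<in>?T. u a * v b)"
    unfolding h_def F[symmetric] G[symmetric] sum_product case_prod_unfold ..
  also have "\<dots> = (\<Sum>(a, b)\<in>hyper_range q0 q1 r0 r1 N. u a * v b)"
  proof (rule sum.mono_neutral_cong_right)
    show "hyper_range q0 q1 r0 r1 N \<subseteq> Sigma {1..N} (\<lambda>a. {1..N div a})"
    proof
      fix x assume "x \<in> hyper_range q0 q1 r0 r1 N"
      then obtain a b where x: "x = (a, b)" "a > 0" "b > 0" "a * b \<le> N" by (auto simp: hyper_range_def)
      then have "b \<le> N div a" by (simp add: less_eq_div_iff_mult_less_eq mult.commute)
      moreover have "a \<le> N" using factor_le_bound[of b a N] x by simp
      ultimately show "x \<in> Sigma {1..N} (\<lambda>a. {1..N div a})" using x by auto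
    qed
    show "\<forall>x\<in>Sigma {1..N} (\<lambda>a. {1..N div a}) - hyper_range q0 q1 r0 r1 N. (case x of (a, b) \<Rightarrow> u a * v b) = 0"
    proof
      fix x assume x: "x \<in> Sigma {1..N} (\<lambda>a. {1..N div a}) - hyper_range q0 q1 r0 r1 N"
      obtain a b where ab: "x = (a, b)" by (metis surj_pair)
      have 1: "a > 0" "b > 0" "a * b \<le> N"
        using x ab by (auto simp: less_eq_div_iff_mult_less_eq mult.commute)
      have "odd n" if "[n = q] (mod 8)" "odd q" for n q :: nat
        using cong_mod8_coarser(2)[OF that(1)] that(2) by simp
      then have "\<not> (coprime a r0 \<and> [a = q0] (mod 8) \<and> coprime b r1 \<and> [b = q1] (mod 8))"
        using x ab 1 q by (auto simp: hyper_range_def)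
      then have "u a = 0 \<or> v b = 0" by (auto simp: u_def v_def)
      then show "(case x of (a, b) \<Rightarrow> u a * v b) = 0" by (auto simp: ab)
    qed
  qed auto
  also have "\<dots> = (\<Sum>(a, b)\<in>hyper_range q0 q1 r0 r1 N.
      16 * (jac a m / (tau a * tau b)))"
    by (rule sum.cong) (auto simp: u_def v_def hyper_range_def)
  also have "\<dots> = 16 * hyper_sum m q0 q1 r0 r1 N"
    unfolding hyper_sum_def by (simp add: sum_distrib_left case_prod_unfold)
  finally show ?thesis unfolding F_def G_def ..
qed

text \<open>Cauchy and Schwarz over the 16 pairs of characters.\<close>

lemma hyper_sum_square_le:
  assumes q: "odd q0" "odd q1"
    and bd: "\<And>i j. i < 4 \<Longrightarrow> j < 4 \<Longrightarrow>
      (\<Sum>n = 1..N. dconv (twist (\<lambda>n. jac n m * chi8 i n) r0) (twist (chi8 j) r1) n)\<^sup>2 \<le> B i j"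
  shows "(hyper_sum m q0 q1 r0 r1 N)\<^sup>2 \<le> (\<Sum>i<4. \<Sum>j<4. B i j)"
proof -
  define S where "S i j = (\<Sum>n = 1..N. dconv (twist (\<lambda>n. jac n m * chi8 i n) r0) (twist (chi8 j) r1) n)" for i j
  let ?I = "{..<4 :: nat} \<times> {..<4 :: nat}"
  have chi: "\<bar>chi8 i n\<bar> \<le> 1" for i n by (simp add: chi8_def)
  have "(16 * hyper_sum m q0 q1 r0 r1 N)\<^sup>2 = (\<Sum>(i, j)\<in>?I. (chi8 i q0 * chi8 j q1) * S i j)\<^sup>2"
    unfolding hyper_sum_expand[OF q] S_def by (simp add: sum.cartesian_product)
  also have "\<dots> \<le> (\<Sum>(i, j)\<in>?I. (chi8 i q0 * chi8 j q1)\<^sup>2) * (\<Sum>(i, j)\<in>?I. (S i j)\<^sup>2)"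
    using Cauchy_Schwarz_ineq_sum[of "\<lambda>(i, j). chi8 i q0 * chi8 j q1" "\<lambda>(i, j). S i j" ?I]
    by (simp add: case_prod_unfold)
  also have "\<dots> \<le> 16 * (\<Sum>(i, j)\<in>?I. B i j)"
  proof (rule mult_mono)
    have "(\<Sum>(i, j)\<in>?I. (chi8 i q0 * chi8 j q1)\<^sup>2) \<le> (\<Sum>(i, j)\<in>?I. 1)"
    proof (rule sum_mono, safe)
      fix i j
      have "\<bar>chi8 i q0 * chi8 j q1\<bar> \<le> 1 * 1" unfolding abs_mult by (intro mult_mono chi) auto
      then show "(chi8 i q0 * chi8 j q1)\<^sup>2 \<le> 1" by (simp add: abs_square_le_1)
    qed
    then show "(\<Sum>(i, j)\<in>?I. (chi8 i q0 * chi8 j q1)\<^sup>2) \<le> 16" by simp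
    show "(\<Sum>(i, j)\<in>?I. (S i j)\<^sup>2) \<le> (\<Sum>(i, j)\<in>?I. B i j)"
      using bd by (intro sum_mono) (auto simp: S_def)
  qed (auto intro!: sum_nonneg)
  finally have "256 * (hyper_sum m q0 q1 r0 r1 N)\<^sup>2 \<le> 16 * (\<Sum>(i, j)\<in>?I. B i j)"
    by (simp add: power_mult_distrib)
  moreover have "(hyper_sum m q0 q1 r0 r1 N)\<^sup>2 \<ge> 0" by simp
  ultimately have "(hyper_sum m q0 q1 r0 r1 N)\<^sup>2 \<le> (\<Sum>(i, j)\<in>?I. B i j)" by linarith
  then show ?thesis by (simp add: sum.cartesian_product)
qed

section \<open>Short Euler products and the Rankin bound\<close>

definition residue_upto :: "nat \<Rightarrow> nat \<Rightarrow> nat set" where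
  "residue_upto a U = {m. 1 \<le> m \<and> m \<le> U \<and> [m = a] (mod 8)}"

text \<open>Up to bounded factors, the Euler product of \<open>L(1, f)\<close> truncated at \<open>z\<close>.\<close>

definition short_product :: "(nat \<Rightarrow> real) \<Rightarrow> nat \<Rightarrow> real" where
  "short_product f z = exp (\<Sum>p\<in>primes_le z. f p / real p)"

lemma finite_residue_upto [simp, intro]: "finite (residue_upto a U)"
  by (rule finite_subset[of _ "{..U}"]) (auto simp: residue_upto_def)

lemma card_residue_upto: "real (card (residue_upto a U)) \<le> real U"
proof -
  have "card (residue_upto a U) \<le> card {1..U}"
    by (intro card_mono) (auto simp: residue_upto_def)
  then show ?thesis by simp
qed

lemma residue_upto_odd: "odd a \<Longrightarrow> m \<in> residue_upto a U \<Longrightarrow> odd m"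
  using cong_mod8_coarser(2) by (auto simp: residue_upto_def)

lemma exp_le_linear:
  fixes y :: real
  assumes "\<bar>y\<bar> \<le> 1 / 2"
  shows "exp y \<le> (1 + y) * exp (2 * y\<^sup>2)"
proof -
  have "y - ln (1 + y) \<le> 2 * y\<^sup>2" using abs_ln_one_plus_x_minus_x_bound[OF assms] by linarith
  then have "exp y \<le> exp (ln (1 + y) + 2 * y\<^sup>2)" by simp
  also have "\<dots> = (1 + y) * exp (2 * y\<^sup>2)" using assms by (simp add: exp_add)
  finally show ?thesis .
qed

text \<open>From 5 onwards \<open>\<bar>2 * f p / p\<bar> \<le> 1 / 2\<close>, so that \<open>1 + 2 * f p / p\<close> is positive and close to
  \<open>exp (2 * f p / p)\<close>.\<close>

definition mid_primes :: "nat \<Rightarrow> nat set" where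
  "mid_primes z = {p \<in> primes_le z. 5 \<le> p}"

lemma mid_primesD: "p \<in> mid_primes z \<Longrightarrow> prime p \<and> 5 \<le> p \<and> p \<le> z"
  by (auto simp: mid_primes_def primes_le_def)

lemma finite_mid_primes [simp, intro]: "finite (mid_primes z)"
  by (auto simp: mid_primes_def)

text \<open>Linearising the exponential turns the square into a finite product over single primes, whose
  expansion runs over squarefree integers only. The errors \<open>O(1 / p\<^sup>2)\<close> and the primes 2 and 3 go into
  the constant.\<close>

lemma short_product_square_le:
  assumes "\<And>p. \<bar>f p\<bar> \<le> 1"
  shows "short_product f z ^ 2 \<le> exp 12 * (\<Prod>p\<in>mid_primes z. 1 + 2 * f p / real p)"
proof -
  have small: "(\<Sum>p\<in>primes_le z. 2 * f p / real p) \<le> (\<Sum>p\<in>mid_primes z. 2 * f p / real p) + 4"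
  proof -
    have "(\<Sum>p\<in>primes_le z - mid_primes z. 2 * f p / real p) \<le> (\<Sum>p\<in>primes_le z - mid_primes z. 1)"
    proof (rule sum_mono)
      fix p assume "p \<in> primes_le z - mid_primes z"
      then have p2: "real p \<ge> 2" using prime_ge_2_nat[of p] by (auto simp: primes_le_def)
      then show "2 * f p / real p \<le> 1" using assms[of p] by (simp add: pos_divide_le_eq)
    qed
    also have "\<dots> = real (card (primes_le z - mid_primes z))" by simp
    also have "\<dots> \<le> real (card {1, 2, 3, 4 :: nat})"
      unfolding of_nat_le_iff
      by (intro card_mono) (auto simp: mid_primes_def primes_le_def dest: prime_gt_0_nat)
    finally have "(\<Sum>p\<in>primes_le z - mid_primes z. 2 * f p / real p) \<le> 4" by simp
    then show ?thesis
      using sum.subset_diff[of "mid_primes z" "primes_le z" "\<lambda>p. 2 * f p / real p"]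
      by (simp add: mid_primes_def)
  qed
  have "short_product f z ^ 2 = exp (\<Sum>p\<in>primes_le z. 2 * f p / real p)"
    unfolding short_product_def exp_double[symmetric] by (simp add: sum_distrib_left)
  also have "\<dots> \<le> exp ((\<Sum>p\<in>mid_primes z. 2 * f p / real p) + 4)" using small by simp
  also have "\<dots> = exp 4 * (\<Prod>p\<in>mid_primes z. exp (2 * f p / real p))"
    by (simp add: exp_add exp_sum mult.commute)
  also have "\<dots> \<le> exp 4 * (\<Prod>p\<in>mid_primes z. (1 + 2 * f p / real p) * exp (8 * (1 / real p ^ 2)))"
  proof (intro mult_left_mono prod_mono conjI)
    fix p assume "p \<in> mid_primes z"
    then have p5: "real p \<ge> 5" by (auto simp: mid_primes_def)
    let ?y = "2 * f p / real p"
    have "\<bar>?y\<bar> = 2 * \<bar>f p\<bar> / real p" using p5 by (simp add: abs_mult)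
    also have "\<dots> \<le> 2 * 1 / real p" using assms[of p] by (intro divide_right_mono mult_left_mono) auto
    finally have y: "\<bar>?y\<bar> \<le> 2 / real p" by simp
    also have "2 / real p \<le> 1 / 2" using p5 by (simp add: field_simps)
    finally have half: "\<bar>?y\<bar> \<le> 1 / 2" .
    have "?y\<^sup>2 \<le> (2 / real p)\<^sup>2" using y p5 by (intro abs_le_square_iff[THEN iffD1]) simp
    then have "2 * ?y\<^sup>2 \<le> 8 * (1 / real p ^ 2)" by (simp add: power_divide)
    then have "exp (2 * ?y\<^sup>2) \<le> exp (8 * (1 / real p ^ 2))" by simp
    then have "(1 + ?y) * exp (2 * ?y\<^sup>2) \<le> (1 + ?y) * exp (8 * (1 / real p ^ 2))"
    proof (rule mult_left_mono)
      show "0 \<le> 1 + ?y" using half by linarith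
    qed
    then show "exp ?y \<le> (1 + ?y) * exp (8 * (1 / real p ^ 2))"
      using exp_le_linear[OF half] by linarith
  qed auto
  also have "\<dots> = exp 4 * exp (8 * (\<Sum>p\<in>mid_primes z. 1 / real p ^ 2)) * (\<Prod>p\<in>mid_primes z. 1 + 2 * f p / real p)"
    by (simp add: prod.distrib exp_sum sum_distrib_left)
  also have "\<dots> \<le> exp 4 * exp 8 * (\<Prod>p\<in>mid_primes z. 1 + 2 * f p / real p)"
  proof (intro mult_right_mono mult_left_mono)
    have "(\<Sum>p\<in>mid_primes z. 1 / real p ^ 2) \<le> (\<Sum>p\<in>primes_le z. 1 / real p ^ 2)"
      by (intro sum_mono2) (auto simp: mid_primes_def)
    then have "(\<Sum>p\<in>mid_primes z. 1 / real p ^ 2) \<le> 1" using sum_primes_recip_squares[of z] by linarith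
    then show "exp (8 * (\<Sum>p\<in>mid_primes z. 1 / real p ^ 2)) \<le> exp 8" by simp
    show "0 \<le> (\<Prod>p\<in>mid_primes z. 1 + 2 * f p / real p)"
    proof (rule prod_nonneg)
      fix p assume "p \<in> mid_primes z"
      then have p5: "real p \<ge> 5" by (auto simp: mid_primes_def)
      have "f p \<ge> -1" using assms[of p] by linarith
      then show "0 \<le> 1 + 2 * f p / real p" using p5 by (simp add: field_simps)
    qed
  qed auto
  also have "exp 4 * exp 8 = exp (12 :: real)" unfolding exp_add[symmetric] by simp
  finally show ?thesis .
qed

lemma jacobi_prod:
  assumes "odd m"
  shows "(\<Prod>p\<in>S. jacobi (int p) m) = jacobi (int (\<Prod>S)) m"
proof (induction S rule: infinite_finite_induct)
  case (insert p S)
  then show ?case using jacobi_mult_left[OF assms, of "int p" "int (\<Prod>S)"] by simp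
qed (auto simp: jacobi_1_left)

lemma mid_primes_subset_prod:
  assumes "S \<subseteq> mid_primes z"
  shows "squarefree (\<Prod>S)" "odd (\<Prod>S)" "\<Prod>S > 0" "2 ^ card S \<le> \<Prod>S" "S \<noteq> {} \<Longrightarrow> \<Prod>S > 1"
    "prime p \<Longrightarrow> p dvd \<Prod>S \<longleftrightarrow> p \<in> S"
proof -
  have fin: "finite S" using assms finite_mid_primes by (rule finite_subset)
  have pr: "prime q" "5 \<le> q" if "q \<in> S" for q using that assms mid_primesD by blast+
  show "squarefree (\<Prod>S)"
    by (rule squarefree_prod_coprime) (auto simp: pr primes_coprime squarefree_prime)
  show iff: "p dvd \<Prod>S \<longleftrightarrow> p \<in> S" if pp: "prime p" for p
  proof
    assume "p dvd \<Prod>S"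
    then obtain x where x: "x \<in> S" "p dvd x" using prime_dvd_prod_iff[OF fin pp, of "\<lambda>x. x"] by auto
    then show "p \<in> S" using primes_dvd_imp_eq[OF pp pr(1)[OF x(1)]] by simp
  next
    assume "p \<in> S"
    then have "\<exists>x\<in>S. p dvd x" by (intro bexI[of _ p]) auto
    then show "p dvd \<Prod>S" using prime_dvd_prod_iff[OF fin pp, of "\<lambda>x. x"] by blast
  qed
  have "\<not> 2 dvd \<Prod>S" using iff[of 2] pr(2)[of 2] by auto
  then show "odd (\<Prod>S)" .
  show "\<Prod>S > 0" using pr by (auto intro!: prod_pos dest: prime_gt_0_nat)
  have "(\<Prod>p\<in>S. 2) \<le> (\<Prod>p\<in>S. p)" using pr by (intro prod_mono) (auto dest: prime_ge_2_nat)
  then show le: "2 ^ card S \<le> \<Prod>S" by simp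
  assume "S \<noteq> {}"
  then have "card S \<ge> 1" using fin by (simp add: Suc_le_eq card_gt_0_iff)
  then have "(2::nat) ^ 1 \<le> 2 ^ card S" by (intro power_increasing) auto
  then show "\<Prod>S > 1" using le by simp
qed

lemma exp_beats_power:
  fixes y :: real
  assumes "y \<ge> 0"
  shows "y ^ 48 * exp (- y / 4) \<le> 192 ^ 48"
proof -
  \<comment> \<open>\<open>192 = 4 * 48\<close>, so that the 48th power of \<open>exp (y / 192)\<close> is \<open>exp (y / 4)\<close>.\<close>
  have "(y / 192) ^ 48 \<le> exp (y / 192) ^ 48"
    using assms exp_ge_add_one_self[of "y / 192"] by (intro power_mono) linarith+
  also have "\<dots> = exp (y / 4)" by (simp add: exp_of_nat_mult[symmetric])
  finally have "y ^ 48 \<le> 192 ^ 48 * exp (y / 4)" by (simp add: power_divide field_simps)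
  then have "y ^ 48 * exp (- y / 4) \<le> 192 ^ 48 * exp (y / 4) * exp (- y / 4)"
    by (intro mult_right_mono) auto
  also have "\<dots> = 192 ^ 48" by (simp add: mult.assoc exp_add[symmetric])
  finally show ?thesis .
qed

text \<open>Rankin's trick with exponent \<open>\<delta> = 1 / ln z\<close>: each term is multiplied by \<open>(n / V) powr \<delta> \<ge> 1\<close>, where \<open>n\<close> is
  the product of \<open>S\<close>. The weights stay of order \<open>1 / p\<close> because \<open>p powr \<delta> \<le> exp 1\<close> for \<open>p \<le> z\<close>, and
  \<open>2 * exp 1 \<le> 6\<close>.\<close>

lemma rankin_tail:
  assumes z: "z \<ge> 2" and V: "V > 0"
  shows "(\<Sum>S\<in>{S \<in> Pow (mid_primes z). real (\<Prod>S) > V}. 2 ^ card S / real (\<Prod>S)) \<le>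
    exp (- ln V / ln (real z)) * exp (6 * ln (ln (real z)) + 30)"
proof -
  define \<delta> where "\<delta> = 1 / ln (real z)"
  have lnz: "ln (real z) > 0" using z by simp
  have \<delta>: "\<delta> > 0" using lnz by (simp add: \<delta>_def)
  let ?P = "Pow (mid_primes z)"
  have "(\<Sum>S\<in>{S \<in> ?P. real (\<Prod>S) > V}. 2 ^ card S / real (\<Prod>S)) \<le>
      (\<Sum>S\<in>{S \<in> ?P. real (\<Prod>S) > V}. exp (- \<delta> * ln V) * (\<Prod>p\<in>S. 2 * exp 1 * (1 / real p)))"
  proof (rule sum_mono)
    fix S assume S: "S \<in> {S \<in> ?P. real (\<Prod>S) > V}"
    then have sub: "S \<subseteq> mid_primes z" by auto
    have fin: "finite S" using sub finite_mid_primes by (rule finite_subset)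
    have "1 \<le> exp (\<delta> * (ln (real (\<Prod>S)) - ln V))"
      using S V \<delta> by (auto intro!: mult_nonneg_nonneg ln_mono)
    also have "\<dots> = exp (- \<delta> * ln V) * exp (\<delta> * ln (real (\<Prod>S)))"
      unfolding exp_add[symmetric] by (simp add: algebra_simps)
    also have "exp (\<delta> * ln (real (\<Prod>S))) = (\<Prod>p\<in>S. exp (\<delta> * ln (real p)))"
    proof -
      have "ln (real (\<Prod>S)) = (\<Sum>p\<in>S. ln (real p))"
        unfolding of_nat_prod
      proof (rule ln_prod[OF fin])
        fix i assume "i \<in> S"
        then have "5 \<le> i" using sub mid_primesD by blast
        then show "real i \<noteq> 0" by simp
      qed
      then show ?thesis using fin by (simp add: exp_sum sum_distrib_left)
    qed
    also have "exp (- \<delta> * ln V) * \<dots> \<le> exp (- \<delta> * ln V) * (\<Prod>p\<in>S. exp 1)"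
    proof (intro mult_left_mono prod_mono conjI)
      fix p assume "p \<in> S"
      then have p: "p \<ge> 5" "p \<le> z" using sub mid_primesD by blast+
      then have "ln (real p) \<le> ln (real z)" by (intro ln_mono) auto
      then have "\<delta> * ln (real p) \<le> 1" using lnz by (simp add: \<delta>_def)
      then show "exp (\<delta> * ln (real p)) \<le> exp 1" by simp
    qed auto
    finally have "1 \<le> exp (- \<delta> * ln V) * (\<Prod>p\<in>S. exp 1)" .
    then have "2 ^ card S / real (\<Prod>S) * 1 \<le> 2 ^ card S / real (\<Prod>S) * (exp (- \<delta> * ln V) * (\<Prod>p\<in>S. exp 1))"
      by (rule mult_left_mono) (simp add: prod_nonneg)
    also have "\<dots> = exp (- \<delta> * ln V) * (\<Prod>p\<in>S. 2 * exp 1 * (1 / real p))"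
      by (simp add: prod.distrib prod_dividef)
    finally show "2 ^ card S / real (\<Prod>S) \<le> exp (- \<delta> * ln V) * (\<Prod>p\<in>S. 2 * exp 1 * (1 / real p))" by simp
  qed
  also have "\<dots> \<le> (\<Sum>S\<in>?P. exp (- \<delta> * ln V) * (\<Prod>p\<in>S. 2 * exp 1 * (1 / real p)))"
    by (intro sum_mono2) (auto intro!: mult_nonneg_nonneg prod_nonneg)
  also have "\<dots> = exp (- \<delta> * ln V) * (\<Sum>S\<in>?P. \<Prod>p\<in>S. 2 * exp 1 * (1 / real p))"
    by (rule sum_distrib_left[symmetric])
  also have "(\<Sum>S\<in>?P. \<Prod>p\<in>S. 2 * exp 1 * (1 / real p)) = (\<Prod>p\<in>mid_primes z. 2 * exp 1 * (1 / real p) + 1)"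
    by (subst prod_add) auto
  also have "\<dots> \<le> (\<Prod>p\<in>mid_primes z. exp (2 * exp 1 * (1 / real p)))"
    using exp_ge_add_one_self by (intro prod_mono) (auto simp: add.commute)
  also have "\<dots> = exp (2 * exp 1 * (\<Sum>p\<in>mid_primes z. 1 / real p))"
    by (simp add: exp_sum sum_distrib_left)
  also have "\<dots> \<le> exp (6 * ln (ln (real z)) + 30)"
  proof -
    have "(\<Sum>p\<in>mid_primes z. 1 / real p) \<le> (\<Sum>p\<in>primes_le z. 1 / real p)"
      by (intro sum_mono2) (auto simp: mid_primes_def)
    also have "\<dots> \<le> ln (ln (real z)) + 5" by (rule mertens_recip_upper[OF z])
    finally have s: "(\<Sum>p\<in>mid_primes z. 1 / real p) \<le> ln (ln (real z)) + 5" .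
    have "2 * exp 1 * (\<Sum>p\<in>mid_primes z. 1 / real p) \<le> 6 * (\<Sum>p\<in>mid_primes z. 1 / real p)"
      using exp_le by (intro mult_right_mono sum_nonneg) auto
    then show ?thesis using s by simp
  qed
  finally show ?thesis by (simp add: \<delta>_def mult_left_mono)
qed

section \<open>Mean squares of short Euler products\<close>

lemma prod_inj_mid_primes: "inj_on (\<lambda>S. \<Prod>S) (Pow (mid_primes z))"
proof (rule inj_onI)
  fix S S' assume S: "S \<in> Pow (mid_primes z)" "S' \<in> Pow (mid_primes z)" and eq: "\<Prod>S = \<Prod>S'"
  have "p \<in> S \<longleftrightarrow> p \<in> S'" if "p \<in> mid_primes z" for p
    using mid_primes_subset_prod(6)[of S z p] mid_primes_subset_prod(6)[of S' z p] S eq mid_primesD[OF that] by auto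
  then show "S = S'" using S by auto
qed

definition mid_coeff :: "(nat \<Rightarrow> real) \<Rightarrow> nat set \<Rightarrow> real" where
  "mid_coeff \<chi> S = (\<Prod>p\<in>S. 2 * \<chi> p / real p)"

lemma mid_coeff_le:
  assumes "\<And>p. \<bar>\<chi> p\<bar> \<le> 1" "S \<subseteq> mid_primes z"
  shows "\<bar>mid_coeff \<chi> S\<bar> \<le> 2 ^ card S / real (\<Prod>S)"
proof -
  have "\<bar>mid_coeff \<chi> S\<bar> = (\<Prod>p\<in>S. \<bar>2 * \<chi> p / real p\<bar>)" by (simp add: mid_coeff_def abs_prod)
  also have "\<dots> \<le> (\<Prod>p\<in>S. 2 / real p)"
  proof (intro prod_mono conjI)
    fix p
    have "\<bar>2 * \<chi> p / real p\<bar> = 2 * \<bar>\<chi> p\<bar> / real p" by (simp add: abs_mult)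
    also have "\<dots> \<le> 2 * 1 / real p" using assms(1)[of p] by (intro divide_right_mono mult_left_mono) auto
    finally show "\<bar>2 * \<chi> p / real p\<bar> \<le> 2 / real p" by simp
  qed auto
  also have "\<dots> = 2 ^ card S / real (\<Prod>S)" by (simp add: prod_dividef)
  finally show ?thesis .
qed

lemma mid_product_expand:
  assumes "odd m0" "odd m1"
  shows "(\<Prod>p\<in>mid_primes z. 1 + 2 * (jac p (m0 * m1) * \<chi> p) / real p) =
    (\<Sum>S\<in>Pow (mid_primes z). mid_coeff \<chi> S * (jac (\<Prod>S) m0 * jac (\<Prod>S) m1))"
proof -
  have pos: "m0 > 0" "m1 > 0" using assms by (auto intro: Nat.gr0I)
  have "(\<Prod>p\<in>mid_primes z. 1 + 2 * (jac p (m0 * m1) * \<chi> p) / real p) =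
      (\<Prod>p\<in>mid_primes z. (2 * \<chi> p / real p) * (jac p m0 * jac p m1) + 1)"
    by (intro prod.cong refl) (simp add: jacobi_mult_right pos mult_ac)
  also have "\<dots> = (\<Sum>S\<in>Pow (mid_primes z). \<Prod>p\<in>S. (2 * \<chi> p / real p) * (jac p m0 * jac p m1))"
    by (subst prod_add) auto
  also have "\<dots> = (\<Sum>S\<in>Pow (mid_primes z). mid_coeff \<chi> S * (jac (\<Prod>S) m0 * jac (\<Prod>S) m1))"
    by (intro sum.cong refl)
       (simp only: mid_coeff_def prod.distrib jacobi_prod[OF assms(1), symmetric] jacobi_prod[OF assms(2), symmetric] of_int_prod)
  finally show ?thesis .
qed

lemma sum_jacobi_trivial:
  "\<bar>\<Sum>m\<in>residue_upto a U. real_of_int (jacobi n m)\<bar> \<le> real U"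
proof -
  have "\<bar>\<Sum>m\<in>residue_upto a U. real_of_int (jacobi n m)\<bar> \<le> (\<Sum>m\<in>residue_upto a U. 1)"
  proof (rule order_trans[OF sum_abs sum_mono])
    fix m
    show "\<bar>real_of_int (jacobi n m)\<bar> \<le> 1" using jacobi_values[of n m] by auto
  qed
  also have "\<dots> \<le> real U" using card_residue_upto by simp
  finally show ?thesis .
qed

text \<open>Expand the squares over subsets \<open>S\<close> of the primes, with product \<open>n\<close>, and sum over the moduli first. The
  empty set gives the main term. For \<open>1 < n \<le> V\<close> the sum over \<open>m1\<close> is at most \<open>8 * n\<close>, because \<open>n\<close> is squarefree and so
  not a square; for larger \<open>n\<close> the trivial bound meets the Rankin tail. All moduli in the classes may be
  included, since the products are positive for every modulus.\<close>

lemma short_product_mean_square_rankin: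
  assumes \<chi>: "\<And>p. \<bar>\<chi> p\<bar> \<le> 1" and a: "odd a0" "odd a1" and z: "z \<ge> 2" and U: "U1 \<ge> 1"
  shows "(\<Sum>m0\<in>residue_upto a0 U0. \<Sum>m1\<in>residue_upto a1 U1.
      short_product (\<lambda>p. jac p (m0 * m1) * \<chi> p) z ^ 2) \<le>
    exp 12 * (9 + exp (- ln (real U1) / (2 * ln (real z))) * exp (6 * ln (ln (real z)) + 30)) * (real U0 * real U1)"
proof -
  let ?B0 = "residue_upto a0 U0" and ?B1 = "residue_upto a1 U1" and ?P = "Pow (mid_primes z)"
  \<comment> \<open>There are at most \<open>V\<close> products up to \<open>V\<close>, each contributing \<open>8 * V * U0\<close>: together \<open>8 * U0 * U1\<close>.\<close>
  define V where "V = sqrt (real U1)"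
  have V: "V > 0" "V ^ 2 = real U1" using U by (auto simp: V_def)
  define J where "J a U S = (\<Sum>m\<in>residue_upto a U. jac (\<Prod>S) m)" for a U S
  define w where "w S = 2 ^ card S / real (\<Prod>S)" for S :: "nat set"
  have w0: "w S \<ge> 0" for S by (auto simp: w_def prod_nonneg)
  have triv: "\<bar>J a U S\<bar> \<le> real U" for a U S unfolding J_def by (rule sum_jacobi_trivial)
  have JJ: "\<bar>J a0 U0 S * J a1 U1 S\<bar> \<le> real U0 * real U1" for S
    unfolding abs_mult by (intro mult_mono triv) auto
  have term_le: "mid_coeff \<chi> S * (J a0 U0 S * J a1 U1 S) \<le>
      (if S = {} then real U0 * real U1 else 0) + (if real (\<Prod>S) \<le> V then 8 * V * real U0 else 0) +
      (if real (\<Prod>S) > V then real U0 * real U1 * w S else 0)"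
    if "S \<in> ?P" for S
  proof -
    have sub: "S \<subseteq> mid_primes z" using that by simp
    note S = mid_primes_subset_prod[OF sub]
    have c: "\<bar>mid_coeff \<chi> S\<bar> \<le> w S" unfolding w_def by (rule mid_coeff_le[OF \<chi> sub])
    have le: "mid_coeff \<chi> S * (J a0 U0 S * J a1 U1 S) \<le> \<bar>mid_coeff \<chi> S\<bar> * \<bar>J a0 U0 S * J a1 U1 S\<bar>"
      by (metis abs_ge_self abs_mult)
    consider "S = {}" | "S \<noteq> {}" "real (\<Prod>S) \<le> V" | "real (\<Prod>S) > V" by linarith
    then show ?thesis
    proof cases
      case 1
      have "\<bar>mid_coeff \<chi> S\<bar> * \<bar>J a0 U0 S * J a1 U1 S\<bar> \<le> 1 * (real U0 * real U1)"
        using JJ[of S] 1 by (intro mult_mono) (auto simp: mid_coeff_def)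
      moreover have "0 \<le> 8 * V * real U0" "0 \<le> real U0 * real U1 * w S" using V w0[of S] by auto
      ultimately show ?thesis using le 1 by (simp del: prod.empty of_nat_prod)
    next
      case 2
      have "\<bar>J a1 U1 S\<bar> \<le> 8 * real (\<Prod>S)"
        unfolding J_def residue_upto_def by (rule jacobi_class_sum) (use S 2 a in auto)
      then have "\<bar>J a0 U0 S * J a1 U1 S\<bar> \<le> real U0 * (8 * real (\<Prod>S))"
        unfolding abs_mult by (intro mult_mono triv) auto
      then have "\<bar>mid_coeff \<chi> S\<bar> * \<bar>J a0 U0 S * J a1 U1 S\<bar> \<le> w S * (real U0 * (8 * real (\<Prod>S)))"
        using c w0 by (intro mult_mono) auto
      also have "\<dots> = 8 * 2 ^ card S * real U0" using S(3) by (simp add: w_def del: of_nat_prod)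
      also have "\<dots> \<le> 8 * V * real U0"
      proof -
        have "real (2 ^ card S) \<le> real (\<Prod>S)" using S(4) by (rule of_nat_mono)
        then have "real (2 ^ card S) \<le> V" using 2(2) by (rule order_trans)
        then have "2 ^ card S \<le> V" by (simp only: of_nat_power of_nat_numeral)
        then show ?thesis by (intro mult_mono) (use V in auto)
      qed
      finally show ?thesis using le 2 by (simp del: of_nat_prod)
    next
      case 3
      have "\<bar>mid_coeff \<chi> S\<bar> * \<bar>J a0 U0 S * J a1 U1 S\<bar> \<le> w S * (real U0 * real U1)"
        using c w0 JJ by (intro mult_mono) auto
      moreover have "w S * (real U0 * real U1) = real U0 * real U1 * w S" by simp
      moreover have "(if S = {} then real U0 * real U1 else 0) \<ge> 0" by simp
      moreover have "(if real (\<Prod>S) \<le> V then 8 * V * real U0 else 0) = 0" using 3 by (simp del: of_nat_prod)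
      moreover have "(if real (\<Prod>S) > V then real U0 * real U1 * w S else 0) = real U0 * real U1 * w S"
        using 3 by (simp del: of_nat_prod)
      ultimately show ?thesis using le by linarith
    qed
  qed
  have "(\<Sum>m0\<in>?B0. \<Sum>m1\<in>?B1. short_product (\<lambda>p. jac p (m0 * m1) * \<chi> p) z ^ 2) \<le>
      (\<Sum>m0\<in>?B0. \<Sum>m1\<in>?B1. exp 12 * (\<Sum>S\<in>?P. mid_coeff \<chi> S *
        (jac (\<Prod>S) m0 * jac (\<Prod>S) m1)))"
  proof (intro sum_mono)
    fix m0 m1 assume m: "m0 \<in> ?B0" "m1 \<in> ?B1"
    have odd: "odd m0" "odd m1" using m residue_upto_odd a by blast+
    have "\<bar>jac p (m0 * m1) * \<chi> p\<bar> \<le> 1" for p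
    proof -
      have "\<bar>jac p (m0 * m1)\<bar> \<le> 1" using jacobi_values[of "int p" "m0 * m1"] by auto
      then have "\<bar>jac p (m0 * m1) * \<chi> p\<bar> \<le> 1 * 1"
        unfolding abs_mult using \<chi> by (intro mult_mono) auto
      then show ?thesis by simp
    qed
    from short_product_square_le[of "\<lambda>p. jac p (m0 * m1) * \<chi> p" z, OF this]
    show "short_product (\<lambda>p. jac p (m0 * m1) * \<chi> p) z ^ 2 \<le>
        exp 12 * (\<Sum>S\<in>?P. mid_coeff \<chi> S *
        (jac (\<Prod>S) m0 * jac (\<Prod>S) m1))"
      unfolding mid_product_expand[OF odd] .
  qed
  also have "\<dots> = exp 12 * (\<Sum>S\<in>?P. mid_coeff \<chi> S * (J a0 U0 S * J a1 U1 S))"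
  proof -
    define g where "g m0 m1 S = mid_coeff \<chi> S *
        (jac (\<Prod>S) m0 * jac (\<Prod>S) m1)" for m0 m1 S
    have "(\<Sum>m0\<in>?B0. \<Sum>m1\<in>?B1. exp 12 * (\<Sum>S\<in>?P. g m0 m1 S)) = exp 12 * (\<Sum>m0\<in>?B0. \<Sum>m1\<in>?B1. \<Sum>S\<in>?P. g m0 m1 S)"
      by (simp only: sum_distrib_left)
    also have "(\<Sum>m0\<in>?B0. \<Sum>m1\<in>?B1. \<Sum>S\<in>?P. g m0 m1 S) = (\<Sum>m0\<in>?B0. \<Sum>S\<in>?P. \<Sum>m1\<in>?B1. g m0 m1 S)"
      by (intro sum.cong refl sum.swap)
    also have "\<dots> = (\<Sum>S\<in>?P. \<Sum>m0\<in>?B0. \<Sum>m1\<in>?B1. g m0 m1 S)"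
      by (rule sum.swap)
    also have "\<dots> = (\<Sum>S\<in>?P. mid_coeff \<chi> S * (J a0 U0 S * J a1 U1 S))"
      unfolding g_def J_def sum_product by (simp only: sum_distrib_left)
    finally show ?thesis unfolding g_def .
  qed
  also have "\<dots> \<le> exp 12 * (\<Sum>S\<in>?P. (if S = {} then real U0 * real U1 else 0) +
      (if real (\<Prod>S) \<le> V then 8 * V * real U0 else 0) + (if real (\<Prod>S) > V then real U0 * real U1 * w S else 0))"
    by (intro mult_left_mono sum_mono term_le) auto
  also have "(\<Sum>S\<in>?P. (if S = {} then real U0 * real U1 else 0) +
      (if real (\<Prod>S) \<le> V then 8 * V * real U0 else 0) + (if real (\<Prod>S) > V then real U0 * real U1 * w S else 0)) =
      real U0 * real U1 + (\<Sum>S\<in>{S \<in> ?P. real (\<Prod>S) \<le> V}. 8 * V * real U0) +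
      real U0 * real U1 * (\<Sum>S\<in>{S \<in> ?P. real (\<Prod>S) > V}. w S)"
  proof -
    have fin: "finite ?P" by simp
    have 1: "(\<Sum>S\<in>?P. if S = {} then real U0 * real U1 else 0) = real U0 * real U1"
      by (subst sum.delta[OF fin]) auto
    have 2: "(\<Sum>S\<in>?P. if real (\<Prod>S) \<le> V then 8 * V * real U0 else 0) = (\<Sum>S\<in>{S \<in> ?P. real (\<Prod>S) \<le> V}. 8 * V * real U0)"
      by (rule sum.inter_filter[OF fin, symmetric])
    have 3: "(\<Sum>S\<in>?P. if real (\<Prod>S) > V then real U0 * real U1 * w S else 0) =
        (\<Sum>S\<in>{S \<in> ?P. real (\<Prod>S) > V}. real U0 * real U1 * w S)"
      by (rule sum.inter_filter[OF fin, symmetric])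
    show ?thesis unfolding sum.distrib 1 2 3 sum_distrib_left ..
  qed
  also have "\<dots> \<le> real U0 * real U1 + 8 * (real U0 * real U1) +
      real U0 * real U1 * (exp (- ln (real U1) / (2 * ln (real z))) * exp (6 * ln (ln (real z)) + 30))"
  proof (intro add_mono mult_left_mono order_refl)
    let ?A = "{S \<in> ?P. real (\<Prod>S) \<le> V}"
    have "card ?A = card ((\<lambda>S. \<Prod>S) ` ?A)"
      by (rule card_image[symmetric, OF inj_on_subset[OF prod_inj_mid_primes[of z]]]) blast
    also have "\<dots> \<le> card {1..nat \<lfloor>V\<rfloor>}"
    proof (rule card_mono)
      show "(\<lambda>S. \<Prod>S) ` ?A \<subseteq> {1..nat \<lfloor>V\<rfloor>}"
      proof safe
        fix S assume S: "S \<subseteq> mid_primes z" "real (\<Prod>S) \<le> V"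
        have "\<Prod>S > 0" by (rule mid_primes_subset_prod(3)[OF S(1)])
        moreover have "\<Prod>S \<le> nat \<lfloor>V\<rfloor>" using S(2) by (rule le_nat_floor)
        ultimately show "\<Prod>S \<in> {1..nat \<lfloor>V\<rfloor>}" by simp
      qed
    qed simp
    finally have "real (card ?A) \<le> real (nat \<lfloor>V\<rfloor>)" by simp
    also have "\<dots> \<le> V" using V by simp
    finally have "real (card ?A) * (8 * V * real U0) \<le> V * (8 * V * real U0)"
      using V by (intro mult_right_mono) auto
    also have "\<dots> = 8 * (real U0 * real U1)" using V(2) by (simp add: power2_eq_square mult_ac)
    finally show "(\<Sum>S\<in>?A. 8 * V * real U0) \<le> 8 * (real U0 * real U1)" by simp
    have lnV: "ln V = ln (real U1) / 2" unfolding V_def using U by (simp add: ln_sqrt)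
    have "(\<Sum>S\<in>{S \<in> ?P. real (\<Prod>S) > V}. w S) \<le> exp (- ln V / ln (real z)) * exp (6 * ln (ln (real z)) + 30)"
      unfolding w_def by (rule rankin_tail[OF z V(1)])
    then show "(\<Sum>S\<in>{S \<in> ?P. real (\<Prod>S) > V}. w S) \<le>
        exp (- ln (real U1) / (2 * ln (real z))) * exp (6 * ln (ln (real z)) + 30)"
      by (simp add: lnV)
  qed auto
  also have "\<dots> = (9 + exp (- ln (real U1) / (2 * ln (real z))) * exp (6 * ln (ln (real z)) + 30)) * (real U0 * real U1)"
    by (simp add: algebra_simps)
  finally show ?thesis by (simp add: mult.assoc)
qed

text \<open>For \<open>m0, m1 \<le> U\<close> this bounds the period \<open>8 * m0 * m1\<close> of every character attached to the box.\<close>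

definition box_level :: "nat \<Rightarrow> nat" where
  "box_level U = 8 * U ^ 2"

text \<open>The cutoff \<open>z\<close> of the Euler products. The exponent is below 1, so that an exponential in \<open>- ln Q / ln z\<close>
  beats the power of \<open>ln z\<close> in the Rankin tail, but close enough to 1 that the loss \<open>(ln Q) powr (1 / 8)\<close> is affordable.\<close>

definition box_cutoff :: "nat \<Rightarrow> nat" where
  "box_cutoff U = nat \<lfloor>exp (ln (real (box_level U)) powr (7 / 8))\<rfloor>"

lemma box_cutoff_bounds:
  assumes "U \<ge> 1"
  shows "ln (real (box_level U)) \<ge> 1" "box_level U \<ge> 8" "box_cutoff U \<ge> 2" "box_cutoff U \<le> box_level U"
    "ln (real (box_cutoff U)) \<le> ln (real (box_level U)) powr (7 / 8)"
    "ln (real (box_cutoff U)) \<ge> ln (real (box_level U)) powr (7 / 8) / 4"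
proof -
  define L where "L = ln (real (box_level U))"
  define E where "E = exp (L powr (7 / 8))"
  have U2: "1 \<le> U ^ 2" using assms by simp
  then show Q8: "box_level U \<ge> 8" by (simp add: box_level_def)
  note ln2 = ln2_ge_half
  have "ln 8 = 3 * ln (2 :: real)" using ln_realpow[of 2 3] by simp
  moreover have "ln 8 \<le> ln (real (box_level U))" using Q8 by (intro ln_mono) auto
  ultimately show L2: "ln (real (box_level U)) \<ge> 1" using ln2 by linarith
  have L1: "L \<ge> 1" using L2 by (simp add: L_def)
  have pl: "L powr (7 / 8) \<le> L" using powr_mono[of "7/8" 1 L] L1 by simp
  have p1: "L powr (7 / 8) \<ge> 1" using L1 by (simp add: ge_one_powr_ge_zero)
  have E2: "E \<ge> 2"
    using exp_ge_add_one_self[of "L powr (7 / 8)"] p1 unfolding E_def by linarith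
  have zE: "box_cutoff U = nat \<lfloor>E\<rfloor>" by (simp add: box_cutoff_def E_def L_def)
  show z2: "box_cutoff U \<ge> 2" unfolding zE using E2 by linarith
  have zle: "real (box_cutoff U) \<le> E" unfolding zE using E2 by simp
  have "E \<le> exp L" using pl by (simp add: E_def)
  also have "exp L = real (box_level U)" using Q8 by (simp add: L_def)
  finally have "real (box_cutoff U) \<le> real (box_level U)" using zle by linarith
  then show "box_cutoff U \<le> box_level U" by simp
  have "ln (real (box_cutoff U)) \<le> ln E" using zle z2 by (intro ln_mono) auto
  then show "ln (real (box_cutoff U)) \<le> ln (real (box_level U)) powr (7 / 8)" by (simp add: E_def L_def)
  have "E / 2 \<le> real (box_cutoff U)" unfolding zE using E2 by linarith
  then have "ln (E / 2) \<le> ln (real (box_cutoff U))" using E2 by (intro ln_mono) auto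
  then have 1: "L powr (7 / 8) - ln 2 \<le> ln (real (box_cutoff U))" using E2 by (simp add: ln_div E_def)
  have 2: "ln 2 \<le> ln (real (box_cutoff U))" using z2 by (intro ln_mono) auto
  show "ln (real (box_cutoff U)) \<ge> ln (real (box_level U)) powr (7 / 8) / 4"
    using 1 2 p1 by (simp add: L_def)
qed

definition mean_square_const :: real where
  "mean_square_const = exp 12 * (9 + exp 33 * 192 ^ 48)"

text \<open>With \<open>y = (ln Q) powr (1 / 8)\<close> the Rankin tail is at most a constant times \<open>exp (- y / 4) * y ^ 48\<close>, which is
  bounded.\<close>

lemma short_product_mean_square_aux:
  assumes \<chi>: "\<And>p. \<bar>\<chi> p\<bar> \<le> 1" and a: "odd a0" "odd a1" and U: "1 \<le> U1"
  shows "(\<Sum>m0\<in>residue_upto a0 U0. \<Sum>m1\<in>residue_upto a1 U1.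
      short_product (\<lambda>p. jac p (m0 * m1) * \<chi> p) (box_cutoff U1) ^ 2) \<le>
    mean_square_const * (real U0 * real U1)"
proof -
  note b = box_cutoff_bounds[OF U]
  define L where "L = ln (real (box_level U1))"
  define t where "t = ln (real (box_cutoff U1))"
  define y where "y = L powr (1 / 8)"
  have L2: "L \<ge> 1" using b(1) by (simp add: L_def)
  note ln2 = ln2_ge_half
  have "ln 2 \<le> t" unfolding t_def using b(3) by (intro ln_mono) auto
  then have t12: "t \<ge> 1 / 2" using ln2 by linarith
  have tL: "t \<le> L powr (7 / 8)" using b(5) by (simp add: t_def L_def)
  have y0: "y \<ge> 0" by (simp add: y_def)
  have "L = L powr (1 / 8) * L powr (7 / 8)" using L2 by (simp add: powr_add[symmetric])
  then have "y * t \<le> L" using mult_left_mono[OF tL y0] by (simp add: y_def)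
  then have yt: "y \<le> L / t" using t12 by (simp add: pos_le_divide_eq)
  have Lu: "L = ln 8 + 2 * ln (real U1)"
    using U by (simp add: L_def box_level_def ln_mult ln_realpow)
  have ln8: "ln (8 :: real) \<le> 3" 
  proof -
    have "ln (8 :: real) = 3 * ln 2" using ln_realpow[of 2 3] by simp
    then show ?thesis using ln_le_minus_one[of "2 :: real"] by simp
  qed
  have "ln (real U1) / (2 * t) = (L / t) / 4 - ln 8 / (4 * t)"
    using t12 Lu by (simp add: field_simps)
  also have "\<dots> \<ge> y / 4 - 2"
  proof -
    have "ln 8 / (4 * t) \<le> 3 / (4 * (1 / 2))" using ln8 t12 by (intro frac_le) auto
    then show ?thesis using yt by simp
  qed
  finally have e1: "- ln (real U1) / (2 * t) \<le> 2 - y / 4" by simp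
  have e2: "6 * ln t \<le> ln (y ^ 48)"
  proof -
    have "ln t \<le> ln L"
      using t12 tL powr_mono[of "7/8" 1 L] L2 by (intro ln_mono) auto
    moreover have "ln (y ^ 48) = 6 * ln L" using L2 by (simp add: y_def ln_realpow ln_powr)
    ultimately show ?thesis by simp
  qed
  have y48: "y ^ 48 > 0" using L2 by (simp add: y_def)
  have "exp (- ln (real U1) / (2 * t)) * exp (6 * ln t + 30) \<le> exp (2 - y / 4) * exp (ln (y ^ 48) + 30)"
    using e1 e2 by (intro mult_mono) auto
  also have "\<dots> = exp (ln (y ^ 48)) * exp (- y / 4) * exp 32"
    unfolding exp_add[symmetric] by (simp add: algebra_simps)
  also have "\<dots> = y ^ 48 * exp (- y / 4) * exp 32" using y48 by simp
  also have "\<dots> \<le> 192 ^ 48 * exp 32" by (intro mult_right_mono exp_beats_power y0) auto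
  also have "\<dots> \<le> exp 33 * 192 ^ 48" by (simp add: mult.commute)
  finally have key: "exp (- ln (real U1) / (2 * t)) * exp (6 * ln t + 30) \<le> exp 33 * 192 ^ 48" .
  have "(\<Sum>m0\<in>residue_upto a0 U0. \<Sum>m1\<in>residue_upto a1 U1.
      short_product (\<lambda>p. jac p (m0 * m1) * \<chi> p) (box_cutoff U1) ^ 2) \<le>
    exp 12 * (9 + exp (- ln (real U1) / (2 * t)) * exp (6 * ln t + 30)) * (real U0 * real U1)"
    unfolding t_def by (rule short_product_mean_square_rankin[OF \<chi> a b(3) U])
  also have "\<dots> \<le> mean_square_const * (real U0 * real U1)"
    unfolding mean_square_const_def using key by (intro mult_right_mono mult_left_mono add_left_mono) auto
  finally show ?thesis .
qed

lemma short_product_mean_square: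
  assumes \<chi>: "\<And>p. \<bar>\<chi> p\<bar> \<le> 1" and a: "odd a0" "odd a1" and U: "1 \<le> U0" "1 \<le> U1"
  shows "(\<Sum>m0\<in>residue_upto a0 U0. \<Sum>m1\<in>residue_upto a1 U1.
      short_product (\<lambda>p. jac p (m0 * m1) * \<chi> p) (box_cutoff (max U0 U1)) ^ 2) \<le>
    mean_square_const * (real U0 * real U1)"
proof (cases "U0 \<le> U1")
  case True
  then have "max U0 U1 = U1" by simp
  then show ?thesis using short_product_mean_square_aux[of \<chi> a0 a1 U1 U0, OF \<chi> a U(2)] by simp
next
  case False
  then have m: "max U0 U1 = U0" by simp
  have "(\<Sum>m0\<in>residue_upto a0 U0. \<Sum>m1\<in>residue_upto a1 U1.
      short_product (\<lambda>p. jac p (m0 * m1) * \<chi> p) (box_cutoff U0) ^ 2) =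
      (\<Sum>m1\<in>residue_upto a1 U1. \<Sum>m0\<in>residue_upto a0 U0.
      short_product (\<lambda>p. jac p (m1 * m0) * \<chi> p) (box_cutoff U0) ^ 2)"
    by (subst sum.swap) (simp only: mult.commute)
  also have "\<dots> \<le> mean_square_const * (real U1 * real U0)"
    by (rule short_product_mean_square_aux[OF \<chi> a(2,1) U(1)])
  finally show ?thesis by (simp add: m mult.commute[of "real U1"])
qed

text \<open>The function \<open>1 / \<tau>\<^sup>2\<close> takes the value \<open>1 / 4\<close> at primes, so its logarithmic sum is at most of order
  \<open>(ln U) powr (1 / 4)\<close>, and the mean value theorem divides by \<open>ln U\<close>.\<close>

lemma sum_inverse_tau_squared:
  assumes "U \<ge> 1"
  shows "(\<Sum>m = 1..U. 1 / tau m ^ 2) \<le> 351 * exp 10 * real U * (1 + ln (real U)) powr (- (3 / 4))"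
proof (cases "U = 1")
  case True
  have "divisor_tau 1 = 1" by (simp add: divisor_tau_def)
  then have "(\<Sum>m = 1..U. 1 / tau m ^ 2) = 1" using True by simp
  moreover have "1 * 1 \<le> 351 * exp (10 :: real)" by (intro mult_mono) auto
  ultimately show ?thesis using True by simp
next
  case False
  then have U2: "U \<ge> 2" using assms by simp
  define g where "g m = 1 / tau m ^ 2" for m
  have mg: "multf g"
  proof -
    have "multf (\<lambda>m. 1 / (tau m * tau m))"
      by (intro multf_inverse multf_times multf_divisor_tau)
    then show ?thesis by (simp add: g_def[abs_def] power2_eq_square)
  qed
  have gpp: "g (p ^ k) = 1 / (real k + 1) ^ 2" if "prime p" for p k
    unfolding g_def divisor_tau_prime_power[OF that] ..
  have gle: "g (p ^ k) \<le> real k + 1" if "prime p" for p k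
  proof -
    have "1 / (real k + 1) ^ 2 \<le> 1" by simp
    then show ?thesis unfolding gpp[OF that] by linarith
  qed
  have g0: "g n \<ge> 0" for n by (simp add: g_def)
  define l where "l = ln (real U)"
  have "ln 2 \<le> l" unfolding l_def using U2 by (intro ln_mono) auto
  then have l12: "l \<ge> 1 / 2" using ln2_ge_half by linarith
  have "(\<Sum>p\<in>primes_le U. g p / real p) = (\<Sum>p\<in>primes_le U. 1 / 4 * (1 / real p))"
  proof (rule sum.cong[OF refl])
    fix p assume "p \<in> primes_le U"
    then have "prime p" by (simp add: primes_le_def)
    then have "g (p ^ 1) = 1 / (real 1 + 1) ^ 2" by (rule gpp)
    then have gp: "g p = 1 / 4" by simp
    show "g p / real p = 1 / 4 * (1 / real p)" unfolding gp by simp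
  qed
  also have "\<dots> = 1 / 4 * (\<Sum>p\<in>primes_le U. 1 / real p)" by (rule sum_distrib_left[symmetric])
  also have "\<dots> \<le> 1 / 4 * (ln l + 5)"
    unfolding l_def by (intro mult_left_mono mertens_recip_upper U2) auto
  finally have e: "(\<Sum>p\<in>primes_le U. g p / real p) \<le> ln l / 4 + 2" by simp
  have "l * (\<Sum>m = 1..U. g m) \<le> 117 * real U * (\<Sum>n = 1..U. g n / real n)"
    unfolding l_def by (rule multf_mean_le_log_mean[OF mg g0 gle])
  also have "\<dots> \<le> 117 * real U * (exp 8 * exp (\<Sum>p\<in>primes_le U. g p / real p))"
    by (intro mult_left_mono sum_le_euler_product[OF mg g0 gle]) auto
  also have "\<dots> \<le> 117 * real U * (exp 8 * exp (ln l / 4 + 2))"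
    using e by (intro mult_left_mono) auto
  also have "exp 8 * exp (ln l / 4 + 2) = exp 10 * l powr (1 / 4)"
  proof -
    have "exp 8 * exp (ln l / 4 + 2) = exp 10 * exp (ln l / 4)" unfolding exp_add[symmetric] by simp
    then show ?thesis using l12 by (simp add: powr_def)
  qed
  finally have "l * (\<Sum>m = 1..U. g m) \<le> l * (117 * real U * exp 10 * l powr (- (3 / 4)))"
  proof -
    have "l * l powr (- (3 / 4)) = l powr 1 * l powr (- (3 / 4))" using l12 by simp
    also have "\<dots> = l powr (1 / 4)" unfolding powr_add[symmetric] by simp
    finally have *: "l * l powr (- (3 / 4)) = l powr (1 / 4)" .
    assume "l * (\<Sum>m = 1..U. g m) \<le> 117 * real U * (exp 10 * l powr (1 / 4))"
    then show ?thesis unfolding *[symmetric] by (simp add: mult_ac)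
  qed
  then have "(\<Sum>m = 1..U. g m) \<le> 117 * real U * exp 10 * l powr (- (3 / 4))"
    using l12 by (subst (asm) mult_le_cancel_left_pos) auto
  also have "l powr (- (3 / 4)) \<le> 3 * (1 + l) powr (- (3 / 4))"
  proof -
    have "l powr (- (3 / 4)) \<le> ((1 + l) / 3) powr (- (3 / 4))"
      using l12 by (intro powr_mono2') auto
    also have "\<dots> = 3 powr (3 / 4) * (1 + l) powr (- (3 / 4))"
      using l12 by (simp add: powr_divide powr_minus field_simps)
    also have "(3 :: real) powr (3 / 4) \<le> 3 powr 1" by (intro powr_mono) auto
    finally show ?thesis by (simp add: mult_right_mono)
  qed
  finally have "(\<Sum>m = 1..U. g m) \<le> 117 * real U * exp 10 * (3 * (1 + l) powr (- (3 / 4)))"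
    by (simp add: mult_left_mono)
  then show ?thesis by (simp add: g_def l_def mult_ac)
qed

section \<open>Averages over boxes of moduli\<close>

definition box_ratio :: "nat \<Rightarrow> real" where
  "box_ratio U = ln (real (box_level U)) / ln (real (box_cutoff U))"

lemma box_ratio_bounds:
  assumes "U \<ge> 1"
  shows "1 \<le> box_ratio U" "(box_ratio U)\<^sup>2 \<le> 144 * (1 + ln (real U)) powr (1 / 4)"
proof -
  note b = box_cutoff_bounds[OF assms]
  define L where "L = ln (real (box_level U))"
  define t where "t = ln (real (box_cutoff U))"
  have L1: "L \<ge> 1" using b(1) by (simp add: L_def)
  have t0: "t > 0" unfolding t_def using b(3) by simp
  have "t \<le> L" unfolding t_def L_def using b(3,4) by (intro ln_mono) auto
  then show "1 \<le> box_ratio U" using t0 by (simp add: box_ratio_def L_def[symmetric] t_def[symmetric])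
  have t4: "L powr (7 / 8) / 4 \<le> t" using b(6) by (simp add: L_def t_def)
  have "L / t \<le> L / (L powr (7 / 8) / 4)"
    using L1 t0 t4 by (intro divide_left_mono) auto
  also have "\<dots> = 4 * (L powr 1 / L powr (7 / 8))" using L1 by simp
  also have "\<dots> = 4 * L powr (1 / 8)" unfolding powr_diff[symmetric] by simp
  finally have r: "box_ratio U \<le> 4 * L powr (1 / 8)" by (simp add: box_ratio_def L_def t_def)
  have ln8: "ln (8 :: real) \<le> 3"
  proof -
    have "ln (8 :: real) = 3 * ln 2" using ln_realpow[of 2 3] by simp
    then show ?thesis using ln_le_minus_one[of "2 :: real"] by simp
  qed
  have lnU: "ln (real U) \<ge> 0" using assms by simp
  have "L = ln 8 + 2 * ln (real U)"
    using assms by (simp add: L_def box_level_def ln_mult ln_realpow)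
  then have L3: "L \<le> 3 * (1 + ln (real U))" using ln8 lnU by simp
  have "L powr (1 / 8) \<le> (3 * (1 + ln (real U))) powr (1 / 8)" using L1 L3 by (intro powr_mono2) auto
  also have "\<dots> = 3 powr (1 / 8) * (1 + ln (real U)) powr (1 / 8)" by (subst powr_mult) (use lnU in auto)
  also have "\<dots> \<le> 3 powr 1 * (1 + ln (real U)) powr (1 / 8)"
    by (intro mult_right_mono powr_mono) auto
  finally have "box_ratio U \<le> 12 * (1 + ln (real U)) powr (1 / 8)" using r by simp
  then have "(box_ratio U)\<^sup>2 \<le> (12 * (1 + ln (real U)) powr (1 / 8))\<^sup>2"
    using \<open>1 \<le> box_ratio U\<close> by (intro power_mono) auto
  also have "\<dots> = 144 * ((1 + ln (real U)) powr (1 / 8) * (1 + ln (real U)) powr (1 / 8))"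
    by (simp add: power2_eq_square)
  also have "\<dots> = 144 * (1 + ln (real U)) powr (1 / 4)" unfolding powr_add[symmetric] by simp
  finally show "(box_ratio U)\<^sup>2 \<le> 144 * (1 + ln (real U)) powr (1 / 4)" .
qed

definition box_const :: real where
  "box_const = 351 * exp 10 * 12 * sqrt (2 * mean_square_const + 2)"

lemma mean_square_const_pos: "mean_square_const > 0"
  by (simp add: mean_square_const_def add_pos_pos)

text \<open>Cauchy and Schwarz separate the weights, whose mean square saves \<open>(A * B) powr (-3 / 4)\<close>, from the Euler
  products, which lose \<open>A powr (1 / 4)\<close> through the square of the ratio. Here \<open>A \<ge> B\<close> are \<open>1 + ln\<close> of the larger and
  the smaller side; the square root of the total \<open>A powr (-1 / 2) * B powr (-3 / 4)\<close> is at most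
  \<open>B powr (-5 / 8)\<close>.\<close>

lemma box_average:
  assumes \<chi>: "\<And>p. \<bar>\<chi> p\<bar> \<le> 1" and a: "odd a0" "odd a1" and U: "1 \<le> U0" "1 \<le> U1"
  shows "(\<Sum>(m0, m1)\<in>residue_upto a0 U0 \<times> residue_upto a1 U1.
      1 / (tau m0 * tau m1) *
      (box_ratio (max U0 U1) *
        short_product (\<lambda>p. jac p (m0 * m1) * \<chi> p) (box_cutoff (max U0 U1)) + 1)) \<le>
    box_const * (real U0 * real U1) * (1 + ln (real (min U0 U1))) powr (- (5 / 8))"
proof -
  let ?B0 = "residue_upto a0 U0" and ?B1 = "residue_upto a1 U1"
  define l where "l = box_ratio (max U0 U1)"
  define E where "E m0 m1 = short_product (\<lambda>p. jac p (m0 * m1) * \<chi> p) (box_cutoff (max U0 U1))" for m0 m1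
  define A where "A = 1 + ln (real (max U0 U1))"
  define B where "B = 1 + ln (real (min U0 U1))"
  have B1: "B \<ge> 1" using U by (simp add: B_def)
  have AB: "B \<le> A" unfolding A_def B_def using U by (intro add_left_mono ln_mono) auto
  have l1: "1 \<le> l" "l\<^sup>2 \<le> 144 * A powr (1 / 4)"
    unfolding l_def A_def using box_ratio_bounds[of "max U0 U1"] U by auto
  have KE: "mean_square_const > 0" by (rule mean_square_const_pos)
  have UU: "real U0 * real U1 \<ge> 0" by simp
  have first: "(\<Sum>(m0, m1)\<in>?B0 \<times> ?B1. (1 / (tau m0 * tau m1))\<^sup>2) \<le>
      (351 * exp 10)\<^sup>2 * (real U0 * real U1) * (A powr (- (3 / 4)) * B powr (- (3 / 4)))"
  proof -
    have one: "(\<Sum>m\<in>residue_upto a U. 1 / tau m ^ 2) \<le> 351 * exp 10 * real U * (1 + ln (real U)) powr (- (3 / 4))"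
      if "U \<ge> 1" for a U
    proof -
      have "(\<Sum>m\<in>residue_upto a U. 1 / tau m ^ 2) \<le> (\<Sum>m = 1..U. 1 / tau m ^ 2)"
        by (intro sum_mono2) (auto simp: residue_upto_def)
      also note sum_inverse_tau_squared[OF that]
      finally show ?thesis .
    qed
    have "(\<Sum>(m0, m1)\<in>?B0 \<times> ?B1. (1 / (tau m0 * tau m1))\<^sup>2) =
        (\<Sum>m0\<in>?B0. 1 / tau m0 ^ 2) * (\<Sum>m1\<in>?B1. 1 / tau m1 ^ 2)"
      by (simp add: sum_product sum.cartesian_product power_divide power_mult_distrib)
    also have "\<dots> \<le> (351 * exp 10 * real U0 * (1 + ln (real U0)) powr (- (3 / 4))) *
        (351 * exp 10 * real U1 * (1 + ln (real U1)) powr (- (3 / 4)))"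
      by (intro mult_mono one U sum_nonneg) auto
    also have "\<dots> = (351 * exp 10)\<^sup>2 * (real U0 * real U1) *
        ((1 + ln (real U0)) powr (- (3 / 4)) * (1 + ln (real U1)) powr (- (3 / 4)))"
      by (simp add: power2_eq_square mult_ac)
    also have "(1 + ln (real U0)) powr (- (3 / 4)) * (1 + ln (real U1)) powr (- (3 / 4)) = A powr (- (3 / 4)) * B powr (- (3 / 4))"
      unfolding A_def B_def by (cases "U0 \<le> U1") (simp_all add: mult.commute)
    finally show ?thesis .
  qed
  have second: "(\<Sum>(m0, m1)\<in>?B0 \<times> ?B1. (l * E m0 m1 + 1)\<^sup>2) \<le> (2 * mean_square_const + 2) * l\<^sup>2 * (real U0 * real U1)"
  proof -
    have "(\<Sum>(m0, m1)\<in>?B0 \<times> ?B1. (l * E m0 m1 + 1)\<^sup>2) \<le> (\<Sum>(m0, m1)\<in>?B0 \<times> ?B1. 2 * l\<^sup>2 * (E m0 m1)\<^sup>2 + 2)"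
    proof (rule sum_mono, safe)
      fix m0 m1
      have "0 \<le> (l * E m0 m1 - 1)\<^sup>2" by simp
      then show "(l * E m0 m1 + 1)\<^sup>2 \<le> 2 * l\<^sup>2 * (E m0 m1)\<^sup>2 + 2"
        by (simp add: power2_eq_square algebra_simps)
    qed
    also have "\<dots> = 2 * l\<^sup>2 * (\<Sum>m0\<in>?B0. \<Sum>m1\<in>?B1. (E m0 m1)\<^sup>2) + 2 * (real (card ?B0) * real (card ?B1))"
      by (simp add: sum.distrib sum_distrib_left[symmetric] sum.cartesian_product case_prod_unfold)
    also have "\<dots> \<le> 2 * l\<^sup>2 * (mean_square_const * (real U0 * real U1)) + 2 * (real U0 * real U1)"
      unfolding E_def
      by (intro add_mono mult_left_mono short_product_mean_square \<chi> a U mult_mono card_residue_upto) auto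
    also have "\<dots> \<le> 2 * l\<^sup>2 * (mean_square_const * (real U0 * real U1)) + l\<^sup>2 * (2 * (real U0 * real U1))"
    proof -
      have "1 \<le> l\<^sup>2" using l1(1) by simp
      from mult_right_mono[OF this, of "2 * (real U0 * real U1)"] show ?thesis by simp
    qed
    also have "\<dots> = (2 * mean_square_const + 2) * l\<^sup>2 * (real U0 * real U1)" by (simp add: algebra_simps)
    finally show ?thesis .
  qed
  let ?S = "\<Sum>(m0, m1)\<in>?B0 \<times> ?B1. 1 / (tau m0 * tau m1) * (l * E m0 m1 + 1)"
  have "?S\<^sup>2 \<le> (\<Sum>(m0, m1)\<in>?B0 \<times> ?B1. (1 / (tau m0 * tau m1))\<^sup>2) *
      (\<Sum>(m0, m1)\<in>?B0 \<times> ?B1. (l * E m0 m1 + 1)\<^sup>2)"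
    using Cauchy_Schwarz_ineq_sum[of "\<lambda>(m0, m1). 1 / (tau m0 * tau m1)" "\<lambda>(m0, m1). l * E m0 m1 + 1" "?B0 \<times> ?B1"]
    by (simp add: case_prod_unfold)
  also have "\<dots> \<le> ((351 * exp 10)\<^sup>2 * (real U0 * real U1) * (A powr (- (3 / 4)) * B powr (- (3 / 4)))) *
      ((2 * mean_square_const + 2) * l\<^sup>2 * (real U0 * real U1))"
    by (intro mult_mono first second) (auto intro!: sum_nonneg mult_nonneg_nonneg)
  also have "\<dots> \<le> ((351 * exp 10)\<^sup>2 * (real U0 * real U1) * (A powr (- (3 / 4)) * B powr (- (3 / 4)))) *
      ((2 * mean_square_const + 2) * (144 * A powr (1 / 4)) * (real U0 * real U1))"
    using l1(2) KE by (intro mult_left_mono mult_right_mono) (auto intro!: mult_nonneg_nonneg)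
  also have "\<dots> = (351 * exp 10 * 12)\<^sup>2 * (2 * mean_square_const + 2) * (real U0 * real U1)\<^sup>2 *
      ((A powr (- (3 / 4)) * A powr (1 / 4)) * B powr (- (3 / 4)))"
    by (simp add: power2_eq_square mult_ac)
  also have "\<dots> \<le> (351 * exp 10 * 12)\<^sup>2 * (2 * mean_square_const + 2) * (real U0 * real U1)\<^sup>2 *
      (B powr (- (5 / 8)))\<^sup>2"
  proof (rule mult_left_mono)
    have "A powr (- (3 / 4)) * A powr (1 / 4) = A powr (- (1 / 2))" unfolding powr_add[symmetric] by simp
    also have "\<dots> \<le> B powr (- (1 / 2))" using AB B1 by (intro powr_mono2') auto
    finally have "(A powr (- (3 / 4)) * A powr (1 / 4)) * B powr (- (3 / 4)) \<le> B powr (- (1 / 2)) * B powr (- (3 / 4))"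
      by (intro mult_right_mono) auto
    also have "\<dots> = B powr (- (5 / 8)) * B powr (- (5 / 8))" unfolding powr_add[symmetric] by simp
    finally show "(A powr (- (3 / 4)) * A powr (1 / 4)) * B powr (- (3 / 4)) \<le> (B powr (- (5 / 8)))\<^sup>2"
      by (simp add: power2_eq_square)
  qed (use KE in auto)
  also have "\<dots> = (box_const * (real U0 * real U1) * B powr (- (5 / 8)))\<^sup>2"
    using KE by (simp add: box_const_def power_mult_distrib)
  finally have "?S \<le> box_const * (real U0 * real U1) * B powr (- (5 / 8))"
    by (rule power2_le_imp_le) (use KE in \<open>auto simp: box_const_def\<close>)
  then show ?thesis unfolding l_def E_def B_def .
qed

section \<open>Coprimality weights and the dyadic sum\<close>

text \<open>Among the primes dividing \<open>r\<close>, those up to \<open>t = \<omega>(r) + 2\<close> are bounded by Mertens, and the at most \<open>t\<close> larger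
  ones contribute at most 1.\<close>

lemma recip_prime_weight_le:
  assumes "r > 0"
  shows "recip_prime_weight r \<le> exp 6 * ln (real (card (prime_factors r)) + 2)"
proof -
  define w where "w = card (prime_factors r)"
  define t where "t = w + 2"
  have "(\<Sum>p\<in>prime_factors r. 1 / real p) \<le> (\<Sum>p\<in>prime_factors r. (if p \<le> t then 1 / real p else 0) + 1 / real t)"
  proof (rule sum_mono)
    fix p assume "p \<in> prime_factors r"
    show "1 / real p \<le> (if p \<le> t then 1 / real p else 0) + 1 / real t"
      by (auto simp: t_def frac_le)
  qed
  also have "\<dots> = (\<Sum>p\<in>prime_factors r. if p \<le> t then 1 / real p else 0) + real w / real t"
    by (simp add: sum.distrib w_def)
  also have "(\<Sum>p\<in>prime_factors r. if p \<le> t then 1 / real p else 0) = (\<Sum>p\<in>{p \<in> prime_factors r. p \<le> t}. 1 / real p)"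
    by (rule sum.inter_filter[symmetric]) auto
  also have "\<dots> \<le> (\<Sum>p\<in>primes_le t. 1 / real p)"
    by (intro sum_mono2) (auto simp: primes_le_def)
  also have "\<dots> \<le> ln (ln (real t)) + 5" by (rule mertens_recip_upper) (simp add: t_def)
  also have "real w / real t \<le> 1" by (simp add: t_def)
  finally have "(\<Sum>p\<in>prime_factors r. 1 / real p) \<le> 6 + ln (ln (real t))" by simp
  then have "recip_prime_weight r \<le> exp (6 + ln (ln (real t)))" by (simp add: recip_prime_weight_def)
  also have "\<dots> = exp 6 * ln (real t)" by (simp add: exp_add t_def)
  finally show ?thesis by (simp add: t_def w_def add.commute)
qed

lemma recip_prime_weight_le_tau:
  assumes "r > 0"
  shows "recip_prime_weight r \<le> exp 6 * tau r"
proof -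
  define w where "w = card (prime_factors r)"
  have "ln (real w + 2) \<le> real w + 1" using ln_le_minus_one[of "real w + 2"] by simp
  moreover have "w + 1 \<le> divisor_tau r"
  proof -
    have "Suc 0 \<notin> prime_factors r" by (auto dest: in_prime_factors_imp_prime)
    then have "w + 1 = card (insert 1 (prime_factors r))" by (simp add: w_def)
    also have "\<dots> \<le> card {d. d dvd r}" using assms by (intro card_mono) auto
    finally show ?thesis by (simp add: divisor_tau_def)
  qed
  then have "real w + 1 \<le> tau r" by linarith
  ultimately have "ln (real w + 2) \<le> tau r" by linarith
  then have "exp 6 * ln (real w + 2) \<le> exp 6 * tau r" by (intro mult_left_mono) auto
  with recip_prime_weight_le[OF assms] show ?thesis unfolding w_def by (rule order_trans)
qed

text \<open>Since \<open>2 ^ \<omega>(r) \<le> r\<close>, the number of prime factors is \<open>O(ln x)\<close>, so the weight is \<open>O(ln (ln x))\<close>; this is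
  weakened to the power of \<open>ln x\<close> that the final count can spare.\<close>

lemma recip_prime_weight_small:
  assumes r: "r > 0" "real r \<le> x powr C" and C: "C > 0" and x: "x > 0" and y: "ln x \<ge> 1"
  shows "recip_prime_weight r \<le> exp 6 * (10 + 2 * C) * ln x powr (1 / 8)"
proof -
  define w where "w = card (prime_factors r)"
  note ln2 = ln2_ge_half
  have "(\<Prod>p\<in>prime_factors r. 2) \<le> (\<Prod>p\<in>prime_factors r. p)"
    by (intro prod_mono) (auto dest!: in_prime_factors_imp_prime prime_ge_2_nat)
  also have "(\<Prod>p\<in>prime_factors r. p) \<le> r"
    using r by (intro dvd_imp_le prod_coprime_dvd) (auto intro!: primes_coprime dest: in_prime_factors_imp_prime)
  finally have "2 ^ w \<le> r" by (simp add: w_def)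
  then have "real (2 ^ w) \<le> real r" by (rule of_nat_mono)
  then have "real (2 ^ w) \<le> x powr C" using r(2) by (rule order_trans)
  then have "ln (real (2 ^ w)) \<le> ln (x powr C)" by (intro ln_mono) auto
  then have "real w * ln 2 \<le> C * ln x" using x by (simp add: ln_realpow ln_powr)
  moreover have "real w * (1 / 2) \<le> real w * ln 2" using ln2 by (intro mult_left_mono) auto
  ultimately have w: "real w \<le> 2 * C * ln x" by simp
  have "ln (real w + 2) \<le> ln ((2 + 2 * C) * ln x)"
    using w y by (intro ln_mono) (auto simp: algebra_simps)
  also have "\<dots> = ln (2 + 2 * C) + 8 * ln (ln x powr (1 / 8))"
    using C y by (simp add: ln_mult ln_powr)
  also have "ln (2 + 2 * C) \<le> (2 + 2 * C) * 1" using ln_le_minus_one[of "2 + 2 * C"] C by simp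
  also have "(2 + 2 * C) * 1 \<le> (2 + 2 * C) * ln x powr (1 / 8)"
    using C y by (intro mult_left_mono) (auto simp: ge_one_powr_ge_zero)
  also have "ln (ln x powr (1 / 8)) \<le> ln x powr (1 / 8)"
    using ln_le_minus_one[of "ln x powr (1 / 8)"] y by simp
  finally have "ln (real w + 2) \<le> (10 + 2 * C) * ln x powr (1 / 8)" by (simp add: algebra_simps)
  then have "exp 6 * ln (real w + 2) \<le> exp 6 * ((10 + 2 * C) * ln x powr (1 / 8))"
    by (intro mult_left_mono) auto
  with recip_prime_weight_le[OF r(1)] show ?thesis unfolding w_def mult.assoc by (rule order_trans)
qed

lemma sum_powr_le:
  "(\<Sum>i = 0..J. (1 + real i) powr (- (5 / 8))) \<le> 8 / 3 * (1 + real J) powr (3 / 8)"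
proof (induction J)
  case (Suc J)
  have "\<exists>x. 1 + real J < x \<and> x < 2 + real J \<and>
      (2 + real J) powr (3 / 8) - (1 + real J) powr (3 / 8) = (2 + real J - (1 + real J)) * (3 / 8 * x powr (3 / 8 - 1))"
    by (intro MVT2 has_real_derivative_powr) auto
  then obtain x where x: "1 + real J < x" "x < 2 + real J"
    "(2 + real J) powr (3 / 8) - (1 + real J) powr (3 / 8) = 3 / 8 * x powr (- (5 / 8))" by auto
  have "(2 + real J) powr (- (5 / 8)) \<le> x powr (- (5 / 8))" using x by (intro powr_mono2') auto
  then have "(1 + real (Suc J)) powr (- (5 / 8)) \<le> 8 / 3 * ((2 + real J) powr (3 / 8) - (1 + real J) powr (3 / 8))"
    using x(3) by (simp add: add.commute)
  then show ?case using Suc by (simp add: algebra_simps)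
qed simp

text \<open>Only scales with \<open>D \<le> 2 ^ (j + 1)\<close> carry moduli at all. Counted from the first such scale \<open>j0\<close>, the
  quotient \<open>2 ^ (j + 1) div D\<close> is at least \<open>2 ^ (j - j0)\<close>, which reduces the sum to one over
  \<open>(1 + i) powr (-5 / 8)\<close> independent of \<open>D\<close>.\<close>

lemma dyadic_sum_le:
  assumes "D > 0"
  shows "(\<Sum>j\<in>{j \<in> {0..J}. D \<le> 2 ^ (j + 1)}. (1 + ln (real (2 ^ (j + 1) div D))) powr (- (5 / 8))) \<le>
    6 * (1 + real J) powr (3 / 8)"
proof (cases "\<exists>j. D \<le> 2 ^ (j + 1)")
  case True
  define j0 where "j0 = (LEAST j. D \<le> 2 ^ (j + 1))"
  have j0: "D \<le> 2 ^ (j0 + 1)" unfolding j0_def using True by (rule LeastI_ex)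
  have least: "j0 \<le> j" if "D \<le> 2 ^ (j + 1)" for j unfolding j0_def using that by (rule Least_le)
  note ln2 = ln2_ge_half
  let ?A = "{j \<in> {0..J}. D \<le> 2 ^ (j + 1)}"
  have "(\<Sum>j\<in>?A. (1 + ln (real (2 ^ (j + 1) div D))) powr (- (5 / 8))) \<le>
      (\<Sum>j\<in>?A. 2 * (1 + real (j - j0)) powr (- (5 / 8)))"
  proof (rule sum_mono)
    fix j assume "j \<in> ?A"
    then have j: "D \<le> 2 ^ (j + 1)" "j0 \<le> j" using least by auto
    have "2 ^ (j - j0) * D \<le> 2 ^ (j - j0) * 2 ^ (j0 + 1)" using j0 by (intro mult_left_mono) auto
    also have "\<dots> = 2 ^ (j + 1)" using j(2) by (simp only: power_add[symmetric]) simp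
    finally have "2 ^ (j - j0) \<le> 2 ^ (j + 1) div D" using assms by (simp add: less_eq_div_iff_mult_less_eq)
    then have "real (2 ^ (j - j0)) \<le> real (2 ^ (j + 1) div D)" by (rule of_nat_mono)
    then have "ln (real (2 ^ (j - j0))) \<le> ln (real (2 ^ (j + 1) div D))" by (intro ln_mono) auto
    then have "real (j - j0) * ln 2 \<le> ln (real (2 ^ (j + 1) div D))" by (simp add: ln_realpow)
    moreover have "real (j - j0) * (1 / 2) \<le> real (j - j0) * ln 2" using ln2 by (intro mult_left_mono) auto
    ultimately have "(1 + real (j - j0)) / 2 \<le> 1 + ln (real (2 ^ (j + 1) div D))" by simp
    then have "(1 + ln (real (2 ^ (j + 1) div D))) powr (- (5 / 8)) \<le> ((1 + real (j - j0)) / 2) powr (- (5 / 8))"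
      by (intro powr_mono2') auto
    also have "\<dots> = 2 powr (5 / 8) * (1 + real (j - j0)) powr (- (5 / 8))"
      by (simp add: powr_divide powr_minus field_simps)
    also have "\<dots> \<le> 2 powr 1 * (1 + real (j - j0)) powr (- (5 / 8))"
      by (intro mult_right_mono powr_mono) auto
    finally show "(1 + ln (real (2 ^ (j + 1) div D))) powr (- (5 / 8)) \<le> 2 * (1 + real (j - j0)) powr (- (5 / 8))" by simp
  qed
  also have "\<dots> = (\<Sum>i\<in>(\<lambda>j. j - j0) ` ?A. 2 * (1 + real i) powr (- (5 / 8)))"
  proof -
    have "inj_on (\<lambda>j. j - j0) ?A"
    proof (rule inj_onI)
      fix x y assume "x \<in> ?A" "y \<in> ?A" and eq: "x - j0 = y - j0"
      then have "j0 \<le> x" "j0 \<le> y" using least by blast+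
      then show "x = y" using eq by simp
    qed
    then show ?thesis by (simp add: sum.reindex)
  qed
  also have "\<dots> \<le> (\<Sum>i = 0..J. 2 * (1 + real i) powr (- (5 / 8)))"
    by (intro sum_mono2) auto
  also have "\<dots> = 2 * (\<Sum>i = 0..J. (1 + real i) powr (- (5 / 8)))" by (rule sum_distrib_left[symmetric])
  also have "\<dots> \<le> 2 * (8 / 3 * (1 + real J) powr (3 / 8))" by (intro mult_left_mono sum_powr_le) auto
  also have "\<dots> \<le> 6 * (1 + real J) powr (3 / 8)" by simp
  finally show ?thesis .
next
  case False
  then have "{j \<in> {0..J}. D \<le> 2 ^ (j + 1)} = {}" by blast
  then show ?thesis by (simp only: sum.empty) simp
qed

section \<open>A pointwise bound for the inner sum\<close>

definition pointwise_const :: real where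
  "pointwise_const = 117\<^sup>2 * exp 8 * (1404 * exp 26 + 21)"

text \<open>The bound produced for a single modulus, summed over the 16 pairs of characters modulo 8 that detect
  two residue classes.\<close>

definition chi_average :: "nat \<Rightarrow> nat \<Rightarrow> nat \<Rightarrow> real" where
  "chi_average U m0 m1 = (\<Sum>i<4. \<Sum>j<4. box_ratio U *
     short_product (\<lambda>p. jac p (m0 * m1) * (chi8 i p * chi8 j p)) (box_cutoff U) + 1)"

lemma chi8_values: "chi8 i n \<in> {-1, 0, 1}"
  using char_mod8_chi8[of i] by (auto simp: char_mod8_def)

lemma chi8_pair_le: "\<bar>chi8 i n * chi8 j n\<bar> \<le> 1"
proof -
  have "\<bar>chi8 i n\<bar> \<le> 1" "\<bar>chi8 j n\<bar> \<le> 1" using chi8_values[of i n] chi8_values[of j n] by auto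
  then have "\<bar>chi8 i n * chi8 j n\<bar> \<le> 1 * 1" unfolding abs_mult by (intro mult_mono) auto
  then show ?thesis by simp
qed

lemma multf_chi8: "multf (chi8 i)"
  using char_mod8_chi8[of i] by (simp add: char_mod8_def multf_def)

lemma chi_average_ge_0:
  assumes "U \<ge> 1"
  shows "chi_average U m0 m1 \<ge> 0"
  unfolding chi_average_def
proof (intro sum_nonneg add_nonneg_nonneg mult_nonneg_nonneg)
  show "0 \<le> box_ratio U" using box_ratio_bounds(1)[OF assms] by linarith
qed (auto simp: short_product_def)

text \<open>For each pair of characters modulo 8 the symbol times both characters is a real character of period
  \<open>8 * m0 * m1\<close>, which \<open>box_level U\<close> bounds.\<close>

lemma hyper_sum_le_chi_average:
  assumes m: "odd (m0 * m1)" "squarefree (m0 * m1)" "m0 * m1 > 1" and mU: "m0 \<le> U" "m1 \<le> U" and U: "U \<ge> 1"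
    and q: "odd q0" "odd q1" and r: "r0 > 0" "r1 > 0"
    and N: "box_level U \<le> N" "(1 + 2 * ln (real (box_level U)))\<^sup>2 \<le> ln (real N)"
  shows "ln (real N) * (hyper_sum (m0 * m1) q0 q1 r0 r1 N)\<^sup>2 \<le>
    pointwise_const * (real N)\<^sup>2 * (recip_prime_weight r0 * recip_prime_weight r1) * chi_average U m0 m1"
proof -
  note b = box_cutoff_bounds[OF U]
  define m where "m = m0 * m1"
  define z where "z = box_cutoff U"
  define \<rho> where "\<rho> = recip_prime_weight r0 * recip_prime_weight r1"
  define E where "E i j = box_ratio U * short_product (\<lambda>p. jac p m * (chi8 i p * chi8 j p)) z" for i j
  have \<rho>0: "\<rho> \<ge> 0" by (simp add: \<rho>_def recip_prime_weight_def)
  have N2: "N \<ge> 2" using N(1) b(2) by linarith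
  have lnN: "ln (real N) > 0" using N2 by simp
  have E0: "E i j \<ge> 0" for i j
    using box_ratio_bounds(1)[OF U] by (simp add: E_def short_product_def)
  have mm: "8 * m \<le> box_level U"
    unfolding m_def box_level_def power2_eq_square using mU by (intro mult_left_mono mult_mono) auto
  have zQ: "z \<le> box_level U ^ 3"
  proof -
    have "box_level U ^ 1 \<le> box_level U ^ 3" using b(2) by (intro power_increasing) auto
    then show ?thesis using b(4) by (simp add: z_def)
  qed
  have S: "(\<Sum>n = 1..N. dconv (twist (\<lambda>n. jac n m * chi8 i n) r0) (twist (chi8 j) r1) n)\<^sup>2 \<le>
      pointwise_const * (real N)\<^sup>2 * \<rho> * (E i j + 1) / ln (real N)" for i j
  proof -
    let ?a = "\<lambda>n. jac n m * chi8 i n"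
    have av: "?a n \<in> {-1, 0, 1}" for n using jacobi_values[of "int n" m] chi8_values[of i n] by auto
    have am: "multf ?a"
      using real_charD(5)[OF real_char_jacobi[OF char_mod8_chi8 m]] by (simp add: m_def)
    have f: "real_char (\<lambda>n. ?a n * chi8 j n) (8 * m)"
      using real_char_jacobi[OF char_mod8_mult[OF char_mod8_chi8[of i] char_mod8_chi8[of j]] m]
      by (simp add: m_def mult.assoc)
    have K: "(1 + 2 * ln (real (box_level U)))\<^sup>2 \<le> 1 * ln (real N)" using N(2) by simp
    have "ln (real N) * (\<Sum>n = 1..N. dconv (twist ?a r0) (twist (chi8 j) r1) n)\<^sup>2 \<le>
      117 ^ 2 * exp 8 * real N ^ 2 * (recip_prime_weight r0 * recip_prime_weight r1) *
      (1404 * exp 26 * (ln (real (box_level U)) / ln (real z)) * exp (\<Sum>p\<in>primes_le z. ?a p * chi8 j p / real p) + 20 + 1)"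
      by (rule twist_conv_bound[OF av am chi8_values multf_chi8 f r N2 mm _ N(1) _ zQ K])
         (use b in \<open>auto simp: z_def\<close>)
    also have "1404 * exp 26 * (ln (real (box_level U)) / ln (real z)) * exp (\<Sum>p\<in>primes_le z. ?a p * chi8 j p / real p) + 20 + 1 =
        1404 * exp 26 * E i j + 21"
      by (simp add: E_def short_product_def box_ratio_def z_def mult.assoc)
    also have "117 ^ 2 * exp 8 * real N ^ 2 * (recip_prime_weight r0 * recip_prime_weight r1) * (1404 * exp 26 * E i j + 21) \<le>
        117 ^ 2 * exp 8 * real N ^ 2 * (recip_prime_weight r0 * recip_prime_weight r1) * ((1404 * exp 26 + 21) * (E i j + 1))"
    proof (rule mult_left_mono)
      have "(1404 * exp 26 + 21) * (E i j + 1) = 1404 * exp 26 * E i j + 21 + (21 * E i j + 1404 * exp 26)"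
        by (simp add: algebra_simps)
      moreover have "0 \<le> 21 * E i j + 1404 * exp 26" using E0[of i j] by simp
      ultimately show "1404 * exp 26 * E i j + 21 \<le> (1404 * exp 26 + 21) * (E i j + 1)" by linarith
    qed (use \<rho>0 in \<open>simp add: \<rho>_def\<close>)
    also have "\<dots> = pointwise_const * (real N)\<^sup>2 * \<rho> * (E i j + 1)"
      by (simp add: pointwise_const_def \<rho>_def mult_ac)
    finally show ?thesis using lnN by (simp add: pos_le_divide_eq mult.commute)
  qed
  have "(hyper_sum m q0 q1 r0 r1 N)\<^sup>2 \<le> (\<Sum>i<4. \<Sum>j<4. pointwise_const * (real N)\<^sup>2 * \<rho> * (E i j + 1) / ln (real N))"
    by (rule hyper_sum_square_le[OF q]) (rule S)
  also have "\<dots> = pointwise_const * (real N)\<^sup>2 * \<rho> * chi_average U m0 m1 / ln (real N)"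
    unfolding chi_average_def E_def m_def z_def by (simp only: sum_distrib_left sum_divide_distrib)
  finally show ?thesis using lnN by (simp add: pos_le_divide_eq mult.commute m_def \<rho>_def)
qed

lemma chi_average_box:
  assumes a: "odd a0" "odd a1" and U: "1 \<le> U0" "1 \<le> U1"
  shows "(\<Sum>(m0, m1)\<in>residue_upto a0 U0 \<times> residue_upto a1 U1.
      1 / (tau m0 * tau m1) * chi_average (max U0 U1) m0 m1) \<le>
    16 * box_const * (real U0 * real U1) * (1 + ln (real (min U0 U1))) powr (- (5 / 8))"
proof -
  let ?B = "residue_upto a0 U0 \<times> residue_upto a1 U1"
  define g where "g i j = (\<lambda>(m0, m1). 1 / (tau m0 * tau m1) *
      (box_ratio (max U0 U1) * short_product (\<lambda>p. jac p (m0 * m1) * (chi8 i p * chi8 j p)) (box_cutoff (max U0 U1)) + 1))" for i j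
  have g: "(\<Sum>x\<in>?B. g i j x) \<le> box_const * (real U0 * real U1) * (1 + ln (real (min U0 U1))) powr (- (5 / 8))" for i j
    unfolding g_def by (rule box_average[OF chi8_pair_le a U])
  have "(\<Sum>(m0, m1)\<in>?B. 1 / (tau m0 * tau m1) * chi_average (max U0 U1) m0 m1) =
      (\<Sum>x\<in>?B. \<Sum>i<4. \<Sum>j<4. g i j x)"
    unfolding chi_average_def g_def case_prod_unfold by (simp only: sum_distrib_left)
  also have "\<dots> = (\<Sum>i<4. \<Sum>x\<in>?B. \<Sum>j<4. g i j x)" by (rule sum.swap)
  also have "\<dots> = (\<Sum>i<4. \<Sum>j<4. \<Sum>x\<in>?B. g i j x)" by (intro sum.cong refl sum.swap)
  also have "\<dots> \<le> (\<Sum>i<(4::nat). \<Sum>j<(4::nat). box_const * (real U0 * real U1) * (1 + ln (real (min U0 U1))) powr (- (5 / 8)))"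
    by (intro sum_mono g)
  also have "\<dots> = 16 * box_const * (real U0 * real U1) * (1 + ln (real (min U0 U1))) powr (- (5 / 8))" by simp
  finally show ?thesis .
qed

text \<open>Both factors of \<open>T\<close> involve the same modulus and the same characters, so the same \<open>chi_average\<close> bounds the
  square of each; in the product it appears to the first power.\<close>

lemma T_sum_pointwise:
  assumes \<psi>: "\<psi> \<in> jacobi_symbols"
    and m: "odd (m0 * m1)" "squarefree (m0 * m1)" "m0 * m1 > 1" and mU: "m0 \<le> U" "m1 \<le> U" and U: "U \<ge> 1"
    and q: "\<And>i. i < 4 \<Longrightarrow> odd (q i)" and r: "\<And>i. i < 4 \<Longrightarrow> r i > 0"
    and c: "c01 > 0" "c23 > 0" and M: "M = max (m0 * ct0) (m1 * ct1)" "M > 0"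
    and X: "X > 1" "real (M * c01) * (sqrt X + 1) \<le> X" "real (M * c23) * (sqrt X + 1) \<le> X"
    and Q: "real (box_level U) \<le> sqrt X" "(1 + 2 * ln (real (box_level U)))\<^sup>2 \<le> ln X / 2"
  shows "\<bar>T_sum \<psi> q r c01 c23 ct0 ct1 X m0 m1\<bar> \<le>
    2 * pointwise_const * sqrt (recip_prime_weight (r 0) * recip_prime_weight (r 1) * (recip_prime_weight (r 2) * recip_prime_weight (r 3))) *
    (X\<^sup>2 / (real M ^ 2 * real c01 * real c23 * ln X)) * chi_average U m0 m1"
proof -
  define N where "N c = nat \<lfloor>X / real (M * c)\<rfloor>" for c
  define P where "P = 2 * pointwise_const / ln X"
  define Y where "Y = chi_average U m0 m1"
  have lnX: "ln X > 0" using X(1) by simp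
  have P0: "P \<ge> 0" using lnX by (simp add: P_def pointwise_const_def)
  have Y0: "Y \<ge> 0" unfolding Y_def by (rule chi_average_ge_0[OF U])
  have half: "(hyper_sum (m0 * m1) q0 q1 r0 r1 (N c))\<^sup>2 \<le>
      P * (X / real (M * c))\<^sup>2 * (recip_prime_weight r0 * recip_prime_weight r1) * Y"
    if c: "c > 0" "real (M * c) * (sqrt X + 1) \<le> X" and q: "odd q0" "odd q1" and r: "r0 > 0" "r1 > 0" for c q0 q1 r0 r1
  proof -
    have Mc: "real (M * c) > 0" using M(2) c(1) by simp
    have x: "sqrt X + 1 \<le> X / real (M * c)" using c(2) Mc by (simp add: pos_le_divide_eq mult.commute)
    have Nx: "real (N c) \<le> X / real (M * c)" unfolding N_def using X(1) Mc by simp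
    have sN: "sqrt X \<le> real (N c)" unfolding N_def using x by linarith
    have "ln (sqrt X) \<le> ln (real (N c))" using X(1) sN by (intro ln_mono) auto
    then have lnN: "ln X / 2 \<le> ln (real (N c))" using X(1) by (simp add: ln_sqrt)
    have QN: "box_level U \<le> N c" using Q(1) sN by linarith
    define R where "R = recip_prime_weight r0 * recip_prime_weight r1"
    have R0: "R \<ge> 0" by (simp add: R_def recip_prime_weight_def)
    have pc: "pointwise_const \<ge> 0" by (simp add: pointwise_const_def)
    let ?h = "hyper_sum (m0 * m1) q0 q1 r0 r1 (N c)"
    have "ln X / 2 * ?h\<^sup>2 \<le> ln (real (N c)) * ?h\<^sup>2" using lnN by (intro mult_right_mono) auto
    also have "\<dots> \<le> pointwise_const * (real (N c))\<^sup>2 * R * Y"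
      unfolding R_def Y_def using Q(2) lnN by (intro hyper_sum_le_chi_average m mU U q r QN) auto
    also have "\<dots> \<le> pointwise_const * (X / real (M * c))\<^sup>2 * R * Y"
      using Nx R0 Y0 pc by (intro mult_right_mono mult_left_mono power_mono) auto
    finally have "?h\<^sup>2 \<le> 2 * (pointwise_const * (X / real (M * c))\<^sup>2 * R * Y) / ln X"
      using lnX by (simp add: pos_le_divide_eq mult_ac)
    also have "\<dots> = P * (X / real (M * c))\<^sup>2 * R * Y" by (simp add: P_def)
    finally show ?thesis unfolding R_def .
  qed
  define h where "h = hyper_sum (m0 * m1) (q 0) (q 1) (r 0) (r 1) (N c01)"
  define h' where "h' = hyper_sum (m0 * m1) (q 2) (q 3) (r 2) (r 3) (N c23)"
  define R where "R = recip_prime_weight (r 0) * recip_prime_weight (r 1)"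
  define R' where "R' = recip_prime_weight (r 2) * recip_prime_weight (r 3)"
  have RR: "R \<ge> 0" "R' \<ge> 0" by (simp_all add: R_def R'_def recip_prime_weight_def)
  have h: "h\<^sup>2 \<le> P * (X / real (M * c01))\<^sup>2 * R * Y" unfolding h_def R_def by (intro half c X q r) auto
  have h': "h'\<^sup>2 \<le> P * (X / real (M * c23))\<^sup>2 * R' * Y" unfolding h'_def R'_def by (intro half c X q r) auto
  have "(h * h')\<^sup>2 = h\<^sup>2 * h'\<^sup>2" by (simp add: power_mult_distrib)
  also have "\<dots> \<le> (P * (X / real (M * c01))\<^sup>2 * R * Y) * (P * (X / real (M * c23))\<^sup>2 * R' * Y)"
    using P0 RR Y0 by (intro mult_mono h h' mult_nonneg_nonneg) auto
  also have "\<dots> = (P * (X / real (M * c01)) * (X / real (M * c23)) * sqrt (R * R') * Y)\<^sup>2"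
  proof -
    have sq: "(sqrt (R * R'))\<^sup>2 = R * R'" using RR by simp
    have "(P * x\<^sup>2 * R * Y) * (P * x'\<^sup>2 * R' * Y) = (P * x * x' * sqrt (R * R') * Y)\<^sup>2" for x x'
      unfolding power_mult_distrib sq by (simp add: power2_eq_square)
    then show ?thesis .
  qed
  finally have "\<bar>h * h'\<bar>\<^sup>2 \<le> (P * (X / real (M * c01)) * (X / real (M * c23)) * sqrt (R * R') * Y)\<^sup>2" by simp
  then have "\<bar>h * h'\<bar> \<le> P * (X / real (M * c01)) * (X / real (M * c23)) * sqrt (R * R') * Y"
    by (rule power2_le_imp_le) (use P0 RR Y0 X(1) in auto)
  also have "\<dots> = 2 * pointwise_const * sqrt (R * R') * (X\<^sup>2 / (real M ^ 2 * real c01 * real c23 * ln X)) * Y"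
    by (simp add: P_def power2_eq_square mult_ac)
  finally have main: "\<bar>h * h'\<bar> \<le> 2 * pointwise_const * sqrt (R * R') * (X\<^sup>2 / (real M ^ 2 * real c01 * real c23 * ln X)) * Y" .
  have "\<bar>T_sum \<psi> q r c01 c23 ct0 ct1 X m0 m1\<bar> = \<bar>T_sum (\<lambda>m n. jacobi (int n) m) q r c01 c23 ct0 ct1 X m0 m1\<bar>"
    by (rule T_sum_other_symbol[OF m(1) q q \<psi>]) auto
  also have "T_sum (\<lambda>m n. jacobi (int n) m) q r c01 c23 ct0 ct1 X m0 m1 = h * h'"
    unfolding h_def h'_def N_def using X(1) by (intro T_sum_factor c M m) auto
  finally show ?thesis using main unfolding R_def R'_def Y_def by simp
qed

section \<open>Summation over the moduli\<close>

lemma finite_m_range [simp, intro]: "finite (m_range qt rt C X)"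
proof (rule finite_subset)
  show "m_range qt rt C X \<subseteq> {..nat \<lfloor>ln X powr C\<rfloor>} \<times> {..nat \<lfloor>ln X powr C\<rfloor>}"
    by (auto simp: m_range_def intro!: le_nat_floor)
qed auto

definition weighted_T :: "(nat \<Rightarrow> nat \<Rightarrow> int) \<Rightarrow> (nat \<Rightarrow> nat) \<Rightarrow> (nat \<Rightarrow> nat) \<Rightarrow> nat \<Rightarrow> nat \<Rightarrow> nat \<Rightarrow> nat \<Rightarrow> real \<Rightarrow> nat \<times> nat \<Rightarrow> real" where
  "weighted_T \<psi> q r c01 c23 ct0 ct1 X = (\<lambda>(m0, m1).
     real_of_int ((moebius (m0 * m1))\<^sup>2) / (tau m0 * tau m1) *
     \<bar>T_sum \<psi> q r c01 c23 ct0 ct1 X m0 m1\<bar>)"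

text \<open>On a block \<open>M\<close> is between \<open>2 ^ j\<close> and \<open>2 ^ (j + 1)\<close>, so the moduli lie in the box with sides
  \<open>2 ^ (j + 1) div ct0\<close> and \<open>2 ^ (j + 1) div ct1\<close>. The area of the box cancels the factor
  \<open>1 / M\<^sup>2\<close> and leaves \<open>1 / (ct0 * ct1)\<close>. If \<open>2 ^ (j + 1)\<close> is below \<open>max ct0 ct1\<close>, the block is empty.\<close>

lemma dyadic_block_sum_le:
  assumes \<psi>: "\<psi> \<in> jacobi_symbols"
    and q: "\<And>i. i < 4 \<Longrightarrow> odd (q i)" and r: "\<And>i. i < 4 \<Longrightarrow> r i > 0" and qt: "odd (qt 0)" "odd (qt 1)"
    and c: "c01 > 0" "c23 > 0" "ct0 > 0" "ct1 > 0"
    and X: "X > 1" "2 ^ (j + 1) * real c01 * (sqrt X + 1) \<le> X" "2 ^ (j + 1) * real c23 * (sqrt X + 1) \<le> X"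
    and Q: "real (box_level (2 ^ (j + 1))) \<le> sqrt X" "(1 + 2 * ln (real (box_level (2 ^ (j + 1)))))\<^sup>2 \<le> ln X / 2"
    and G: "G = 2 * pointwise_const * sqrt (recip_prime_weight (r 0) * recip_prime_weight (r 1) * (recip_prime_weight (r 2) * recip_prime_weight (r 3))) *
      (X\<^sup>2 / (real c01 * real c23 * ln X))"
  shows "(\<Sum>(m0, m1)\<in>{(m0, m1) \<in> m_range qt rt C X. 2 ^ j \<le> max (m0 * ct0) (m1 * ct1) \<and> max (m0 * ct0) (m1 * ct1) < 2 ^ (j + 1)}.
      weighted_T \<psi> q r c01 c23 ct0 ct1 X (m0, m1)) \<le>
    (if max ct0 ct1 \<le> 2 ^ (j + 1) then
      64 * box_const * G / (real ct0 * real ct1) * (1 + ln (real (2 ^ (j + 1) div max ct0 ct1))) powr (- (5 / 8)) else 0)"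
proof -
  let ?A = "{(m0, m1) \<in> m_range qt rt C X. 2 ^ j \<le> max (m0 * ct0) (m1 * ct1) \<and> max (m0 * ct0) (m1 * ct1) < 2 ^ (j + 1)}"
  define U0 where "U0 = 2 ^ (j + 1) div ct0"
  define U1 where "U1 = 2 ^ (j + 1) div ct1"
  define U where "U = max U0 U1"
  have pc: "pointwise_const \<ge> 0" by (simp add: pointwise_const_def)
  have bc: "box_const \<ge> 0" using mean_square_const_pos by (simp add: box_const_def)
  have G0: "G \<ge> 0" unfolding G using X(1) pc by (auto simp: recip_prime_weight_def)
  have mem: "m0 \<in> residue_upto (qt 0) U0 \<and> m1 \<in> residue_upto (qt 1) U1 \<and> m0 * m1 \<noteq> 1 \<and>
      2 ^ j \<le> max (m0 * ct0) (m1 * ct1) \<and> max (m0 * ct0) (m1 * ct1) < 2 ^ (j + 1)"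
    if "(m0, m1) \<in> ?A" for m0 m1
    using that c unfolding m_range_def residue_upto_def U0_def U1_def
    by (auto simp: less_eq_div_iff_mult_less_eq)
  show ?thesis
  proof (cases "max ct0 ct1 \<le> 2 ^ (j + 1)")
    case False
    have "?A = {}"
    proof (rule equals0I)
      fix x assume x: "x \<in> ?A"
      obtain m0 m1 where x': "x = (m0, m1)" by (metis surj_pair)
      have "1 \<le> m0" "1 \<le> m1" "max (m0 * ct0) (m1 * ct1) < 2 ^ (j + 1)"
        using mem[of m0 m1] x x' by (auto simp: residue_upto_def)
      then have lt: "m0 * ct0 < 2 ^ (j + 1)" "m1 * ct1 < 2 ^ (j + 1)"
        by (simp_all only: max_less_iff_conj)
      have "ct0 < 2 ^ (j + 1)" by (rule le_less_trans[OF _ lt(1)]) (use \<open>1 \<le> m0\<close> in simp)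
      moreover have "ct1 < 2 ^ (j + 1)" by (rule le_less_trans[OF _ lt(2)]) (use \<open>1 \<le> m1\<close> in simp)
      ultimately show False using False by simp
    qed
    then show ?thesis using False by (simp only: sum.empty) simp
  next
    case True
    then have U01: "U0 \<ge> 1" "U1 \<ge> 1"
      unfolding U0_def U1_def using c by (auto simp: less_eq_div_iff_mult_less_eq)
    have U: "U \<ge> 1" using U01 by (simp add: U_def)
    have U2: "U \<le> 2 ^ (j + 1)" unfolding U_def U0_def U1_def by (simp add: div_le_dividend)
    have lev: "box_level U \<le> box_level (2 ^ (j + 1))"
      unfolding box_level_def using U2 by (intro mult_left_mono power_mono) auto
    have lev1: "box_level U \<ge> 1" using box_cutoff_bounds(2)[OF U] by simp
    have QU: "real (box_level U) \<le> sqrt X" using Q(1) lev by linarith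
    have "ln (real (box_level U)) \<le> ln (real (box_level (2 ^ (j + 1))))" using lev lev1 by (intro ln_mono) auto
    then have "(1 + 2 * ln (real (box_level U)))\<^sup>2 \<le> (1 + 2 * ln (real (box_level (2 ^ (j + 1)))))\<^sup>2"
      using lev1 by (intro power_mono) auto
    then have QU2: "(1 + 2 * ln (real (box_level U)))\<^sup>2 \<le> ln X / 2" using Q(2) by linarith
    have pt: "weighted_T \<psi> q r c01 c23 ct0 ct1 X (m0, m1) \<le>
        (G / 4 ^ j) * (1 / (tau m0 * tau m1) * chi_average U m0 m1)"
      if A: "(m0, m1) \<in> ?A" for m0 m1
    proof -
      define M where "M = max (m0 * ct0) (m1 * ct1)"
      note mm = mem[OF A]
      have Y0: "chi_average U m0 m1 \<ge> 0" by (rule chi_average_ge_0[OF U])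
      have tau0: "1 / (tau m0 * tau m1) \<ge> 0" by simp
      show ?thesis
      proof (cases "squarefree (m0 * m1)")
        case False
        then have "moebius (m0 * m1) = 0" by (simp add: moebius_def)
        then show ?thesis using G0 Y0 by (simp add: weighted_T_def)
      next
        case sf: True
        have odd: "odd (m0 * m1)" using mm residue_upto_odd qt by auto
        have le: "m0 \<ge> 1" "m1 \<ge> 1" "m0 \<le> U" "m1 \<le> U" using mm by (auto simp: residue_upto_def U_def)
        have "m0 * m1 \<noteq> 0" "m0 * m1 \<noteq> 1" using mm le by auto
        then have "m0 * m1 > 1" by linarith
        have M: "2 ^ j \<le> M" "M < 2 ^ (j + 1)" using mm by (auto simp: M_def)
        have M0: "M > 0" using M(1) by (metis less_le_trans pos2 zero_less_power)
        have Mr: "2 ^ j \<le> real M" using M(1) by (metis of_nat_le_iff of_nat_numeral of_nat_power)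
        have Mr2: "real M \<le> 2 ^ (j + 1)" using M(2) by (metis less_imp_le of_nat_le_iff of_nat_numeral of_nat_power)
        have XM: "real (M * cc) * (sqrt X + 1) \<le> X" if "2 ^ (j + 1) * real cc * (sqrt X + 1) \<le> X" for cc
        proof -
          have "real (M * cc) * (sqrt X + 1) \<le> 2 ^ (j + 1) * real cc * (sqrt X + 1)"
            unfolding of_nat_mult using Mr2 X(1) by (intro mult_right_mono) auto
          then show ?thesis using that by linarith
        qed
        have T: "\<bar>T_sum \<psi> q r c01 c23 ct0 ct1 X m0 m1\<bar> \<le>
          2 * pointwise_const * sqrt (recip_prime_weight (r 0) * recip_prime_weight (r 1) * (recip_prime_weight (r 2) * recip_prime_weight (r 3))) *
          (X\<^sup>2 / (real M ^ 2 * real c01 * real c23 * ln X)) * chi_average U m0 m1"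
          by (rule T_sum_pointwise[OF \<psi> odd sf \<open>m0 * m1 > 1\<close> \<open>m0 \<le> U\<close> \<open>m1 \<le> U\<close> U q r c(1,2) M_def M0 X(1) XM[OF X(2)] XM[OF X(3)] QU QU2])
        also have "\<dots> = G / real M ^ 2 * chi_average U m0 m1" unfolding G by simp
        also have "\<dots> \<le> G / 4 ^ j * chi_average U m0 m1"
        proof (intro mult_right_mono divide_left_mono G0 Y0)
          have "(2 ^ j) ^ 2 \<le> real M ^ 2" using Mr by (intro power_mono) auto
          moreover have "(2 ^ j) ^ 2 = (4 :: real) ^ j" by (simp add: power_mult[symmetric] power2_eq_square power_mult_distrib[symmetric])
          ultimately show "(4 :: real) ^ j \<le> real M ^ 2" by simp
        qed (use M0 in simp)
        finally have T': "\<bar>T_sum \<psi> q r c01 c23 ct0 ct1 X m0 m1\<bar> \<le> G / 4 ^ j * chi_average U m0 m1" .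
        have mu: "real_of_int ((moebius (m0 * m1))\<^sup>2) = 1"
          using sf by (simp add: moebius_def power_mult[symmetric] mult.commute)
        have "weighted_T \<psi> q r c01 c23 ct0 ct1 X (m0, m1) =
            1 / (tau m0 * tau m1) * \<bar>T_sum \<psi> q r c01 c23 ct0 ct1 X m0 m1\<bar>"
          by (simp only: weighted_T_def prod.case mu)
        also have "\<dots> \<le> 1 / (tau m0 * tau m1) * (G / 4 ^ j * chi_average U m0 m1)"
          by (rule mult_left_mono[OF T' tau0])
        finally show ?thesis by (simp only: mult_ac)
      qed
    qed
    let ?B = "residue_upto (qt 0) U0 \<times> residue_upto (qt 1) U1"
    have "(\<Sum>(m0, m1)\<in>?A. weighted_T \<psi> q r c01 c23 ct0 ct1 X (m0, m1)) \<le>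
        (\<Sum>(m0, m1)\<in>?A. (G / 4 ^ j) * (1 / (tau m0 * tau m1) * chi_average U m0 m1))"
    proof (rule sum_mono)
      fix x assume "x \<in> ?A"
      then show "(case x of (m0, m1) \<Rightarrow> weighted_T \<psi> q r c01 c23 ct0 ct1 X (m0, m1)) \<le>
          (case x of (m0, m1) \<Rightarrow> (G / 4 ^ j) * (1 / (tau m0 * tau m1) * chi_average U m0 m1))"
        using pt by (cases x) simp
    qed
    also have "\<dots> \<le> (\<Sum>(m0, m1)\<in>?B. (G / 4 ^ j) * (1 / (tau m0 * tau m1) * chi_average U m0 m1))"
    proof (rule sum_mono2)
      show "?A \<subseteq> ?B" using mem by auto
      fix b assume "b \<in> ?B - ?A"
      show "0 \<le> (case b of (m0, m1) \<Rightarrow> (G / 4 ^ j) * (1 / (tau m0 * tau m1) * chi_average U m0 m1))"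
        using G0 chi_average_ge_0[OF U] by (cases b) auto
    qed auto
    also have "\<dots> = (G / 4 ^ j) * (\<Sum>(m0, m1)\<in>?B. 1 / (tau m0 * tau m1) * chi_average U m0 m1)"
      by (simp only: sum_distrib_left case_prod_unfold)
    also have "\<dots> \<le> (G / 4 ^ j) * (16 * box_const * (real U0 * real U1) * (1 + ln (real (min U0 U1))) powr (- (5 / 8)))"
      unfolding U_def using G0 by (intro mult_left_mono chi_average_box qt U01) auto
    also have "\<dots> \<le> (G / 4 ^ j) * (16 * box_const * (4 * 4 ^ j / (real ct0 * real ct1)) * (1 + ln (real (min U0 U1))) powr (- (5 / 8)))"
    proof (intro mult_left_mono mult_right_mono)
      have "real U0 \<le> real (2 ^ (j + 1)) / real ct0" unfolding U0_def by (rule of_nat_div_le_of_nat)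
      moreover have "real U1 \<le> real (2 ^ (j + 1)) / real ct1" unfolding U1_def by (rule of_nat_div_le_of_nat)
      ultimately have "real U0 * real U1 \<le> (real (2 ^ (j + 1)) / real ct0) * (real (2 ^ (j + 1)) / real ct1)"
        by (intro mult_mono) auto
      also have "\<dots> = 4 * 4 ^ j / (real ct0 * real ct1)"
        by (simp add: power_mult_distrib[symmetric])
      finally show "real U0 * real U1 \<le> 4 * 4 ^ j / (real ct0 * real ct1)" .
    qed (use G0 bc in auto)
    also have "\<dots> = 64 * box_const * G / (real ct0 * real ct1) * (1 + ln (real (min U0 U1))) powr (- (5 / 8))"
      by simp
    also have "min U0 U1 = 2 ^ (j + 1) div max ct0 ct1"
      unfolding U0_def U1_def using c by (cases "ct0 \<le> ct1") (auto simp: min_def max_def intro!: antisym div_le_mono2)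
    finally show ?thesis using True by simp
  qed
qed

text \<open>The hypothesis \<open>X \<ge> 3\<close> keeps \<open>ln (ln X)\<close> positive. The proof compares \<open>ln 12 - ln 4\<close> with
  \<open>1 / 5 + ... + 1 / 12\<close>.\<close>

lemma ln3_gt_one: "ln 3 > (1 :: real)"
proof -
  have "ln (real (Suc n)) - ln (real n) \<ge> 1 / real (Suc n)" if "n > 0" for n
  proof -
    have "ln (real n / real (Suc n)) \<le> real n / real (Suc n) - 1" using that by (intro ln_le_minus_one) auto
    also have "\<dots> = - 1 / real (Suc n)" by (simp add: field_simps)
    finally show ?thesis using that by (subst (asm) ln_div) auto
  qed
  from this[of 4] this[of 5] this[of 6] this[of 7] this[of 8] this[of 9] this[of 10] this[of 11]
  have "ln 12 - ln 4 \<ge> 1/5 + 1/6 + 1/7 + 1/8 + 1/9 + 1/10 + 1/11 + (1/12 :: real)" by simp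
  moreover have "ln 12 = ln 3 + ln (4::real)" using ln_mult_pos[of 3 "4 :: real"] by simp
  ultimately show ?thesis by simp
qed

text \<open>Every summand is at most 1 in absolute value and every variable is at most \<open>X\<close>. This crude bound serves
  for bounded \<open>X\<close>.\<close>

lemma weighted_T_sum_small:
  assumes \<psi>: "\<psi> \<in> jacobi_symbols" and X: "X \<ge> 3"
    and c: "c01 \<ge> 1" "c23 \<ge> 1" "ct0 \<ge> 1" "ct1 \<ge> 1"
  shows "(\<Sum>x\<in>m_range qt rt C X. weighted_T \<psi> q r c01 c23 ct0 ct1 X x) \<le> X ^ 4 * (ln X powr C)\<^sup>2"
proof -
  have pt: "weighted_T \<psi> q r c01 c23 ct0 ct1 X x \<le> X ^ 4" if x: "x \<in> m_range qt rt C X" for x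
  proof -
    obtain m0 m1 where x': "x = (m0, m1)" by (metis surj_pair)
    have m: "m0 > 0" "m1 > 0" using x x' by (auto simp: m_range_def)
    let ?R = "T_range q r c01 c23 ct0 ct1 X m0 m1"
    define n where "n = nat \<lfloor>X\<rfloor>"
    have sub: "?R \<subseteq> {1..n} \<times> {1..n} \<times> {1..n} \<times> {1..n}"
    proof
      fix y assume y: "y \<in> ?R"
      obtain n0 n1 n2 n3 where y': "y = (n0, n1, n2, n3)" by (metis surj_pair)
      define M where "M = max (m0 * ct0) (m1 * ct1)"
      have M1: "M \<ge> 1" unfolding M_def using m(1) c(3) by (simp add: le_max_iff_disj Suc_le_eq)
      have n: "n0 \<ge> 1" "n1 \<ge> 1" "n2 \<ge> 1" "n3 \<ge> 1" "real (max (n0 * n1 * c01) (n2 * n3 * c23) * M) \<le> X"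
        using y by (auto simp: y' T_range_def M_def)
      have le: "k \<le> n" if "k \<le> max (n0 * n1 * c01) (n2 * n3 * c23) * M" for k
      proof -
        have "real k \<le> X" using that n(5) of_nat_mono[OF that, where ?'a = real] by linarith
        then show ?thesis unfolding n_def by (rule le_nat_floor)
      qed
      have up: "k \<le> max (n0 * n1 * c01) (n2 * n3 * c23) * M"
        if "k \<le> n0 * n1 * c01 \<or> k \<le> n2 * n3 * c23" for k
      proof -
        have "k \<le> max (n0 * n1 * c01) (n2 * n3 * c23)" using that by (simp add: le_max_iff_disj)
        also have "\<dots> = max (n0 * n1 * c01) (n2 * n3 * c23) * 1" by simp
        also have "\<dots> \<le> max (n0 * n1 * c01) (n2 * n3 * c23) * M" using M1 by (rule mult_left_mono) simp
        finally show ?thesis .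
      qed
      have three: "a \<le> a * b * d" "b \<le> a * b * d" if "a \<ge> 1" "b \<ge> 1" "d \<ge> 1" for a b d :: nat
        using that by (auto simp: mult.assoc Suc_le_eq mult.commute[of a] mult.left_commute[of a])
      have "n0 \<le> n" "n1 \<le> n" "n2 \<le> n" "n3 \<le> n"
        using le up three[OF n(1,2) c(1)] three[OF n(3,4) c(2)] by blast+
      then show "y \<in> {1..n} \<times> {1..n} \<times> {1..n} \<times> {1..n}" using n by (simp add: y')
    qed
    have "\<bar>T_sum \<psi> q r c01 c23 ct0 ct1 X m0 m1\<bar> \<le> (\<Sum>y\<in>?R. 1)"
      unfolding T_sum_def
    proof (rule order_trans[OF sum_abs sum_mono], safe)
      fix n0 n1 n2 n3 assume y: "(n0, n1, n2, n3) \<in> ?R"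
      have "\<bar>real_of_int (\<psi> (m0 * m1) (n0 * n2))\<bar> \<le> 1"
      proof -
        have "\<psi> (m0 * m1) (n0 * n2) \<in> {-1, 0, 1}" using \<psi> jacobi_values unfolding jacobi_symbols_def by auto
        then show ?thesis by auto
      qed
      moreover have "1 \<le> tau n0 * tau n1 * tau n2 * tau n3"
      proof -
        have "n0 > 0" "n1 > 0" "n2 > 0" "n3 > 0" using y by (auto simp: T_range_def)
        then have "divisor_tau n0 \<ge> 1" "divisor_tau n1 \<ge> 1" "divisor_tau n2 \<ge> 1" "divisor_tau n3 \<ge> 1"
          using divisor_tau_ge_1 by blast+
        then have "1 \<le> divisor_tau n0 * divisor_tau n1 * divisor_tau n2 * divisor_tau n3" by (simp add: Suc_le_eq)
        then have "real 1 \<le> real (divisor_tau n0 * divisor_tau n1 * divisor_tau n2 * divisor_tau n3)" by (rule of_nat_mono)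
        then show ?thesis by simp
      qed
      ultimately show "\<bar>real_of_int (\<psi> (m0 * m1) (n0 * n2)) /
          (tau n0 * tau n1 * tau n2 * tau n3)\<bar> \<le> 1"
        by (simp add: abs_divide divide_le_eq_1)
    qed
    also have "\<dots> = real (card ?R)" by simp
    also have "\<dots> \<le> real (card ({1..n} \<times> {1..n} \<times> {1..n} \<times> {1..n}))"
      unfolding of_nat_le_iff by (rule card_mono[OF _ sub]) auto
    also have "\<dots> = real n ^ 4" by (simp add: card_cartesian_product power4_eq_xxxx)
    also have "\<dots> \<le> X ^ 4" using X by (intro power_mono) (auto simp: n_def)
    finally have T: "\<bar>T_sum \<psi> q r c01 c23 ct0 ct1 X m0 m1\<bar> \<le> X ^ 4" .
    have w: "real_of_int ((moebius (m0 * m1))\<^sup>2) / (tau m0 * tau m1) \<le> 1"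
    proof -
      have "real_of_int ((moebius (m0 * m1))\<^sup>2) \<le> 1" by (simp add: moebius_def power_mult[symmetric] mult.commute)
      moreover have "1 \<le> tau m0 * tau m1"
      proof -
        have "1 * 1 \<le> divisor_tau m0 * divisor_tau m1" using m by (intro mult_mono divisor_tau_ge_1) auto
        then have "real (1 * 1) \<le> real (divisor_tau m0 * divisor_tau m1)" by (rule of_nat_mono)
        then show ?thesis by simp
      qed
      ultimately show ?thesis by (simp add: divide_le_eq_1)
    qed
    have "weighted_T \<psi> q r c01 c23 ct0 ct1 X x \<le> 1 * X ^ 4"
      unfolding weighted_T_def x' prod.case using w T by (intro mult_mono) auto
    then show ?thesis by simp
  qed
  have "(\<Sum>x\<in>m_range qt rt C X. weighted_T \<psi> q r c01 c23 ct0 ct1 X x) \<le> (\<Sum>x\<in>m_range qt rt C X. X ^ 4)"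
    by (rule sum_mono[OF pt])
  also have "\<dots> = real (card (m_range qt rt C X)) * X ^ 4" by simp
  also have "\<dots> \<le> (ln X powr C)\<^sup>2 * X ^ 4"
  proof (rule mult_right_mono)
    define k where "k = nat \<lfloor>ln X powr C\<rfloor>"
    have "m_range qt rt C X \<subseteq> {1..k} \<times> {1..k}"
      by (auto simp: m_range_def k_def intro!: le_nat_floor)
    then have "card (m_range qt rt C X) \<le> card ({1..k} \<times> {1..k})" by (intro card_mono) auto
    then have "real (card (m_range qt rt C X)) \<le> real (card ({1..k} \<times> {1..k}))" by (rule of_nat_mono)
    also have "\<dots> = (real k)\<^sup>2" by (simp add: card_cartesian_product power2_eq_square)
    also have "\<dots> \<le> (ln X powr C)\<^sup>2" unfolding k_def by (intro power_mono) auto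
    finally show "real (card (m_range qt rt C X)) \<le> (ln X powr C)\<^sup>2" .
  qed (use X in auto)
  finally show ?thesis by (simp add: mult.commute)
qed

text \<open>The hypotheses on \<open>X\<close> hold from some point on that depends on \<open>C2\<close> and \<open>C3\<close>. The number of dyadic
  blocks is \<open>O(ln (ln X))\<close>, as \<open>M\<close> is at most a power of \<open>ln X\<close>.\<close>

lemma weighted_T_sum_large:
  assumes C: "C1 > 0" "C2 > 0" "C3 > 0"
    and \<psi>: "\<psi> \<in> jacobi_symbols"
    and q: "\<And>i. i < 4 \<Longrightarrow> odd (q i)" and qt: "odd (qt 0)" "odd (qt 1)"
    and r: "\<And>i. i < 4 \<Longrightarrow> 1 \<le> r i \<and> real (r i) \<le> ln X powr C1"
    and c: "\<And>c. c \<in> {c01, c23, ct0, ct1} \<Longrightarrow> 1 \<le> c \<and> real c \<le> ln X powr C2"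
    and X: "X \<ge> 3" "1 \<le> ln (ln X)" "ln X powr (2 * C2 + C3) * (4 * (sqrt X + 1)) \<le> X"
      "32 * ln X powr (2 * (C2 + C3)) \<le> sqrt X"
      "(1 + 2 * ln (32 * ln X powr (2 * (C2 + C3))))\<^sup>2 \<le> ln X / 2"
  shows "(\<Sum>x\<in>m_range qt rt C3 X. weighted_T \<psi> q r c01 c23 ct0 ct1 X x) \<le>
    768 * box_const * pointwise_const * exp 12 * (10 + 2 * C1) * (2 * (C2 + C3) + 2) *
    (tau (r 0) * tau (r 2) * X\<^sup>2 * sqrt (ln (ln X)) /
     (real c01 * real c23 * real ct0 * real ct1 * ln X))"
proof -
  define x where "x = ln X"
  define y where "y = ln x"
  define M where "M = (\<lambda>(m0, m1). max (m0 * ct0) (m1 * ct1))"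
  define J where "J = nat \<lfloor>2 * (C2 + C3) * y\<rfloor>"
  define R where "R = recip_prime_weight (r 0) * recip_prime_weight (r 1) * (recip_prime_weight (r 2) * recip_prime_weight (r 3))"
  define G where "G = 2 * pointwise_const * sqrt R * (X\<^sup>2 / (real c01 * real c23 * ln X))"
  have x1: "x > 1" using X(1) ln3_gt_one ln_mono[of 3 X] unfolding x_def by linarith
  have y1: "y \<ge> 1" using X(2) by (simp add: x_def y_def)
  have pc: "pointwise_const \<ge> 0" by (simp add: pointwise_const_def)
  have bc: "box_const \<ge> 0" using mean_square_const_pos by (simp add: box_const_def)
  note ln2 = ln2_ge_half
  have c0: "c01 > 0" "c23 > 0" "ct0 > 0" "ct1 > 0" using c by force+
  have cle: "real c01 \<le> x powr C2" "real c23 \<le> x powr C2" "real ct0 \<le> x powr C2" "real ct1 \<le> x powr C2"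
    using c by (auto simp: x_def)
  have r0: "r i > 0" if "i < 4" for i using r[OF that] by simp
  have G0: "G \<ge> 0" unfolding G_def using pc X(1) by (auto simp: R_def recip_prime_weight_def)
  have M_le: "real (M m) \<le> x powr (C2 + C3)" "M m > 0" if "m \<in> m_range qt rt C3 X" for m
  proof -
    obtain m0 m1 where m: "m = (m0, m1)" by (metis surj_pair)
    have mm: "m0 > 0" "m1 > 0" "real (max m0 m1) \<le> x powr C3"
      using that m by (auto simp: m_range_def x_def)
    have "real m0 \<le> x powr C3" "real m1 \<le> x powr C3" using mm(3) by (auto simp: of_nat_max)
    then have "real m0 * real ct0 \<le> x powr C3 * x powr C2" "real m1 * real ct1 \<le> x powr C3 * x powr C2"
      using cle by (auto intro!: mult_mono)
    then show "real (M m) \<le> x powr (C2 + C3)"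
      by (simp add: M_def m of_nat_max powr_add mult.commute)
    show "M m > 0" using mm c0 by (simp add: M_def m less_max_iff_disj)
  qed
  define block where "block j = {(m0, m1) \<in> m_range qt rt C3 X. 2 ^ j \<le> max (m0 * ct0) (m1 * ct1) \<and> max (m0 * ct0) (m1 * ct1) < 2 ^ (j + 1)}" for j
  have fin: "finite (block j)" for j
    by (rule finite_subset[OF _ finite_m_range]) (auto simp: block_def)
  have w0: "weighted_T \<psi> q r c01 c23 ct0 ct1 X m \<ge> 0" for m
    by (auto simp: weighted_T_def split: prod.split)
  define f where "f j = (if max ct0 ct1 \<le> 2 ^ (j + 1) then
      64 * box_const * G / (real ct0 * real ct1) * (1 + ln (real (2 ^ (j + 1) div max ct0 ct1))) powr (- (5 / 8)) else 0)" for j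
  have f0: "f j \<ge> 0" for j unfolding f_def using bc G0 by auto
  have blk: "(\<Sum>m\<in>block j. weighted_T \<psi> q r c01 c23 ct0 ct1 X m) \<le> f j" for j
  proof (cases "block j = {}")
    case True
    then show ?thesis using f0 by simp
  next
    case False
    then obtain m where m: "m \<in> block j" by blast
    obtain m0 m1 where m': "m = (m0, m1)" by (metis surj_pair)
    have jM: "2 ^ j \<le> M m" and mr: "m \<in> m_range qt rt C3 X" using m m' by (auto simp: block_def M_def)
    have "real (2 ^ j) \<le> real (M m)" using jM by (rule of_nat_mono)
    then have "real (2 ^ j) \<le> x powr (C2 + C3)" using M_le(1)[OF mr] by (rule order_trans)
    then have "2 ^ j \<le> x powr (C2 + C3)" by simp
    then have j2: "2 ^ (j + 1) \<le> 2 * x powr (C2 + C3)" by simp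
    have cX: "2 ^ (j + 1) * real cc * (sqrt X + 1) \<le> X" if "real cc \<le> x powr C2" for cc
    proof -
      have "2 ^ (j + 1) * real cc * (sqrt X + 1) \<le> (2 * x powr (C2 + C3)) * x powr C2 * (sqrt X + 1)"
        using j2 that X(1) by (intro mult_right_mono mult_mono) auto
      also have "\<dots> = x powr (2 * C2 + C3) * (2 * (sqrt X + 1))"
      proof -
        have "x powr (C2 + C3) * x powr C2 = x powr (2 * C2 + C3)"
          unfolding powr_add[symmetric] by (simp add: algebra_simps)
        then show ?thesis by (metis (no_types) mult.assoc mult.commute)
      qed
      also have "\<dots> \<le> x powr (2 * C2 + C3) * (4 * (sqrt X + 1))"
        using X(1) by (intro mult_left_mono) auto
      also have "\<dots> \<le> X" using X(3) by (simp add: x_def)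
      finally show ?thesis .
    qed
    have lev: "real (box_level (2 ^ (j + 1))) \<le> 32 * x powr (2 * (C2 + C3))"
    proof -
      have "real (box_level (2 ^ (j + 1))) = 8 * (2 ^ (j + 1))\<^sup>2" by (simp add: box_level_def)
      also have "\<dots> \<le> 8 * (2 * x powr (C2 + C3))\<^sup>2"
        using j2 by (intro mult_left_mono power_mono) auto
      also have "\<dots> = 32 * (x powr (C2 + C3) * x powr (C2 + C3))" by (simp add: power2_eq_square)
      also have "\<dots> = 32 * x powr (2 * (C2 + C3))" unfolding powr_add[symmetric] by simp
      finally show ?thesis .
    qed
    have lev1: "box_level (2 ^ (j + 1)) \<ge> 8" by (rule box_cutoff_bounds(2)) simp
    have Q1: "real (box_level (2 ^ (j + 1))) \<le> sqrt X" using lev X(4) by (simp add: x_def)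
    have "ln (real (box_level (2 ^ (j + 1)))) \<le> ln (32 * x powr (2 * (C2 + C3)))"
      using lev lev1 by (intro ln_mono) auto
    then have "(1 + 2 * ln (real (box_level (2 ^ (j + 1)))))\<^sup>2 \<le> (1 + 2 * ln (32 * x powr (2 * (C2 + C3))))\<^sup>2"
      using lev1 by (intro power_mono) auto
    then have Q2: "(1 + 2 * ln (real (box_level (2 ^ (j + 1)))))\<^sup>2 \<le> ln X / 2" using X(5) by (simp add: x_def)
    have X1: "X > 1" using X(1) by simp
    have "(\<Sum>(m0, m1)\<in>block j. weighted_T \<psi> q r c01 c23 ct0 ct1 X (m0, m1)) \<le> f j"
      unfolding block_def f_def
      by (rule dyadic_block_sum_le[OF \<psi> q r0 qt c0 X1 cX[OF cle(1)] cX[OF cle(2)] Q1 Q2]) (simp_all add: G_def R_def)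
    then show ?thesis by (simp add: case_prod_unfold)
  qed
  have cover: "\<exists>j\<in>{0..J}. m \<in> block j" if m: "m \<in> m_range qt rt C3 X" for m
  proof -
    obtain m0 m1 where m': "m = (m0, m1)" by (metis surj_pair)
    obtain j where j: "2 ^ j \<le> M m" "M m < 2 ^ (j + 1)"
      using ex_power_ivl1[of 2 "M m"] M_le(2)[OF m] by auto
    have "real (2 ^ j) \<le> real (M m)" using j(1) by (rule of_nat_mono)
    then have "real (2 ^ j) \<le> x powr (C2 + C3)" using M_le(1)[OF m] by (rule order_trans)
    then have "ln (real (2 ^ j)) \<le> ln (x powr (C2 + C3))" by (intro ln_mono) auto
    then have "real j * ln 2 \<le> (C2 + C3) * y" using x1 by (simp add: ln_realpow ln_powr y_def)
    moreover have "real j * (1 / 2) \<le> real j * ln 2" using ln2 by (intro mult_left_mono) auto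
    ultimately have "real j \<le> 2 * ((C2 + C3) * y)" by linarith
    then have "real j \<le> 2 * (C2 + C3) * y" by (simp only: mult.assoc)
    then have "j \<le> J" unfolding J_def by (rule le_nat_floor)
    moreover have "m \<in> block j" using m m' j by (simp add: block_def M_def)
    ultimately show ?thesis by auto
  qed
  have "(\<Sum>m\<in>m_range qt rt C3 X. weighted_T \<psi> q r c01 c23 ct0 ct1 X m) \<le>
      (\<Sum>(j, m)\<in>Sigma {0..J} block. weighted_T \<psi> q r c01 c23 ct0 ct1 X m)"
    by (rule sum_le_included[where i = snd]) (use cover fin w0 in \<open>force+\<close>)
  also have "\<dots> = (\<Sum>j\<in>{0..J}. \<Sum>m\<in>block j. weighted_T \<psi> q r c01 c23 ct0 ct1 X m)"
    by (rule sum.Sigma[symmetric]) (use fin in auto)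
  also have "\<dots> \<le> (\<Sum>j\<in>{0..J}. f j)" by (intro sum_mono blk)
  also have "\<dots> = (\<Sum>j\<in>{j \<in> {0..J}. max ct0 ct1 \<le> 2 ^ (j + 1)}.
      64 * box_const * G / (real ct0 * real ct1) * (1 + ln (real (2 ^ (j + 1) div max ct0 ct1))) powr (- (5 / 8)))"
    unfolding f_def by (rule sum.inter_filter[symmetric]) simp
  also have "\<dots> = 64 * box_const * G / (real ct0 * real ct1) *
      (\<Sum>j\<in>{j \<in> {0..J}. max ct0 ct1 \<le> 2 ^ (j + 1)}. (1 + ln (real (2 ^ (j + 1) div max ct0 ct1))) powr (- (5 / 8)))"
    by (rule sum_distrib_left[symmetric])
  also have "\<dots> \<le> 64 * box_const * G / (real ct0 * real ct1) * (6 * (1 + real J) powr (3 / 8))"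
    using bc G0 c0 by (intro mult_left_mono dyadic_sum_le) auto
  also have "\<dots> \<le> 64 * box_const * G / (real ct0 * real ct1) * (6 * ((2 * (C2 + C3) + 2) * y powr (3 / 8)))"
  proof (intro mult_left_mono)
    have "real J \<le> 2 * (C2 + C3) * y" unfolding J_def using C y1 by simp
    then have "1 + real J \<le> (2 * (C2 + C3) + 1) * y" using y1 by (simp add: algebra_simps)
    then have "(1 + real J) powr (3 / 8) \<le> ((2 * (C2 + C3) + 1) * y) powr (3 / 8)" by (intro powr_mono2) auto
    also have "\<dots> = (2 * (C2 + C3) + 1) powr (3 / 8) * y powr (3 / 8)" by (rule powr_mult)
    also have "\<dots> \<le> (2 * (C2 + C3) + 1) powr 1 * y powr (3 / 8)"
      using C by (intro mult_right_mono powr_mono) auto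
    also have "\<dots> \<le> (2 * (C2 + C3) + 2) * y powr (3 / 8)" using C by (intro mult_right_mono) auto
    finally show "(1 + real J) powr (3 / 8) \<le> (2 * (C2 + C3) + 2) * y powr (3 / 8)" .
  qed (use bc G0 c0 in auto)
  also have "\<dots> \<le> 64 * box_const * (2 * pointwise_const *
      (exp 12 * (10 + 2 * C1) * tau (r 0) * tau (r 2) * y powr (1 / 8)) *
      (X\<^sup>2 / (real c01 * real c23 * ln X))) / (real ct0 * real ct1) * (6 * ((2 * (C2 + C3) + 2) * y powr (3 / 8)))"
  proof (intro mult_right_mono divide_right_mono mult_left_mono)
    have big: "recip_prime_weight (r i) \<le> exp 6 * (10 + 2 * C1) * y powr (1 / 8)" if "i < 4" for i
      unfolding y_def using r[OF that] C(1) x1 y1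
      by (intro recip_prime_weight_small) (auto simp: x_def y_def)
    define t0 where "t0 = tau (r 0)"
    define t2 where "t2 = tau (r 2)"
    have t: "t0 \<ge> 1" "t2 \<ge> 1" unfolding t0_def t2_def using divisor_tau_ge_1[of "r 0"] divisor_tau_ge_1[of "r 2"] r0 by (simp_all add: Suc_le_eq)
    define B where "B = exp 6 * (10 + 2 * C1) * y powr (1 / 8)"
    have B0: "B \<ge> 0" unfolding B_def using C by simp
    have nn: "recip_prime_weight s \<ge> 0" for s by (simp add: recip_prime_weight_def)
    have "R \<le> (exp 6 * t0) * B * ((exp 6 * t2) * B)"
      unfolding R_def B_def t0_def t2_def
      by (intro mult_mono recip_prime_weight_le_tau big r0 nn mult_nonneg_nonneg) (use C in auto)
    also have "\<dots> = (exp 6 * B)\<^sup>2 * (t0 * t2)" by (simp add: power2_eq_square)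
    also have "\<dots> \<le> (exp 6 * B)\<^sup>2 * (t0 * t2)\<^sup>2"
    proof (rule mult_left_mono)
      have "1 * 1 \<le> t0 * t2" using t by (intro mult_mono) auto
      then show "t0 * t2 \<le> (t0 * t2)\<^sup>2" using self_le_power[of "t0 * t2" 2] by simp
    qed simp
    also have "\<dots> = (exp 6 * B * (t0 * t2))\<^sup>2" by (simp add: power_mult_distrib)
    finally have "sqrt R \<le> exp 6 * B * (t0 * t2)"
      using B0 t by (intro real_le_lsqrt) auto
    also have "\<dots> = exp 12 * (10 + 2 * C1) * t0 * t2 * y powr (1 / 8)"
    proof -
      have "exp 12 = exp 6 * exp (6 :: real)" unfolding exp_add[symmetric] by simp
      then show ?thesis by (simp add: B_def mult_ac)
    qed
    finally have "sqrt R \<le> exp 12 * (10 + 2 * C1) * t0 * t2 * y powr (1 / 8)" .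
    then show "G \<le> 2 * pointwise_const *
      (exp 12 * (10 + 2 * C1) * tau (r 0) * tau (r 2) * y powr (1 / 8)) *
      (X\<^sup>2 / (real c01 * real c23 * ln X))"
      unfolding G_def t0_def t2_def using pc X(1) by (intro mult_right_mono mult_left_mono) auto
  qed (use bc C in auto)
  also have "\<dots> = 768 * box_const * pointwise_const * exp 12 * (10 + 2 * C1) * (2 * (C2 + C3) + 2) *
    (tau (r 0) * tau (r 2) * X\<^sup>2 * (y powr (1 / 8) * y powr (3 / 8)) /
     (real c01 * real c23 * real ct0 * real ct1 * ln X))"
    by (simp add: mult_ac)
  also have "y powr (1 / 8) * y powr (3 / 8) = sqrt (ln (ln X))"
  proof -
    have "y powr (1 / 8) * y powr (3 / 8) = y powr (1 / 2)" unfolding powr_add[symmetric] by simp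
    then show ?thesis using y1 by (simp add: powr_half_sqrt y_def x_def)
  qed
  finally show ?thesis .
qed

lemma coprime_8_odd:
  fixes n :: nat
  assumes "coprime n 8"
  shows "odd n"
proof
  assume "even n"
  then have "is_unit (2 :: nat)" using coprime_common_divisor[OF assms, of 2] by simp
  then show False by simp
qed

theorem proposition6p6:
  fixes C1 C2 C3 :: real
  assumes "C1 > 0" and "C2 > 0" and "C3 > 0"
  shows "\<exists>K>0. \<forall>\<psi> \<in> jacobi_symbols.
    \<forall>(X :: real) (q :: nat \<Rightarrow> nat) (qt :: nat \<Rightarrow> nat) (r :: nat \<Rightarrow> nat) (rt :: nat \<Rightarrow> nat)
      (c01 :: nat) (c23 :: nat) (ct0 :: nat) (ct1 :: nat).
      X \<ge> 3 \<longrightarrow>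
      (\<forall>i<4. coprime (q i) 8) \<longrightarrow>
      (\<forall>i<2. coprime (qt i) 8) \<longrightarrow>
      (\<forall>i<4. odd (r i) \<and> 1 \<le> r i \<and> real (r i) \<le> ln X powr C1) \<longrightarrow>
      (\<forall>i<2. odd (rt i) \<and> 1 \<le> rt i \<and> real (rt i) \<le> ln X powr C1) \<longrightarrow>
      (\<forall>c \<in> {c01, c23, ct0, ct1}. 1 \<le> c \<and> real c \<le> ln X powr C2) \<longrightarrow>
      (\<Sum>(m0, m1) \<in> m_range qt rt C3 X.
         real_of_int ((moebius (m0 * m1))\<^sup>2) / (real (divisor_tau m0) * real (divisor_tau m1)) *
         \<bar>T_sum \<psi> q r c01 c23 ct0 ct1 X m0 m1\<bar>)
      \<le> K * (real (divisor_tau (r 0)) * real (divisor_tau (r 2)) * X\<^sup>2 * sqrt (ln (ln X)) /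
             (real c01 * real c23 * real ct0 * real ct1 * ln X))"
proof -
  have ev: "eventually (\<lambda>X. 1 \<le> ln (ln X) \<and> ln X powr (2 * C2 + C3) * (4 * (sqrt X + 1)) \<le> X \<and>
      32 * ln X powr (2 * (C2 + C3)) \<le> sqrt X \<and>
      (1 + 2 * ln (32 * ln X powr (2 * (C2 + C3))))\<^sup>2 \<le> ln X / 2) (at_top :: real filter)"
    (is "eventually ?big at_top")
  proof (intro eventually_conj)
    define c where "c = 2 * (C2 + C3)"
    define d where "d = 2 * C2 + C3"
    have cd: "c > 0" "d > 0" using assms by (auto simp: c_def d_def)
    show "eventually (\<lambda>X :: real. 1 \<le> ln (ln X)) at_top" by real_asymp
    show "eventually (\<lambda>X :: real. ln X powr (2 * C2 + C3) * (4 * (sqrt X + 1)) \<le> X) at_top"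
      unfolding d_def[symmetric] using cd by real_asymp
    show "eventually (\<lambda>X :: real. 32 * ln X powr (2 * (C2 + C3)) \<le> sqrt X) at_top"
      unfolding c_def[symmetric] using cd by real_asymp
    show "eventually (\<lambda>X :: real. (1 + 2 * ln (32 * ln X powr (2 * (C2 + C3))))\<^sup>2 \<le> ln X / 2) at_top"
      unfolding c_def[symmetric] using cd by real_asymp
  qed
  then obtain X0 where X0: "\<And>X. X \<ge> X0 \<Longrightarrow> ?big X" unfolding eventually_at_top_linorder by blast
  define X1 where "X1 = max X0 3"
  define V where "V = ln X1 powr C2"
  define L where "L = X1 ^ 4 * (ln X1 powr C3)\<^sup>2"
  \<comment> \<open>For \<open>3 \<le> X \<le> X1\<close> the left side is at most \<open>L\<close>, and the expression multiplied by \<open>K\<close> is at least \<open>b\<close>.\<close>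
  define b where "b = 9 * sqrt (ln (ln 3)) / (V * V * V * V * ln X1)"
  define K1 where "K1 = 768 * box_const * pointwise_const * exp 12 * (10 + 2 * C1) * (2 * (C2 + C3) + 2)"
  define K where "K = K1 + L / b + 1"
  have X1: "X1 \<ge> 3" "X1 \<ge> X0" by (auto simp: X1_def)
  have lnX1: "ln X1 > 1" using X1 ln3_gt_one ln_mono[of 3 X1] by linarith
  have V0: "V > 0" using lnX1 by (simp add: V_def)
  have b0: "b > 0" unfolding b_def using V0 lnX1 ln3_gt_one by simp
  have L0: "L \<ge> 0" using X1 by (simp add: L_def)
  have K10: "K1 \<ge> 0"
    unfolding K1_def using assms mean_square_const_pos by (auto simp: box_const_def pointwise_const_def)
  have Kpos: "K > 0" unfolding K_def using K10 L0 b0 by (simp add: add_nonneg_pos)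
  have main: "(\<Sum>x\<in>m_range qt rt C3 X. weighted_T \<psi> q r c01 c23 ct0 ct1 X x) \<le>
      K * (real (divisor_tau (r 0)) * real (divisor_tau (r 2)) * X\<^sup>2 * sqrt (ln (ln X)) /
           (real c01 * real c23 * real ct0 * real ct1 * ln X))"
    if \<psi>: "\<psi> \<in> jacobi_symbols" and X: "X \<ge> 3"
      and q: "\<forall>i<4. coprime (q i) 8" and qt: "\<forall>i<2. coprime (qt i) 8"
      and r: "\<forall>i<4. odd (r i) \<and> 1 \<le> r i \<and> real (r i) \<le> ln X powr C1"
      and c: "\<forall>c \<in> {c01, c23, ct0, ct1}. 1 \<le> c \<and> real c \<le> ln X powr C2"
    for \<psi> X q qt r rt c01 c23 ct0 ct1
  proof -
    define W where "W = real (divisor_tau (r 0)) * real (divisor_tau (r 2)) * X\<^sup>2 * sqrt (ln (ln X)) /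
           (real c01 * real c23 * real ct0 * real ct1 * ln X)"
    have lnX: "ln X > 1" using X ln3_gt_one ln_mono[of 3 X] by linarith
    have lnlnX: "ln (ln X) \<ge> ln (ln 3)" using X ln3_gt_one by (intro ln_mono) auto
    have lnln3: "ln (ln 3) > (0 :: real)" using ln3_gt_one by simp
    have W0: "W \<ge> 0" unfolding W_def using lnX lnlnX lnln3 by simp
    have c1: "c01 \<ge> 1" "c23 \<ge> 1" "ct0 \<ge> 1" "ct1 \<ge> 1" using c by auto
    have "(\<Sum>x\<in>m_range qt rt C3 X. weighted_T \<psi> q r c01 c23 ct0 ct1 X x) \<le> K * W"
    proof (cases "X \<ge> X1")
      case True
      then have "X \<ge> X0" using X1 by simp
      note big = X0[OF this]
      have qo: "odd (q i)" if "i < 4" for i using q that coprime_8_odd by blast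
      have qto: "odd (qt 0)" "odd (qt 1)" using qt coprime_8_odd by auto
      have "(\<Sum>x\<in>m_range qt rt C3 X. weighted_T \<psi> q r c01 c23 ct0 ct1 X x) \<le> K1 * W"
        unfolding K1_def W_def
        by (rule weighted_T_sum_large[OF assms \<psi> qo qto _ _ X]) (use r c big in auto)
      also have "\<dots> \<le> K * W"
        unfolding K_def using W0 L0 b0 by (intro mult_right_mono) auto
      finally show ?thesis .
    next
      case False
      then have XX1: "X \<le> X1" by simp
      have lnle: "ln X \<le> ln X1" using XX1 X by (intro ln_mono) auto
      have "(\<Sum>x\<in>m_range qt rt C3 X. weighted_T \<psi> q r c01 c23 ct0 ct1 X x) \<le> X ^ 4 * (ln X powr C3)\<^sup>2"
        by (rule weighted_T_sum_small[OF \<psi> X c1])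
      also have "\<dots> \<le> L"
        unfolding L_def using XX1 X lnle lnX assms
        by (intro mult_mono power_mono powr_mono2) auto
      also have "L = L / b * b" using b0 by simp
      also have "\<dots> \<le> L / b * W"
      proof (rule mult_left_mono)
        have cV: "real c \<le> V" if "c \<in> {c01, c23, ct0, ct1}" for c
        proof -
          have "real c \<le> ln X powr C2" using c that by blast
          also have "\<dots> \<le> V" unfolding V_def using lnle lnX assms by (intro powr_mono2) auto
          finally show ?thesis .
        qed
        have t: "real (divisor_tau (r 0)) \<ge> 1" "real (divisor_tau (r 2)) \<ge> 1"
          using divisor_tau_ge_1[of "r 0"] divisor_tau_ge_1[of "r 2"] r by (auto simp: Suc_le_eq)
        have "3\<^sup>2 \<le> X\<^sup>2" using X by (intro power_mono) auto
        then have "1 * 1 * 9 * sqrt (ln (ln 3)) \<le>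
            real (divisor_tau (r 0)) * real (divisor_tau (r 2)) * X\<^sup>2 * sqrt (ln (ln X))"
          using t lnlnX lnln3 by (intro mult_mono) auto
        then have "9 * sqrt (ln (ln 3)) \<le>
            real (divisor_tau (r 0)) * real (divisor_tau (r 2)) * X\<^sup>2 * sqrt (ln (ln X))"
          by simp
        moreover have "real c01 * real c23 * real ct0 * real ct1 * ln X \<le> V * V * V * V * ln X1"
          using cV lnle lnX V0 by (intro mult_mono) auto
        moreover have "0 < real c01 * real c23 * real ct0 * real ct1 * ln X" using c1 lnX by simp
        moreover have "0 \<le> real (divisor_tau (r 0)) * real (divisor_tau (r 2)) * X\<^sup>2 * sqrt (ln (ln X))"
        proof -
          have "ln (ln X) \<ge> 0" using lnlnX lnln3 by linarith
          then show ?thesis by simp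
        qed
        ultimately show "b \<le> W"
          unfolding b_def W_def by (intro frac_le) assumption+
      qed (use L0 b0 in simp)
      also have "\<dots> \<le> K * W" unfolding K_def using W0 K10 by (intro mult_right_mono) auto
      finally show ?thesis .
    qed
    then show ?thesis unfolding W_def .
  qed
  show ?thesis
  proof (intro exI[of _ K] conjI Kpos ballI allI impI, goal_cases)
    case (1 \<psi> X q qt r rt c01 c23 ct0 ct1)
    from main[OF 1(1-5) 1(7), of rt] show ?case
      by (simp only: weighted_T_def case_prod_unfold)
  qed
qed

end
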